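(* Fix integers $d_1,d_2\ge1$, $s>0$ with $4s>d_1+d_2$, $L>0$, $\alpha\in(0,e^{-1})$ and $\beta\in(0,1-\alpha)$. There is a sufficiently large constant $C(s,d_1,d_2,L,\alpha,\beta)>0$ such that for all $n\ge4$, whenever $$\epsilon_n\ \ge\ C(s,d_1,d_2,L,\alpha,\beta)\left(\frac{\log\log n}{n}\right)^{\frac{2s}{4s+d_1+d_2}},$$ for testing $\mathcal{P}_0=\{P_{YZ}\in\mathcal{P}^{(d_1+d_2,s)}_{\text{Hölder}}:f_{YZ}=f_Yf_Z\}$ against $\mathcal{P}_1=\{P_{YZ}\in\mathcal{P}^{(d_1+d_2,s)}_{\text{Hölder}}:\|f_{YZ}-f_Yf_Z\|_{L_2}\ge\epsilon_n\}$, the adaptive permutation test $\phi^\dagger_{\rm adapt}$ defined in the context (which does not depend on $s$) satisfies $$\sup_{P\in\mathcal{P}_0}\mathbb{P}_P(\phi^\dagger_{\rm adapt}=1)\le\alpha\quad\text{and}\quad\sup_{P\in\mathcal{P}_1}\mathbb{P}_P(\phi^\dagger_{\rm adapt}=0)\le\beta .$$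
   Context: Hölder class: $\mathcal{H}^{d_1+d_2}_s(L)$ is the class of functions $f:[0,1]^{d_1+d_2}\to\mathbb{R}$ with (1) $|f^{(\lfloor s\rfloor)}(x)-f^{(\lfloor s\rfloor)}(x')|\le L\|x-x'\|^{s-\lfloor s\rfloor}$ for all $x,x'$, and (2) $\|f^{(s')}\|_\infty\le L$ for each $s'\in\{1,\dots,\lfloor s\rfloor\}$, where $f^{(k)}$ denotes the $k$-th order derivative (the array of all order-$k$ partial derivatives). $\mathcal{P}^{(d_1+d_2,s)}_{\text{Hölder}}$ is the set of joint distributions $P_{YZ}$ of $(Y,Z)\in[0,1]^{d_1}\times[0,1]^{d_2}$ such that both the joint Lebesgue density $f_{YZ}$ and the product of marginal densities $f_Yf_Z$ belong to $\mathcal{H}^{d_1+d_2}_s(L)$. $\|f\|_{L_2}^2=\int f^2$. Data: $X_i=(Y_i,Z_i)$, $i=1,\dots,n$, i.i.d. from $P_{YZ}$. Single test: for an integer $\kappa\ge1$ and level $a\in(0,1)$, partition $[0,1]^{d_1}$ and $[0,1]^{d_2}$ into hypercubes of side length $\kappa^{-1}$; let $g_Y(y_1,y_2)=1$ if $y_1,y_2$ lie in the same hypercube of $[0,1]^{d_1}$ and $0$ otherwise, and $g_Z$ similarly on $[0,1]^{d_2}$. For $x_i=(y_i,z_i)$ let $$h_{\rm in}(x_1,x_2,x_3,x_4):=\{g_Y(y_1,y_2)+g_Y(y_3,y_4)-g_Y(y_1,y_3)-g_Y(y_2,y_4)\}\cdot\{g_Z(z_1,z_2)+g_Z(z_3,z_4)-g_Z(z_1,z_3)-g_Z(z_2,z_4)\}$$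 and let $U_n$ be the average of $h_{\rm in}(X_{i_1},X_{i_2},X_{i_3},X_{i_4})$ over all ordered 4-tuples of distinct indices in $\{1,\dots,n\}$. For a permutation $\pi$ of $\{1,\dots,n\}$, $U_n^\pi$ is $U_n$ computed from $(Y_1,Z_{\pi_1}),\dots,(Y_n,Z_{\pi_n})$, $c_{1-a,n}:=\inf\{t:\frac1{n!}\sum_\pi\mathbb{1}(U_n^\pi\le t)\ge1-a\}$, and $\phi^\dagger_{\kappa,a}:=\mathbb{1}(U_n>c_{1-a,n})$. Adaptive test: $\gamma^*_{\max}:=\left\lceil\frac{2}{d_1+d_2}\log_2\left(\frac{n}{\log\log n}\right)\right\rceil$, $\mathsf{K}^\dagger:=\{2^j:j=1,\dots,\gamma^*_{\max}\}$ and $\phi^\dagger_{\rm adapt}:=\max_{\kappa\in\mathsf{K}^\dagger}\phi^\dagger_{\kappa,\alpha/\gamma^*_{\max}}$. *)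

theory Defs
  imports "HOL-Probability.Probability" "HOL-Combinatorics.Permutations"
begin

section \<open>The Hoelder class\<close>

definition unit_cube :: "'a::euclidean_space set" where
  "unit_cube = cbox 0 (\<Sum>Basis)"

text \<open>
  For \<open>bs = [b\<^sub>1, \<dots>, b\<^sub>k]\<close> a list of coordinate directions with \<open>k \<le> m\<close>, the function \<open>D bs\<close> is
  the partial derivative \<open>\<partial>\<^sub>b\<^sub>1 \<dots> \<partial>\<^sub>b\<^sub>k f\<close> on the closed cube, one-sided at boundary points.
  All partial derivatives up to order \<open>m\<close> are required to exist.  The values of such a \<open>D\<close> on the
  cube are uniquely determined, because every coordinate line through a point of the cube meets
  the cube in a segment of length 1.
\<close>
definition partial_derivs :: "nat \<Rightarrow> ('a::euclidean_space \<Rightarrow> real) \<Rightarrow> ('a list \<Rightarrow> 'a \<Rightarrow> real) \<Rightarrow> bool" where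
  "partial_derivs m f D \<longleftrightarrow>
     (\<forall>x\<in>unit_cube. D [] x = f x) \<and>
     (\<forall>bs b. set bs \<subseteq> Basis \<and> b \<in> Basis \<and> length bs < m \<longrightarrow>
        (\<forall>x\<in>unit_cube.
           ((\<lambda>t. D bs (x + t *\<^sub>R b)) has_real_derivative D (b # bs) x)
             (at 0 within {t. x + t *\<^sub>R b \<in> unit_cube})))"

text \<open>
  The bounds on the array of order-\<open>k\<close> partial derivatives are imposed entrywise, i.e. arrays carry
  the maximum norm.  The Euclidean norm of the array would give a smaller class for the same \<open>L\<close>,
  and the two families of classes agree up to a rescaling of \<open>L\<close>.  Only the values of \<open>f\<close> on the
  cube matter.  For integer \<open>s\<close> the exponent of the first bound is 0; the HOL convention
  \<open>0 powr 0 = 0\<close> is harmless, since it only concerns \<open>x = x'\<close>.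
\<close>
definition holder_class :: "real \<Rightarrow> real \<Rightarrow> ('a::euclidean_space \<Rightarrow> real) set" where
  "holder_class s L = {f. \<exists>D. partial_derivs (nat \<lfloor>s\<rfloor>) f D \<and>
     (\<forall>bs. set bs \<subseteq> Basis \<and> length bs = nat \<lfloor>s\<rfloor> \<longrightarrow>
        (\<forall>x\<in>unit_cube. \<forall>x'\<in>unit_cube.
           \<bar>D bs x - D bs x'\<bar> \<le> L * norm (x - x') powr (s - of_int \<lfloor>s\<rfloor>))) \<and>
     (\<forall>k\<in>{1..nat \<lfloor>s\<rfloor>}. \<forall>bs. set bs \<subseteq> Basis \<and> length bs = k \<longrightarrow>
        (\<forall>x\<in>unit_cube. \<bar>D bs x\<bar> \<le> L))}"


section \<open>Distributions and hypotheses\<close>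

definition joint_density :: "('a::euclidean_space \<times> 'b::euclidean_space) measure \<Rightarrow> 'a \<times> 'b \<Rightarrow> real" where
  "joint_density P x = enn2real (RN_deriv lborel P x)"

definition product_density :: "('a::euclidean_space \<times> 'b::euclidean_space) measure \<Rightarrow> 'a \<times> 'b \<Rightarrow> real" where
  "product_density P x =
     enn2real (RN_deriv lborel (distr P borel fst) (fst x)) *
     enn2real (RN_deriv lborel (distr P borel snd) (snd x))"

text \<open>
  Densities are determined only almost everywhere, so membership in the Hoelder class means
  that some version of the density belongs to it.
\<close>
definition holder_dists :: "real \<Rightarrow> real \<Rightarrow> ('a::euclidean_space \<times> 'b::euclidean_space) measure set" where
  "holder_dists s L = {P. prob_space P \<and> sets P = sets borel \<and> emeasure P unit_cube = 1 \<and>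
     absolutely_continuous lborel P \<and>
     (\<exists>f\<in>holder_class s L. AE x in lborel. x \<in> unit_cube \<longrightarrow> joint_density P x = f x) \<and>
     (\<exists>g\<in>holder_class s L. AE x in lborel. x \<in> unit_cube \<longrightarrow> product_density P x = g x)}"

definition L2_norm :: "('a::euclidean_space \<Rightarrow> real) \<Rightarrow> real" where
  "L2_norm f = sqrt (\<integral>x. (f x)\<^sup>2 \<partial>lborel)"

definition null_dists :: "real \<Rightarrow> real \<Rightarrow> ('a::euclidean_space \<times> 'b::euclidean_space) measure set" where
  "null_dists s L =
     {P \<in> holder_dists s L. AE x in lborel. joint_density P x = product_density P x}"

definition alt_dists ::
    "real \<Rightarrow> real \<Rightarrow> real \<Rightarrow> ('a::euclidean_space \<times> 'b::euclidean_space) measure set" where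
  "alt_dists s L \<epsilon> =
     {P \<in> holder_dists s L. L2_norm (\<lambda>x. joint_density P x - product_density P x) \<ge> \<epsilon>}"


section \<open>The permutation test\<close>

text \<open>
  The cells are the half-open cubes of side \<open>1/\<kappa>\<close>, except that the last cell in each coordinate
  also contains the endpoint 1, so that the cells partition the closed cube.
\<close>
definition cell_index :: "nat \<Rightarrow> real \<Rightarrow> int" where
  "cell_index \<kappa> t = min (int \<kappa> - 1) \<lfloor>real \<kappa> * t\<rfloor>"

definition same_cell :: "nat \<Rightarrow> real^'d \<Rightarrow> real^'d \<Rightarrow> real" where
  "same_cell \<kappa> u v = of_bool (\<forall>i. cell_index \<kappa> (u $ i) = cell_index \<kappa> (v $ i))"

definition h_in :: "nat \<Rightarrow> (real^'d1) \<times> (real^'d2) \<Rightarrow> (real^'d1) \<times> (real^'d2)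
    \<Rightarrow> (real^'d1) \<times> (real^'d2) \<Rightarrow> (real^'d1) \<times> (real^'d2) \<Rightarrow> real" where
  "h_in \<kappa> x1 x2 x3 x4 =
     (same_cell \<kappa> (fst x1) (fst x2) + same_cell \<kappa> (fst x3) (fst x4)
       - same_cell \<kappa> (fst x1) (fst x3) - same_cell \<kappa> (fst x2) (fst x4)) *
     (same_cell \<kappa> (snd x1) (snd x2) + same_cell \<kappa> (snd x3) (snd x4)
       - same_cell \<kappa> (snd x1) (snd x3) - same_cell \<kappa> (snd x2) (snd x4))"

definition distinct_quadruples :: "nat \<Rightarrow> (nat \<times> nat \<times> nat \<times> nat) set" where
  "distinct_quadruples n =
     {(i, j, k, l). {i, j, k, l} \<subseteq> {1..n} \<and> distinct [i, j, k, l]}"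

definition U_stat :: "nat \<Rightarrow> nat \<Rightarrow> (nat \<Rightarrow> (real^'d1) \<times> (real^'d2)) \<Rightarrow> real" where
  "U_stat \<kappa> n X =
     (\<Sum>(i, j, k, l)\<in>distinct_quadruples n. h_in \<kappa> (X i) (X j) (X k) (X l))
       / real (card (distinct_quadruples n))"

definition permuted_sample :: "(nat \<Rightarrow> nat) \<Rightarrow> (nat \<Rightarrow> 'a \<times> 'b) \<Rightarrow> nat \<Rightarrow> 'a \<times> 'b" where
  "permuted_sample \<pi> X i = (fst (X i), snd (X (\<pi> i)))"

definition crit_value :: "nat \<Rightarrow> real \<Rightarrow> nat \<Rightarrow> (nat \<Rightarrow> (real^'d1) \<times> (real^'d2)) \<Rightarrow> real" where
  "crit_value \<kappa> a n X =
     Inf {t. 1 / fact n *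
               (\<Sum>\<pi> | \<pi> permutes {1..n}. of_bool (U_stat \<kappa> n (permuted_sample \<pi> X) \<le> t)) \<ge> 1 - a}"

definition single_test :: "nat \<Rightarrow> real \<Rightarrow> nat \<Rightarrow> (nat \<Rightarrow> (real^'d1) \<times> (real^'d2)) \<Rightarrow> real" where
  "single_test \<kappa> a n X = of_bool (U_stat \<kappa> n X > crit_value \<kappa> a n X)"

definition gamma_max :: "nat \<Rightarrow> nat \<Rightarrow> nat" where
  "gamma_max d n = nat \<lceil>2 / real d * log 2 (real n / ln (ln (real n)))\<rceil>"

definition adaptive_test :: "real \<Rightarrow> nat \<Rightarrow> (nat \<Rightarrow> (real^'d1) \<times> (real^'d2)) \<Rightarrow> real" where
  "adaptive_test \<alpha> n X =
     (let \<gamma> = gamma_max (CARD('d1) + CARD('d2)) n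
      in Max ((\<lambda>\<kappa>. single_test \<kappa> (\<alpha> / real \<gamma>) n X) ` {2 ^ j | j. j \<in> {1..\<gamma>}}))"

definition iid_sample :: "nat \<Rightarrow> 'a measure \<Rightarrow> (nat \<Rightarrow> 'a) measure" where
  "iid_sample n P = Pi\<^sub>M {1..n} (\<lambda>_. P)"

definition test_prob ::
    "nat \<Rightarrow> 'a measure \<Rightarrow> ((nat \<Rightarrow> 'a) \<Rightarrow> real) \<Rightarrow> real \<Rightarrow> ennreal" where
  "test_prob n P \<phi> v = emeasure (iid_sample n P) {X \<in> space (iid_sample n P). \<phi> X = v}"

end

theory Submission
  imports Defs
begin

text \<open>
  Binning at resolution \<open>\<kappa>\<close> replaces the sample by pairs of cells with joint probabilities
  \<open>p\<^sub>a\<^sub>b\<close>; the U-statistic depends on the cells only and has mean \<open>4 \<theta>\<close> with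
  \<open>\<theta> = (\<Sum>a b. (p\<^sub>a\<^sub>b - p\<^sub>a p\<^sub>b)\<^sup>2)\<close>. It is the average over relabellings \<open>\<sigma>\<close> of the sample of a decoupled
  statistic built from disjoint blocks, so by convexity its second moment and the moments of its permuted version
  are bounded by those of the decoupled statistic.

  Swapping \<open>Z\<close>-values inside the pairs of the decoupled statistic only changes signs. The permuted
  statistic is therefore a decoupled Rademacher chaos, and Khinchine's inequality, applied twice,
  bounds its moments of order \<open>2 q\<close> by those of the sum of squares of the kernel, a quadratic form in cell
  counts. Bounded densities make all cell probabilities at most \<open>\<rho> = O(1/\<kappa>\<^sup>d)\<close>, and the counts then
  have the moments of a binomial variable. For \<open>q\<close> of order \<open>log log n \<le> O(n / \<kappa>\<^sup>d)\<close> (this is where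
  \<open>4 s > d\<close> enters) Markov's inequality bounds the critical value at level \<open>\<alpha> / \<gamma>\<close> by a multiple of
  \<open>log log n / (n \<kappa>\<^sup>(\<^sup>d\<^sup>/\<^sup>2\<^sup>))\<close>.

  The bias bound \<open>\<parallel>f\<parallel>\<^sup>2 \<le> C (\<kappa>\<^sup>d \<theta> + \<kappa>\<^sup>(\<^sup>-\<^sup>2\<^sup>s\<^sup>))\<close> for \<open>f = f\<^sub>Y\<^sub>Z - f\<^sub>Y f\<^sub>Z\<close> also holds for \<open>s > 1\<close>: a function that is
  a polynomial of degree \<open>k\<close> along coordinate lines up to \<open>O(\<kappa>\<^sup>(\<^sup>-\<^sup>s\<^sup>))\<close> is recovered up to that error, one
  coordinate at a time, from its averages over \<open>k + 1\<close> neighbouring cells.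
\<close>


section \<open>Finite expectations\<close>

text \<open>The iterated logarithm comes from the multiplicity of the test. There are O(log n)
  resolutions, so each level is of order 1 / log n. Moments of order 2 q give a tail exp (- 2 q),
  hence q of order log log n suffices; a variance bound alone would inflate the critical values by a
  power of log n. Decoupling and symmetrization lose only constants at every moment order, so they
  are harmless here. The bias is the second obstacle. The statistic sees one average per cell, and
  replacing a function by its cell average has an error of order 1 / \<kappa> even if the function
  is very smooth. Combining neighbouring averages uses the higher smoothness in the analysis without
  changing the test. The test depends on the sample through finitely many labels, so expectations
  over independent labels are plain finite sums \<open>fexp\<close>, free of measurability and
  integrability conditions. The passage to the actual sample needs only an upper bound by a
  measurable cover.\<close>

definition fexp :: "('c \<Rightarrow> real) \<Rightarrow> 'c set \<Rightarrow> 'i set \<Rightarrow> (('i \<Rightarrow> 'c) \<Rightarrow> real) \<Rightarrow> real" where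
  "fexp p C I F = (\<Sum>w\<in>PiE I (\<lambda>_. C). (\<Prod>i\<in>I. p (w i)) * F w)"

lemma fexp_insert:
  assumes "finite I" "i \<notin> I"
  shows "fexp p C (insert i I) F = (\<Sum>c\<in>C. p c * fexp p C I (\<lambda>w. F (w(i := c))))"
proof -
  have inj: "inj_on (\<lambda>(y, g). g(i := y)) (C \<times> PiE I (\<lambda>_. C))"
  proof (rule inj_onI, clarify)
    fix y g y' g' assume g: "g \<in> PiE I (\<lambda>_. C)" "g' \<in> PiE I (\<lambda>_. C)" and eq: "g(i := y) = g'(i := y')"
    have "y = y'" using fun_cong[OF eq, of i] by simp
    moreover have "g = g'"
    proof
      fix x show "g x = g' x"
        using fun_cong[OF eq, of x] g assms(2) by (cases "x = i") (auto simp: PiE_def extensional_def)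
    qed
    ultimately show "y = y' \<and> g = g'" by simp
  qed
  have pr: "(\<Prod>j\<in>I. p (if j = i then c else g j)) = (\<Prod>j\<in>I. p (g j))" for g c
    using assms(2) by (intro prod.cong) auto
  have "fexp p C (insert i I) F
      = (\<Sum>(c, g)\<in>C \<times> PiE I (\<lambda>_. C). p c * (\<Prod>j\<in>I. p (g j)) * F (g(i := c)))"
    unfolding fexp_def PiE_insert_eq
    by (subst sum.reindex[OF inj]) (simp add: case_prod_unfold pr assms)
  also have "\<dots> = (\<Sum>c\<in>C. p c * fexp p C I (\<lambda>w. F (w(i := c))))"
    unfolding fexp_def by (simp add: sum.cartesian_product[symmetric] sum_distrib_left mult.assoc)
  finally show ?thesis .
qed

lemma fexp_cong:
  "(\<And>w. w \<in> PiE I (\<lambda>_. C) \<Longrightarrow> F w = G w) \<Longrightarrow> fexp p C I F = fexp p C I G"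
  unfolding fexp_def by (intro sum.cong) auto

lemma fexp_sum: "fexp p C I (\<lambda>w. \<Sum>x\<in>A. F x w) = (\<Sum>x\<in>A. fexp p C I (F x))"
  unfolding fexp_def by (simp add: sum_distrib_left sum.swap[of _ A])

lemma fexp_add: "fexp p C I (\<lambda>w. F w + G w) = fexp p C I F + fexp p C I G"
  unfolding fexp_def by (simp add: distrib_left sum.distrib)

lemma fexp_cmult: "fexp p C I (\<lambda>w. a * F w) = a * fexp p C I F"
  unfolding fexp_def by (simp add: sum_distrib_left algebra_simps)

lemma fexp_prod:
  assumes "finite I" "finite C"
  shows "fexp p C I (\<lambda>w. \<Prod>i\<in>I. g i (w i)) = (\<Prod>i\<in>I. \<Sum>c\<in>C. p c * g i c)"
  unfolding fexp_def using assms by (simp add: prod_sum_PiE prod.distrib)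

locale finite_dist =
  fixes p :: "'c \<Rightarrow> real" and C :: "'c set"
  assumes finite_C: "finite C" and p_nonneg: "\<And>c. 0 \<le> p c" and p_sum: "sum p C = 1"
begin

lemma fexp_mono:
  "(\<And>w. w \<in> PiE I (\<lambda>_. C) \<Longrightarrow> F w \<le> G w) \<Longrightarrow> fexp p C I F \<le> fexp p C I G"
  unfolding fexp_def by (intro sum_mono mult_left_mono prod_nonneg) (auto simp: p_nonneg)

lemma fexp_const: "finite I \<Longrightarrow> fexp p C I (\<lambda>_. a) = a"
  using fexp_cmult[of p C I a "\<lambda>_. 1"] fexp_prod[of I C p "\<lambda>_ _. 1"] by (simp add: finite_C p_sum)

lemma fexp_pick:
  "finite I \<Longrightarrow> i \<in> I \<Longrightarrow> fexp p C I F = (\<Sum>c\<in>C. p c * fexp p C (I - {i}) (\<lambda>w. F (w(i := c))))"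
  using fexp_insert[of "I - {i}" i p C F] by (simp add: insert_absorb)

text \<open>Dependence on a block of coordinates is expressed as invariance under changes elsewhere.
  This lets the induction peel coordinates off \<open>J\<close> while \<open>G\<close> stays
  untouched.\<close>

lemma fexp_indep_Un:
  assumes "finite J" "finite J'" "J \<inter> J' = {}"
    and "\<And>w w'. (\<And>i. i \<in> J \<Longrightarrow> w i = w' i) \<Longrightarrow> F w = F w'"
    and "\<And>w w'. (\<And>i. i \<in> J' \<Longrightarrow> w i = w' i) \<Longrightarrow> G w = G w'"
  shows "fexp p C (J \<union> J') (\<lambda>w. F w * G w) = fexp p C J F * fexp p C J' G"
  using assms
proof (induction J arbitrary: F rule: finite_induct)
  case empty
  \<comment> \<open>\<open>F\<close> depends on no coordinate here, so \<open>undefined\<close> may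
    stand for any assignment.\<close>
  have F: "F w = F undefined" for w using empty(3) by blast
  have "fexp p C ({} \<union> J') (\<lambda>w. F w * G w) = F undefined * fexp p C J' G"
    by (subst F) (simp add: fexp_cmult)
  also have "F undefined = F (\<lambda>_. undefined)" by (rule F[symmetric])
  also have "\<dots> = fexp p C {} F" by (simp add: fexp_def)
  finally show ?case .
next
  case (insert i J)
  have G: "G (w(i := c)) = G w" for w c
    by (rule insert.prems(4)) (use insert.prems(2) in auto)
  have "fexp p C (insert i J \<union> J') (\<lambda>w. F w * G w)
      = (\<Sum>c\<in>C. p c * fexp p C (J \<union> J') (\<lambda>w. F (w(i := c)) * G w))"
    using insert.hyps insert.prems(1,2) by (simp add: fexp_insert G)
  also have "\<dots> = (\<Sum>c\<in>C. p c * (fexp p C J (\<lambda>w. F (w(i := c))) * fexp p C J' G))"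
  proof (intro sum.cong refl arg_cong2[where f="(*)"], rule insert.IH)
    show "F (w(i := c)) = F (w'(i := c))" if "\<And>i. i \<in> J \<Longrightarrow> w i = w' i" for c w w'
      by (rule insert.prems(3)) (use that in auto)
  qed (rule insert.prems(1), use insert.prems(2) in blast, rule insert.prems(4), blast)
  also have "\<dots> = fexp p C (insert i J) F * fexp p C J' G"
    using insert.hyps by (simp add: fexp_insert sum_distrib_right mult.assoc)
  finally show ?case .
qed

text \<open>Independence with the constant 1 as second factor: the coordinates outside
  \<open>J\<close> sum out to one.\<close>

lemma fexp_marginal:
  assumes "finite I" "J \<subseteq> I"
    and "\<And>w w'. (\<And>i. i \<in> J \<Longrightarrow> w i = w' i) \<Longrightarrow> F w = F w'"
  shows "fexp p C I F = fexp p C J F"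
proof -
  have "fexp p C (J \<union> (I - J)) (\<lambda>w. F w * 1) = fexp p C J F * fexp p C (I - J) (\<lambda>_. 1)"
    by (rule fexp_indep_Un, use assms(1,2) finite_subset in blast, use assms(1) in blast, blast,
        rule assms(3)) auto
  moreover have "J \<union> (I - J) = I" using assms(2) by auto
  ultimately show ?thesis using assms(1) by (simp add: fexp_const)
qed

lemma fexp_indep:
  assumes "finite I" "J \<subseteq> I" "J' \<subseteq> I" "J \<inter> J' = {}"
    and F: "\<And>w w'. (\<And>i. i \<in> J \<Longrightarrow> w i = w' i) \<Longrightarrow> F w = F w'"
    and G: "\<And>w w'. (\<And>i. i \<in> J' \<Longrightarrow> w i = w' i) \<Longrightarrow> G w = G w'"
  shows "fexp p C I (\<lambda>w. F w * G w) = fexp p C I F * fexp p C I G"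
proof -
  have fin: "finite J" "finite J'" using assms(1-3) finite_subset by auto
  have "fexp p C I (\<lambda>w. F w * G w) = fexp p C (J \<union> J') (\<lambda>w. F w * G w)"
    by (rule fexp_marginal[OF assms(1)], use assms(2,3) in blast,
        rule arg_cong2[where f="(*)"], rule F, simp, rule G, simp)
  also have "\<dots> = fexp p C J F * fexp p C J' G"
    by (rule fexp_indep_Un[OF fin assms(4)]) (rule F, assumption, rule G, assumption)
  also have "fexp p C J F = fexp p C I F"
    by (rule fexp_marginal[OF assms(1,2), symmetric]) (rule F, assumption)
  also have "fexp p C J' G = fexp p C I G"
    by (rule fexp_marginal[OF assms(1,3), symmetric]) (rule G, assumption)
  finally show ?thesis .
qed

lemma fexp_pair:
  assumes "finite I" "i \<in> I" "j \<in> I" "i \<noteq> j"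
  shows "fexp p C I (\<lambda>w. F (w i) (w j)) = (\<Sum>u\<in>C. \<Sum>v\<in>C. p u * p v * F u v)"
proof -
  have "fexp p C I (\<lambda>w. F (w i) (w j))
      = (\<Sum>u\<in>C. p u * (\<Sum>v\<in>C. p v * fexp p C (I - {i} - {j}) (\<lambda>_. F u v)))"
    using assms by (subst fexp_pick[of _ i], simp, simp, subst fexp_pick[of _ j]) auto
  then show ?thesis
    using assms(1) by (simp add: fexp_const sum_distrib_left mult.assoc)
qed

end

section \<open>Power mean inequalities\<close>

lemma sum_power_le:
  fixes y :: "'a \<Rightarrow> real"
  assumes "finite J" "J \<noteq> {}" "\<And>j. j \<in> J \<Longrightarrow> 0 \<le> y j" "\<And>j. j \<in> J \<Longrightarrow> 0 \<le> w j" "sum w J = 1"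
  shows "(\<Sum>j\<in>J. w j * y j) ^ p \<le> (\<Sum>j\<in>J. w j * y j ^ p)"
proof -
  have "convex_on {0::real..} (\<lambda>x. x ^ p)"
    by (cases "even p") (auto intro: convex_on_subset[OF convex_power_even] convex_power_odd)
  from convex_on_sum[OF assms(1,2) this assms(5), of y] show ?thesis
    using assms by auto
qed

lemma sum_power_card_le:
  fixes y :: "'a \<Rightarrow> real"
  assumes "finite J" "J \<noteq> {}" "\<And>j. j \<in> J \<Longrightarrow> 0 \<le> y j"
  shows "(\<Sum>j\<in>J. y j) ^ p \<le> real (card J) ^ p * (\<Sum>j\<in>J. y j ^ p) / card J"
proof -
  let ?N = "real (card J)"
  have N: "?N > 0" using assms by (simp add: card_gt_0_iff)
  have "(\<Sum>j\<in>J. (1 / ?N) * y j) ^ p \<le> (\<Sum>j\<in>J. (1 / ?N) * y j ^ p)"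
    by (rule sum_power_le) (use assms in auto)
  then have "(sum y J) ^ p / ?N ^ p \<le> (\<Sum>j\<in>J. y j ^ p) / ?N"
    by (simp only: mult_1 times_divide_eq_left sum_divide_distrib[symmetric] power_divide)
  then show ?thesis
    using N by (simp add: pos_divide_le_eq mult.commute)
qed

section \<open>The U-statistic of a discretized sample\<close>

text \<open>The parts of \<open>S\<close> left over by \<open>A\<close> and by its image have the
  same size, so any bijection between them completes \<open>f\<close>.\<close>

lemma permutes_extend:
  assumes "finite S" "inj_on f A" "A \<subseteq> S" "f ` A \<subseteq> S"
  shows "\<exists>r. r permutes S \<and> (\<forall>x\<in>A. r x = f x)"
proof -
  have "card (S - A) = card (S - f ` A)"
    using assms by (simp add: card_Diff_subset finite_subset card_image)
  then obtain g where g: "bij_betw g (S - A) (S - f ` A)"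
    using assms(1) finite_same_card_bij[of "S - A" "S - f ` A"] by auto
  define r where "r x = (if x \<in> A then f x else if x \<in> S then g x else x)" for x
  have "bij_betw r A (f ` A)"
    using assms(2) by (subst bij_betw_cong[where g = f]) (auto simp: r_def bij_betw_def)
  moreover have "bij_betw r (S - A) (S - f ` A)"
    using g by (subst bij_betw_cong[where g = g]) (auto simp: r_def)
  ultimately have "bij_betw r (A \<union> (S - A)) (f ` A \<union> (S - f ` A))"
    by (rule bij_betw_combine) auto
  moreover have "A \<union> (S - A) = S" "f ` A \<union> (S - f ` A) = S" using assms by auto
  ultimately have "bij_betw r S S" by simp
  then have "r permutes S"
    by (rule bij_imp_permutes) (use assms in \<open>auto simp: r_def\<close>)
  then show ?thesis by (intro exI[of _ r]) (auto simp: r_def)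
qed

lemma finite_distinct_quadruples: "finite (distinct_quadruples n)"
  by (rule finite_subset[of _ "{1..n} \<times> {1..n} \<times> {1..n} \<times> {1..n}"])
     (auto simp: distinct_quadruples_def)

text \<open>The symmetric group acts transitively on quadruples of distinct indices, so the sum over
  relabellings does not depend on the quadruple. Averaging it over all quadruples, which each
  relabelling merely reorders, gives the right-hand side.\<close>

lemma sum_permutes_quadruple:
  fixes g :: "nat \<Rightarrow> nat \<Rightarrow> nat \<Rightarrow> nat \<Rightarrow> real"
  assumes "(i, j, k, l) \<in> distinct_quadruples n"
  shows "(\<Sum>\<sigma> | \<sigma> permutes {1..n}. g (\<sigma> i) (\<sigma> j) (\<sigma> k) (\<sigma> l))
    = fact n * ((\<Sum>(i, j, k, l)\<in>distinct_quadruples n. g i j k l) / real (card (distinct_quadruples n)))"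
proof -
  let ?P = "{\<sigma>. \<sigma> permutes {1..n}}" and ?Q = "distinct_quadruples n"
  define G where "G = (\<lambda>(i, j, k, l). \<Sum>\<sigma>\<in>?P. g (\<sigma> i) (\<sigma> j) (\<sigma> k) (\<sigma> l))"
  have G_const: "G t = G (i, j, k, l)" if "t \<in> ?Q" for t
  proof -
    obtain i' j' k' l' where t: "t = (i', j', k', l')" by (cases t)
    define f where "f = (\<lambda>_. l')(i := i', j := j', k := k')"
    have "\<exists>r. r permutes {1..n} \<and> (\<forall>x\<in>{i, j, k, l}. r x = f x)"
      using that assms by (intro permutes_extend) (auto simp: t f_def distinct_quadruples_def)
    then obtain r where r: "r permutes {1..n}" "\<And>x. x \<in> {i, j, k, l} \<Longrightarrow> r x = f x" by blast
    have f: "f i = i'" "f j = j'" "f k = k'" "f l = l'"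
      using assms by (auto simp: f_def distinct_quadruples_def)
    have "G (i, j, k, l) = (\<Sum>\<sigma>\<in>?P. g ((\<sigma> \<circ> r) i) ((\<sigma> \<circ> r) j) ((\<sigma> \<circ> r) k) ((\<sigma> \<circ> r) l))"
      unfolding G_def case_prod_conv by (rule sum_permutations_compose_right[OF r(1)])
    also have "\<dots> = G t" by (simp add: G_def t r(2) f)
    finally show ?thesis by simp
  qed
  have "real (card ?Q) * G (i, j, k, l) = (\<Sum>t\<in>?Q. G t)"
    by (simp add: G_const)
  also have "\<dots> = (\<Sum>\<sigma>\<in>?P. \<Sum>(i, j, k, l)\<in>?Q. g (\<sigma> i) (\<sigma> j) (\<sigma> k) (\<sigma> l))"
    unfolding G_def case_prod_unfold by (rule sum.swap)
  also have "\<dots> = (\<Sum>\<sigma>\<in>?P. \<Sum>(i, j, k, l)\<in>?Q. g i j k l)"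
  proof (rule sum.cong[OF refl])
    fix \<sigma> assume "\<sigma> \<in> ?P"
    then have s: "\<sigma> permutes {1..n}" by simp
    have si: "inv \<sigma> permutes {1..n}" by (rule permutes_inv[OF s])
    note * = permutes_in_image[OF s] permutes_in_image[OF si] permutes_inverses[OF s]
      permutes_inj[OF s, THEN inj_eq] permutes_inj[OF si, THEN inj_eq]
    show "(\<Sum>(i, j, k, l)\<in>?Q. g (\<sigma> i) (\<sigma> j) (\<sigma> k) (\<sigma> l)) = (\<Sum>(i, j, k, l)\<in>?Q. g i j k l)"
      by (rule sum.reindex_bij_witness[where
            i = "\<lambda>(i, j, k, l). (inv \<sigma> i, inv \<sigma> j, inv \<sigma> k, inv \<sigma> l)" and
            j = "\<lambda>(i, j, k, l). (\<sigma> i, \<sigma> j, \<sigma> k, \<sigma> l)"])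
         (auto simp: distinct_quadruples_def * simp del: atLeastAtMost_iff One_nat_def)
  qed
  also have "\<dots> = fact n * (\<Sum>(i, j, k, l)\<in>?Q. g i j k l)"
    by (simp add: card_permutations)
  finally have "real (card ?Q) * G (i, j, k, l) = fact n * (\<Sum>(i, j, k, l)\<in>?Q. g i j k l)" .
  moreover have "real (card ?Q) \<noteq> 0"
    using assms finite_distinct_quadruples by auto
  ultimately show ?thesis
    unfolding G_def case_prod_conv by (simp add: field_simps)
qed

text \<open>\<open>h_in\<close> on cell labels: lying in a common cell has become equality of
  labels.\<close>

definition cell_kernel :: "'u \<times> 'v \<Rightarrow> 'u \<times> 'v \<Rightarrow> 'u \<times> 'v \<Rightarrow> 'u \<times> 'v \<Rightarrow> real" where
  "cell_kernel x1 x2 x3 x4 =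
     (of_bool (fst x1 = fst x2) + of_bool (fst x3 = fst x4)
       - of_bool (fst x1 = fst x3) - of_bool (fst x2 = fst x4)) *
     (of_bool (snd x1 = snd x2) + of_bool (snd x3 = snd x4)
       - of_bool (snd x1 = snd x3) - of_bool (snd x2 = snd x4))"

definition cell_U :: "nat \<Rightarrow> (nat \<Rightarrow> 'u \<times> 'v) \<Rightarrow> real" where
  "cell_U n x = (\<Sum>(i, j, k, l)\<in>distinct_quadruples n. cell_kernel (x i) (x j) (x k) (x l))
       / real (card (distinct_quadruples n))"

text \<open>
  The sample is split into four blocks of length \<open>m\<close>; \<open>slot m e k\<close> is the \<open>k\<close>-th index of block \<open>e\<close>.
  Blocks 0 and 3 play the first pair of arguments of the kernel, blocks 1 and 2 the second, so
  \<open>split_U\<close> is a decoupled U-statistic of pairs.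
\<close>
definition slot :: "nat \<Rightarrow> nat \<Rightarrow> nat \<Rightarrow> nat" where
  "slot m e k = e * m + k + 1"

definition split_U :: "nat \<Rightarrow> (nat \<Rightarrow> 'u \<times> 'v) \<Rightarrow> real" where
  "split_U m x = (\<Sum>k<m. \<Sum>l<m. cell_kernel (x (slot m 0 k)) (x (slot m 1 l)) (x (slot m 2 l)) (x (slot m 3 k)))
     / (real m)\<^sup>2"

lemma slot_eq_iff:
  assumes "k < m" "l < m"
  shows "slot m e k = slot m f l \<longleftrightarrow> e = f \<and> k = l"
proof
  assume "slot m e k = slot m f l"
  then have eq: "e * m + k = f * m + l" by (simp add: slot_def)
  have "(e * m + k) div m = e" "(f * m + l) div m = f" using assms by auto
  then have "e = f" using eq by simp
  then show "e = f \<and> k = l" using eq by simp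
qed simp

lemma slot_range:
  assumes "k < m" "e < 4" "4 * m \<le> n"
  shows "slot m e k \<in> {1..n}"
proof -
  have "e * m \<le> 3 * m" using assms(2) by (intro mult_right_mono) auto
  then have "e * m + k + 1 \<le> n" using assms by linarith
  then show ?thesis unfolding slot_def by auto
qed

lemma slots_quadruple:
  assumes "k < m" "l < m" "4 * m \<le> n"
  shows "(slot m 0 k, slot m 1 l, slot m 2 l, slot m 3 k) \<in> distinct_quadruples n"
  using assms slot_range[of _ m _ n]
  by (simp add: distinct_quadruples_def slot_eq_iff del: atLeastAtMost_iff One_nat_def)

text \<open>Hoeffding's averaging device: under relabelling, each summand of \<open>split_U\<close>
  runs through all quadruples. The full statistic is thus an average of decoupled ones, and every
  convex bound on those passes to it.\<close>

lemma cell_U_eq_average: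
  assumes "0 < m" "4 * m \<le> n"
  shows "cell_U n x = (\<Sum>\<sigma> | \<sigma> permutes {1..n}. split_U m (x \<circ> \<sigma>)) / fact n"
proof -
  let ?P = "{\<sigma>. \<sigma> permutes {1..n}}"
  have "(\<Sum>\<sigma>\<in>?P. split_U m (x \<circ> \<sigma>))
      = (\<Sum>\<sigma>\<in>?P. \<Sum>k<m. \<Sum>l<m. cell_kernel (x (\<sigma> (slot m 0 k))) (x (\<sigma> (slot m 1 l)))
            (x (\<sigma> (slot m 2 l))) (x (\<sigma> (slot m 3 k)))) / (real m)\<^sup>2"
    by (simp add: split_U_def sum_divide_distrib)
  also have "\<dots> = (\<Sum>k<m. \<Sum>\<sigma>\<in>?P. \<Sum>l<m. cell_kernel (x (\<sigma> (slot m 0 k))) (x (\<sigma> (slot m 1 l)))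
            (x (\<sigma> (slot m 2 l))) (x (\<sigma> (slot m 3 k)))) / (real m)\<^sup>2"
    by (subst sum.swap) simp
  also have "\<dots> = (\<Sum>k<m. \<Sum>l<m. \<Sum>\<sigma>\<in>?P. cell_kernel (x (\<sigma> (slot m 0 k))) (x (\<sigma> (slot m 1 l)))
            (x (\<sigma> (slot m 2 l))) (x (\<sigma> (slot m 3 k)))) / (real m)\<^sup>2"
    by (subst sum.swap) simp
  also have "\<dots> = (\<Sum>k<m. \<Sum>l<m. fact n * cell_U n x) / (real m)\<^sup>2"
  proof (intro arg_cong2[where f="(/)"] sum.cong refl)
    fix k l assume "k \<in> {..<m}" "l \<in> {..<m}"
    then have q: "(slot m 0 k, slot m 1 l, slot m 2 l, slot m 3 k) \<in> distinct_quadruples n"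
      using assms by (intro slots_quadruple) auto
    show "(\<Sum>\<sigma>\<in>?P. cell_kernel (x (\<sigma> (slot m 0 k))) (x (\<sigma> (slot m 1 l)))
            (x (\<sigma> (slot m 2 l))) (x (\<sigma> (slot m 3 k)))) = fact n * cell_U n x"
      using sum_permutes_quadruple[OF q, of "\<lambda>i j k l. cell_kernel (x i) (x j) (x k) (x l)"]
      by (simp add: cell_U_def)
  qed
  also have "\<dots> = fact n * cell_U n x" using assms by (simp add: power2_eq_square)
  finally show ?thesis by simp
qed

text \<open>The kernel is an inner product of pair features, which is what makes \<open>split_U\<close> tractable.\<close>

definition pair_feature :: "'u \<times> 'v \<Rightarrow> 'u \<times> 'v \<Rightarrow> 'u \<times> 'v \<Rightarrow> real" where
  "pair_feature c u v = (of_bool (fst u = fst c) - of_bool (fst v = fst c)) *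
     (of_bool (snd u = snd c) - of_bool (snd v = snd c))"

lemma sum_of_bool_eq:
  "finite A \<Longrightarrow> u \<in> A \<Longrightarrow> (\<Sum>a\<in>A. of_bool (u = a) * f a) = (f u :: real)"
  by (simp add: of_bool_def if_distrib[of "\<lambda>x. x * _"] cong: if_cong)

lemma sum_indicator_diff_mult:
  assumes "finite S" "u1 \<in> S" "u2 \<in> S" "u3 \<in> S" "u4 \<in> S"
  shows "(\<Sum>a\<in>S. (of_bool (u1 = a) - of_bool (u4 = a)) * (of_bool (u2 = a) - of_bool (u3 = a)))
      = (of_bool (u1 = u2) + of_bool (u3 = u4) - of_bool (u1 = u3) - of_bool (u2 = u4) :: real)"
proof -
  have "(\<Sum>a\<in>S. (of_bool (u1 = a) - of_bool (u4 = a)) * (of_bool (u2 = a) - of_bool (u3 = a)))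
      = (\<Sum>a\<in>S. of_bool (u1 = a) * (of_bool (u2 = a) - of_bool (u3 = a)))
      - (\<Sum>a\<in>S. of_bool (u4 = a) * (of_bool (u2 = a) - of_bool (u3 = a)) :: real)"
    by (simp only: left_diff_distrib sum_subtractf)
  also have "\<dots> = of_bool (u1 = u2) + of_bool (u3 = u4) - of_bool (u1 = u3) - of_bool (u2 = u4)"
    using assms by (simp only: sum_of_bool_eq) (auto simp: of_bool_def)
  finally show ?thesis .
qed

text \<open>Each bracket of the kernel is an inner product of two differences of indicators, and the
  product of the brackets is an inner product over pairs of cells. Arguments 1, 4 and 2, 3 belong
  together, which is the grouping of the blocks in \<open>split_U\<close>.\<close>

lemma cell_kernel_eq_sum:
  assumes "finite A" "finite B" "x1 \<in> A \<times> B" "x2 \<in> A \<times> B" "x3 \<in> A \<times> B" "x4 \<in> A \<times> B"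
  shows "cell_kernel x1 x2 x3 x4 = (\<Sum>c\<in>A \<times> B. pair_feature c x1 x4 * pair_feature c x2 x3)"
proof -
  have "(\<Sum>c\<in>A \<times> B. pair_feature c x1 x4 * pair_feature c x2 x3)
     = (\<Sum>a\<in>A. (of_bool (fst x1 = a) - of_bool (fst x4 = a)) * (of_bool (fst x2 = a) - of_bool (fst x3 = a)))
     * (\<Sum>b\<in>B. (of_bool (snd x1 = b) - of_bool (snd x4 = b)) * (of_bool (snd x2 = b) - of_bool (snd x3 = b)))"
    unfolding sum_product sum.cartesian_product
    by (intro sum.cong) (simp_all add: pair_feature_def case_prod_unfold mult_ac)
  also have "\<dots> = cell_kernel x1 x2 x3 x4"
    using assms by (subst (1 2) sum_indicator_diff_mult) (auto simp: cell_kernel_def of_bool_def)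
  finally show ?thesis by simp
qed

section \<open>Rademacher sums\<close>

text \<open>A sign vector is encoded by the set \<open>P\<close> of its negative positions, so
  averaging over independent signs on \<open>K\<close> is summing over \<open>Pow K\<close>.\<close>

definition sign_of :: "'a set \<Rightarrow> 'a \<Rightarrow> real" where
  "sign_of P k = (if k \<in> P then -1 else 1)"

text \<open>A form of the sub-Gaussian bound for cosh, with x^2 in place of x^2 / 2, that follows
  from quadratic estimates of the exponential.\<close>

lemma exp_add_exp_minus_le: "exp x + exp (- x) \<le> 2 * exp (x\<^sup>2)" for x :: real
proof -
  have *: "exp x + exp (- x) \<le> 2 * exp (x\<^sup>2)" if "0 \<le> x" for x :: real
  proof (cases "x \<le> 1")
    case True
    \<comment> \<open>With the quadratic lower bound for exp x this identity yields an upper bound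
      for exp (- x).\<close>
    have "(1 - x + x\<^sup>2) * (1 + x + x\<^sup>2 / 2) = 1 + x\<^sup>2 / 2 + x ^ 3 / 2 + x ^ 4 / 2"
      by (simp add: field_simps power2_eq_square power3_eq_cube power4_eq_xxxx)
    then have "1 \<le> (1 - x + x\<^sup>2) * (1 + x + x\<^sup>2 / 2)" using that by simp
    also have "\<dots> \<le> (1 - x + x\<^sup>2) * exp x"
      using that True exp_lower_Taylor_quadratic[OF that] by (intro mult_left_mono) auto
    finally have "exp (- x) \<le> 1 - x + x\<^sup>2" by (simp add: exp_minus field_simps)
    moreover have "exp x \<le> 1 + x + x\<^sup>2" by (rule exp_bound[OF that True])
    moreover have "1 + x\<^sup>2 \<le> exp (x\<^sup>2)" by (rule exp_ge_add_one_self)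
    ultimately show ?thesis by linarith
  next
    case False
    then have "x \<le> x\<^sup>2" using mult_right_mono[of 1 x x] by (simp add: power2_eq_square)
    then have "exp x \<le> exp (x\<^sup>2)" "exp (- x) \<le> exp (x\<^sup>2)" using that by auto
    then show ?thesis by linarith
  qed
  show ?thesis using *[of x] *[of "- x"] by (cases "0 \<le> x") (auto simp: add.commute)
qed

text \<open>Independence of signs: the subsets of \<open>insert j K\<close> come in pairs that
  differ only in \<open>j\<close>, and each pair contributes the factor exp (c j) + exp (- c
  j).\<close>

lemma rademacher_mgf_le:
  assumes "finite K"
  shows "(\<Sum>P\<in>Pow K. exp (\<Sum>k\<in>K. sign_of P k * c k)) \<le> 2 ^ card K * exp (\<Sum>k\<in>K. (c k)\<^sup>2)"
  using assms
proof (induction K rule: finite_induct)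
  case empty then show ?case by simp
next
  case (insert j K)
  let ?S = "\<lambda>P. \<Sum>k\<in>K. sign_of P k * c k"
  have S1: "(\<Sum>k\<in>insert j K. sign_of P k * c k) = c j + ?S P" if "P \<in> Pow K" for P
    using insert.hyps that by (auto simp: sign_of_def)
  have S2: "(\<Sum>k\<in>insert j K. sign_of (insert j P) k * c k) = - c j + ?S P" for P
  proof -
    have "(\<Sum>k\<in>K. sign_of (insert j P) k * c k) = ?S P"
      using insert.hyps by (intro sum.cong) (auto simp: sign_of_def)
    then show ?thesis using insert.hyps by (simp add: sign_of_def)
  qed
  have "(\<Sum>P\<in>Pow (insert j K). exp (\<Sum>k\<in>insert j K. sign_of P k * c k))
      = (\<Sum>P\<in>Pow K. exp (\<Sum>k\<in>insert j K. sign_of P k * c k))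
      + (\<Sum>P\<in>insert j ` Pow K. exp (\<Sum>k\<in>insert j K. sign_of P k * c k))"
    unfolding Pow_insert using insert.hyps by (intro sum.union_disjoint) auto
  also have "(\<Sum>P\<in>insert j ` Pow K. exp (\<Sum>k\<in>insert j K. sign_of P k * c k))
      = (\<Sum>P\<in>Pow K. exp (\<Sum>k\<in>insert j K. sign_of (insert j P) k * c k))"
    by (rule sum.reindex_cong[of "insert j"]) (use insert.hyps in \<open>auto intro!: inj_onI\<close>)
  also have "(\<Sum>P\<in>Pow K. exp (\<Sum>k\<in>insert j K. sign_of P k * c k)) + \<dots>
      = (\<Sum>P\<in>Pow K. exp (?S P) * (exp (c j) + exp (- c j)))"
    unfolding sum.distrib[symmetric] S2
    by (intro sum.cong refl) (simp only: S1 exp_add, simp add: algebra_simps)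
  also have "\<dots> = (\<Sum>P\<in>Pow K. exp (?S P)) * (exp (c j) + exp (- c j))"
    by (simp add: sum_distrib_right)
  also have "\<dots> \<le> (2 ^ card K * exp (\<Sum>k\<in>K. (c k)\<^sup>2)) * (2 * exp ((c j)\<^sup>2))"
    by (intro mult_mono insert.IH exp_add_exp_minus_le) (auto intro: add_nonneg_nonneg)
  also have "\<dots> = 2 ^ card (insert j K) * exp (\<Sum>k\<in>insert j K. (c k)\<^sup>2)"
    using insert.hyps by (simp add: exp_add)
  finally show ?case .
qed

text \<open>A single term of the exponential series at the absolute value of x; adding the
  exponential at - x covers both signs.\<close>

lemma power_le_fact_exp: "(x::real) ^ (2 * p) \<le> fact (2 * p) * (exp x + exp (- x))"
proof -
  have *: "x ^ (2 * p) \<le> fact (2 * p) * exp x" if "0 \<le> x" for x :: real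
  proof -
    have "(\<Sum>n\<in>{2 * p}. x ^ n /\<^sub>R fact n) \<le> (\<Sum>n. x ^ n /\<^sub>R fact n)"
      by (rule sum_le_suminf[OF summable_exp_generic]) (use that in auto)
    then show ?thesis by (simp add: exp_def field_simps)
  qed
  show ?thesis
  proof (cases "0 \<le> x")
    case True
    have "fact (2 * p) * exp x \<le> fact (2 * p) * (exp x + exp (- x))" by (intro mult_left_mono) auto
    then show ?thesis using *[OF True] by linarith
  next
    case False
    have "fact (2 * p) * exp (- x) \<le> fact (2 * p) * (exp x + exp (- x))" by (intro mult_left_mono) auto
    moreover have "x ^ (2 * p) \<le> fact (2 * p) * exp (- x)" using *[of "- x"] False by simp
    ultimately show ?thesis by linarith
  qed
qed

text \<open>Exponential moments at scale \<open>z\<close> control the moment of order 2 p, and z^2 =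
  p / V balances the two. The constant is 24 = 4 * 3 * 2: the 4 comes from (2 p)! \<le> (2 p)^(2 p),
  the 3 from exp p \<le> 3^p, and the 2 from the two signs of the exponent, since 2 \<le> 2^p. One
  of the two factors p^p is cancelled by z^(2 p).\<close>

lemma khinchine:
  assumes "finite K" "1 \<le> p"
  shows "(\<Sum>P\<in>Pow K. (\<Sum>k\<in>K. sign_of P k * c k) ^ (2 * p))
    \<le> 2 ^ card K * (24 * real p) ^ p * (\<Sum>k\<in>K. (c k)\<^sup>2) ^ p"
proof (cases "(\<Sum>k\<in>K. (c k)\<^sup>2) = 0")
  case True
  then have "c k = 0" if "k \<in> K" for k
    using that assms(1) by (simp add: sum_nonneg_eq_0_iff)
  then show ?thesis using assms(2) by (simp add: True power_0_left)
next
  case False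
  define V where "V = (\<Sum>k\<in>K. (c k)\<^sup>2)"
  have V: "V > 0" using False unfolding V_def by (simp add: sum_nonneg order.not_eq_order_implies_strict)
  define z where "z = sqrt (real p / V)"
  have z2: "z\<^sup>2 = real p / V" using V by (simp add: z_def)
  have z2p: "z ^ (2 * p) = real p ^ p / V ^ p" by (simp add: power_mult z2 power_divide)
  let ?S = "\<lambda>P. \<Sum>k\<in>K. sign_of P k * c k"
  have mgf: "(\<Sum>P\<in>Pow K. exp (y * ?S P)) \<le> 2 ^ card K * exp (y\<^sup>2 * V)" for y
    using rademacher_mgf_le[OF assms(1), of "\<lambda>k. y * c k"]
    by (simp add: V_def sum_distrib_left power_mult_distrib mult.left_commute)
  have ep: "exp (real p) \<le> 3 ^ p"
    using power_mono[OF exp_le, of p] by (simp add: exp_of_nat_mult[of p 1, simplified])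
  have "z ^ (2 * p) * (\<Sum>P\<in>Pow K. ?S P ^ (2 * p)) = (\<Sum>P\<in>Pow K. (z * ?S P) ^ (2 * p))"
    by (simp only: sum_distrib_left[of _ _ "Pow K"] power_mult_distrib)
  also have "\<dots> \<le> (\<Sum>P\<in>Pow K. fact (2 * p) * (exp (z * ?S P) + exp (- z * ?S P)))"
    by (intro sum_mono) (simp add: power_le_fact_exp)
  also have "\<dots> = fact (2 * p) * ((\<Sum>P\<in>Pow K. exp (z * ?S P)) + (\<Sum>P\<in>Pow K. exp (- z * ?S P)))"
    by (simp add: sum_distrib_left sum.distrib distrib_left)
  also have "\<dots> \<le> (2 * real p) ^ (2 * p) * (2 ^ card K * 3 ^ p + 2 ^ card K * 3 ^ p)"
  proof (intro mult_mono add_mono)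
    have "fact (2 * p) \<le> real ((2 * p) ^ (2 * p))" by (rule fact_le_power)
    then show "fact (2 * p) \<le> (2 * real p) ^ (2 * p)" by simp
    have "z\<^sup>2 * V = real p" using V z2 by simp
    then show "(\<Sum>P\<in>Pow K. exp (z * ?S P)) \<le> 2 ^ card K * 3 ^ p"
       "(\<Sum>P\<in>Pow K. exp (- z * ?S P)) \<le> 2 ^ card K * 3 ^ p"
      using order_trans[OF mgf[of z], of "2 ^ card K * 3 ^ p"]
        order_trans[OF mgf[of "- z"], of "2 ^ card K * 3 ^ p"] ep by auto
  qed (auto intro!: sum_nonneg add_nonneg_nonneg)
  also have "\<dots> \<le> (2 * real p) ^ (2 * p) * (2 ^ card K * 3 ^ p * 2 ^ p)"
    using power_increasing[OF assms(2), of "2::real"] by (intro mult_left_mono) auto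
  also have "\<dots> = real p ^ p * (2 ^ card K * (24 * real p) ^ p)"
  proof -
    have "(24 * real p) ^ p = (2\<^sup>2 * 3 * 2 * real p) ^ p" by simp
    also have "\<dots> = 2 ^ (2 * p) * 3 ^ p * 2 ^ p * real p ^ p"
      by (simp only: power_mult_distrib power_mult)
    finally have *: "(24 * real p) ^ p = 2 ^ (2 * p) * 3 ^ p * 2 ^ p * real p ^ p" .
    have "real p ^ (2 * p) = real p ^ p * real p ^ p" by (metis mult_2 power_add)
    then have "(2 * real p) ^ (2 * p) = 2 ^ (2 * p) * (real p ^ p * real p ^ p)"
      by (simp only: power_mult_distrib)
    with * show ?thesis by (simp only: mult_ac)
  qed
  finally have "real p ^ p / V ^ p * (\<Sum>P\<in>Pow K. ?S P ^ (2 * p)) \<le> real p ^ p * (2 ^ card K * (24 * real p) ^ p)"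
    by (simp only: z2p)
  then show ?thesis
    using V assms(2) unfolding V_def[symmetric] by (simp add: pos_divide_le_eq mult_ac)
qed

text \<open>For fixed \<open>Q\<close> the double sum is a Rademacher sum in \<open>P\<close>.
  Khinchine leaves the p-th moment of a sum of squares \<open>(X Q k)\<^sup>2\<close>; once Jensen
  has moved the power inside that sum, a second use of Khinchine bounds each square.\<close>

lemma rademacher_chaos:
  assumes "finite K" "finite L" "1 \<le> p"
  shows "(\<Sum>P\<in>Pow K. \<Sum>Q\<in>Pow L. (\<Sum>k\<in>K. \<Sum>l\<in>L. sign_of P k * sign_of Q l * h k l) ^ (2 * p))
    \<le> 2 ^ card K * 2 ^ card L * (24 * real p) ^ (2 * p) * (\<Sum>k\<in>K. \<Sum>l\<in>L. (h k l)\<^sup>2) ^ p"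
proof -
  let ?B = "(24 * real p) ^ p"
  define s where "s k = (\<Sum>l\<in>L. (h k l)\<^sup>2)" for k
  define H where "H = (\<Sum>k\<in>K. s k)"
  define X where "X Q k = (\<Sum>l\<in>L. sign_of Q l * h k l)" for Q k
  have s: "0 \<le> s k" for k by (simp add: s_def sum_nonneg)
  have X: "(\<Sum>Q\<in>Pow L. ((X Q k)\<^sup>2) ^ p) \<le> 2 ^ card L * ?B * s k ^ p" for k
    using khinchine[OF assms(2,3), of "h k"] by (simp add: X_def s_def power_mult)
  have sX: "(X Q k)\<^sup>2 = 0" if "k \<in> K" "s k = 0" for Q k
    using that assms(2) by (simp add: X_def s_def sum_nonneg_eq_0_iff)
  have main: "(\<Sum>Q\<in>Pow L. (\<Sum>k\<in>K. (X Q k)\<^sup>2) ^ p) \<le> 2 ^ card L * ?B * H ^ p"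
  proof (cases "H = 0")
    case True
    then have "s k = 0" if "k \<in> K" for k
      using that s assms(1) by (simp add: H_def sum_nonneg_eq_0_iff)
    then show ?thesis using assms(3) sX True by (simp add: power_0_left)
  next
    case False
    have Hpos: "H > 0" using False s by (simp add: H_def sum_nonneg order.not_eq_order_implies_strict)
    have K: "K \<noteq> {}" using False by (auto simp: H_def)
    \<comment> \<open>Jensen with weights \<open>s k / H\<close>, proportional to the mean squares
      of the \<open>X Q k\<close>. After Khinchine every summand then carries the same factor
      \<open>H ^ p\<close>, and the weights add up to one.\<close>
    have "(\<Sum>Q\<in>Pow L. (\<Sum>k\<in>K. (X Q k)\<^sup>2) ^ p)
        \<le> (\<Sum>Q\<in>Pow L. \<Sum>k\<in>K. (s k / H) * (H * (X Q k)\<^sup>2 / s k) ^ p)"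
    proof (rule sum_mono)
      fix Q
      \<comment> \<open>Where \<open>s k = 0\<close> the quotient is zero by convention, and
        \<open>X Q k\<close> vanishes as well.\<close>
      have "(\<Sum>k\<in>K. (X Q k)\<^sup>2) = (\<Sum>k\<in>K. (s k / H) * (H * (X Q k)\<^sup>2 / s k))"
        using False sX by (intro sum.cong) auto
      also have "\<dots> ^ p \<le> (\<Sum>k\<in>K. (s k / H) * (H * (X Q k)\<^sup>2 / s k) ^ p)"
        using assms(1) K s Hpos
        by (intro sum_power_le) (auto simp: H_def[symmetric] sum_divide_distrib[symmetric])
      finally show "(\<Sum>k\<in>K. (X Q k)\<^sup>2) ^ p \<le> (\<Sum>k\<in>K. (s k / H) * (H * (X Q k)\<^sup>2 / s k) ^ p)" .
    qed
    also have "\<dots> = (\<Sum>k\<in>K. (s k / H) * (H / s k) ^ p * (\<Sum>Q\<in>Pow L. ((X Q k)\<^sup>2) ^ p))"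
      by (subst sum.swap) (simp add: sum_distrib_left sum_divide_distrib power_mult_distrib power_divide mult_ac)
    also have "\<dots> \<le> (\<Sum>k\<in>K. (s k / H) * (H / s k) ^ p * (2 ^ card L * ?B * s k ^ p))"
      using s Hpos by (intro sum_mono mult_left_mono X) auto
    also have "\<dots> \<le> (\<Sum>k\<in>K. (s k / H) * (2 ^ card L * ?B * H ^ p))"
    proof (rule sum_mono)
      fix k
      show "(s k / H) * (H / s k) ^ p * (2 ^ card L * ?B * s k ^ p) \<le> (s k / H) * (2 ^ card L * ?B * H ^ p)"
        by (cases "s k = 0") (simp_all add: power_divide mult_ac)
    qed
    also have "\<dots> = 2 ^ card L * ?B * H ^ p"
      using Hpos by (simp add: sum_distrib_right[symmetric] sum_divide_distrib[symmetric] H_def[symmetric])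
    finally show ?thesis .
  qed
  have "(\<Sum>P\<in>Pow K. \<Sum>Q\<in>Pow L. (\<Sum>k\<in>K. \<Sum>l\<in>L. sign_of P k * sign_of Q l * h k l) ^ (2 * p))
     = (\<Sum>Q\<in>Pow L. \<Sum>P\<in>Pow K. (\<Sum>k\<in>K. sign_of P k * X Q k) ^ (2 * p))"
    by (subst sum.swap) (simp add: X_def sum_distrib_left mult.assoc)
  also have "\<dots> \<le> (\<Sum>Q\<in>Pow L. 2 ^ card K * ?B * (\<Sum>k\<in>K. (X Q k)\<^sup>2) ^ p)"
    by (intro sum_mono khinchine assms)
  also have "\<dots> = 2 ^ card K * ?B * (\<Sum>Q\<in>Pow L. (\<Sum>k\<in>K. (X Q k)\<^sup>2) ^ p)"
    by (simp add: sum_distrib_left)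
  also have "\<dots> \<le> 2 ^ card K * ?B * (2 ^ card L * ?B * H ^ p)"
    by (intro mult_left_mono main) auto
  also have "\<dots> = 2 ^ card K * 2 ^ card L * (24 * real p) ^ (2 * p) * H ^ p"
    by (simp add: mult_2 power_add)
  finally show ?thesis by (simp add: H_def s_def)
qed

section \<open>Moments of cell counts\<close>

lemma prod_of_bool: "finite I \<Longrightarrow> (\<Prod>i\<in>I. of_bool (P i)) = (of_bool (\<forall>i\<in>I. P i) :: real)"
  by (induction I rule: finite_induct) auto

text \<open>One number \<open>\<rho>\<close> bounds both the joint cell probabilities and the
  products of marginals. A permuted sample pairs Y and Z values from the same or from different
  observations, and the two bounds cover the two situations.\<close>

locale cell_dist =
  fixes p :: "'u \<times> 'v \<Rightarrow> real" and A :: "'u set" and B :: "'v set" and \<rho> :: real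
  assumes finite_A: "finite A" and finite_B: "finite B"
    and p_nonneg': "\<And>c. 0 \<le> p c" and p_sum': "sum p (A \<times> B) = 1" and rho_nonneg: "0 \<le> \<rho>"
    and p_le: "\<And>c. c \<in> A \<times> B \<Longrightarrow> p c \<le> \<rho>"
    and marg_le: "\<And>a b. a \<in> A \<Longrightarrow> b \<in> B \<Longrightarrow> (\<Sum>b'\<in>B. p (a, b')) * (\<Sum>a'\<in>A. p (a', b)) \<le> \<rho>"

sublocale cell_dist \<subseteq> finite_dist p "A \<times> B"
  by unfold_locales (use finite_A finite_B p_nonneg' p_sum' in auto)

context cell_dist
begin

definition p1 :: "'u \<Rightarrow> real" where "p1 a = (\<Sum>b\<in>B. p (a, b))"
definition p2 :: "'v \<Rightarrow> real" where "p2 b = (\<Sum>a\<in>A. p (a, b))"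
definition dep :: "'u \<times> 'v \<Rightarrow> real" where "dep c = p c - p1 (fst c) * p2 (snd c)"
definition \<theta> :: real where "\<theta> = (\<Sum>c\<in>A \<times> B. (dep c)\<^sup>2)"
abbreviation E :: "nat set \<Rightarrow> ((nat \<Rightarrow> 'u \<times> 'v) \<Rightarrow> real) \<Rightarrow> real" where "E \<equiv> fexp p (A \<times> B)"

lemma p1_nonneg: "0 \<le> p1 a" and p2_nonneg: "0 \<le> p2 b"
  by (simp_all add: p1_def p2_def sum_nonneg p_nonneg)

text \<open>A position contributes \<open>p (a, b)\<close>, \<open>p1 a\<close>, \<open>p2 b\<close>
  or 1, depending on which of \<open>S\<close> and \<open>T\<close> contain it. Since the sets have
  equal size, each position in \<open>S\<close> only can be matched with one in \<open>T\<close>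
  only, so marginals occur only in products, which are at most \<open>\<rho>\<close>.\<close>

lemma cell_prob:
  assumes "finite I" "S \<subseteq> I" "T \<subseteq> I" "card S = card T" "a \<in> A" "b \<in> B"
  shows "E I (\<lambda>w. of_bool ((\<forall>i\<in>S. fst (w i) = a) \<and> (\<forall>i\<in>T. snd (w i) = b))) \<le> \<rho> ^ card S"
proof -
  have fin: "finite S" "finite T" using assms(1-3) by (auto intro: finite_subset)
  define g where "g i c = (of_bool ((i \<in> S \<longrightarrow> fst c = a) \<and> (i \<in> T \<longrightarrow> snd c = b)) :: real)" for i c
  have cp: "(\<Sum>c\<in>A \<times> B. h c) = (\<Sum>a'\<in>A. \<Sum>b'\<in>B. h (a', b'))" for h :: "'u \<times> 'v \<Rightarrow> real"
    by (simp add: sum.cartesian_product)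
  have q: "(\<Sum>c\<in>A \<times> B. p c * g i c)
      = (if i \<in> S \<inter> T then p (a, b) else if i \<in> S then p1 a else if i \<in> T then p2 b else 1)" for i
  proof -
    consider "i \<in> S" "i \<in> T" | "i \<in> S" "i \<notin> T" | "i \<notin> S" "i \<in> T" | "i \<notin> S" "i \<notin> T" by blast
    then show ?thesis
    proof cases
      case 1
      then have "(\<Sum>c\<in>A \<times> B. p c * g i c) = (\<Sum>c\<in>A \<times> B. if c = (a, b) then p c else 0)"
        by (intro sum.cong) (auto simp: g_def)
      then show ?thesis using 1 assms finite_A finite_B by (simp add: sum.delta)
    next
      case 2
      then have "(\<Sum>c\<in>A \<times> B. p c * g i c) = (\<Sum>a'\<in>A. \<Sum>b'\<in>B. if a' = a then p (a', b') else 0)"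
        unfolding cp by (intro sum.cong) (auto simp: g_def)
      also have "\<dots> = (\<Sum>a'\<in>A. if a' = a then p1 a' else 0)"
        by (intro sum.cong) (auto simp: p1_def)
      finally show ?thesis using 2 assms finite_A by (simp add: sum.delta)
    next
      case 3
      then have "(\<Sum>c\<in>A \<times> B. p c * g i c) = (\<Sum>a'\<in>A. \<Sum>b'\<in>B. if b' = b then p (a', b') else 0)"
        unfolding cp by (intro sum.cong) (auto simp: g_def)
      also have "\<dots> = p2 b" using assms finite_B by (simp add: sum.delta p2_def)
      finally show ?thesis using 3 by simp
    next
      case 4
      then show ?thesis using p_sum by (simp add: g_def)
    qed
  qed
  define r where "r i = (if i \<in> S \<inter> T then p (a, b) else if i \<in> S then p1 a else if i \<in> T then p2 b else 1)" for i
  have "E I (\<lambda>w. of_bool ((\<forall>i\<in>S. fst (w i) = a) \<and> (\<forall>i\<in>T. snd (w i) = b)))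
      = E I (\<lambda>w. \<Prod>i\<in>I. g i (w i))"
    unfolding g_def prod_of_bool[OF assms(1)]
    by (intro fexp_cong arg_cong[where f=of_bool]) (use assms(2,3) in blast)
  also have "\<dots> = prod r I"
    unfolding fexp_prod[OF assms(1) finite_C] q r_def ..
  also have "\<dots> = prod r ((S \<inter> T) \<union> ((S - T) \<union> (T - S)))"
  proof (rule prod.mono_neutral_right[OF assms(1)])
    show "S \<inter> T \<union> (S - T \<union> (T - S)) \<subseteq> I" using assms(2,3) by blast
    show "\<forall>i\<in>I - (S \<inter> T \<union> (S - T \<union> (T - S))). r i = 1"
    proof
      fix i assume "i \<in> I - (S \<inter> T \<union> (S - T \<union> (T - S)))"
      then have "i \<notin> S" "i \<notin> T" by blast+
      then show "r i = 1" unfolding r_def by simp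
    qed
  qed
  also have "\<dots> = prod r (S \<inter> T) * prod r ((S - T) \<union> (T - S))"
    using fin by (intro prod.union_disjoint) auto
  also have "prod r ((S - T) \<union> (T - S)) = prod r (S - T) * prod r (T - S)"
    using fin by (intro prod.union_disjoint) auto
  also have "prod r (S \<inter> T) * (prod r (S - T) * prod r (T - S))
      = (\<Prod>i\<in>S \<inter> T. p (a, b)) * ((\<Prod>i\<in>S - T. p1 a) * (\<Prod>i\<in>T - S. p2 b))"
    by (intro arg_cong2[where f="(*)"] prod.cong) (simp_all add: r_def)
  also have "\<dots> = p (a, b) ^ card (S \<inter> T) * (p1 a ^ card (S - T) * p2 b ^ card (T - S))" by simp
  also have "card (T - S) = card (S - T)"
    using card_Diff_subset_Int[of S T] card_Diff_subset_Int[of T S] fin assms(4) by (simp add: Int_commute)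
  also have "p (a, b) ^ card (S \<inter> T) * (p1 a ^ card (S - T) * p2 b ^ card (S - T))
     = p (a, b) ^ card (S \<inter> T) * (p1 a * p2 b) ^ card (S - T)" by (simp add: power_mult_distrib)
  also have "\<dots> \<le> \<rho> ^ card (S \<inter> T) * \<rho> ^ card (S - T)"
    using assms p_le[of "(a, b)"] marg_le[of a b] p_nonneg p1_nonneg p2_nonneg rho_nonneg
    by (intro mult_mono power_mono) (auto simp: p1_def p2_def)
  also have "\<dots> = \<rho> ^ card S"
    using card_Int_Diff[OF fin(1), of T] by (simp add: power_add)
  finally show ?thesis .
qed

text \<open>
  The bound of \<open>cell_prob\<close> turns the moments of a cell count into a recursion: multiplying by
  one more summand either repeats an index already present or costs a factor \<open>\<rho>\<close>.
\<close>
lemma cell_count_moment_aux: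
  assumes "finite I" "inj_on s {..<m}" "inj_on t {..<m}" "s ` {..<m} \<subseteq> I" "t ` {..<m} \<subseteq> I"
    and "a \<in> A" "b \<in> B" "R \<subseteq> {..<m}"
  shows "E I (\<lambda>w. of_bool (\<forall>k\<in>R. fst (w (s k)) = a \<and> snd (w (t k)) = b) *
      (\<Sum>k<m. of_bool (fst (w (s k)) = a \<and> snd (w (t k)) = b)) ^ N)
    \<le> (real (card R) + real N + real m * \<rho>) ^ N * \<rho> ^ card R"
  using assms(8)
proof (induction N arbitrary: R)
  case 0
  have "E I (\<lambda>w. of_bool (\<forall>k\<in>R. fst (w (s k)) = a \<and> snd (w (t k)) = b))
     = E I (\<lambda>w. of_bool ((\<forall>i\<in>s ` R. fst (w i) = a) \<and> (\<forall>i\<in>t ` R. snd (w i) = b)))"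
    by (intro fexp_cong) (auto simp: of_bool_def)
  also have "\<dots> \<le> \<rho> ^ card (s ` R)"
    using assms(1,4-7) 0 card_image[OF inj_on_subset[OF assms(2) 0]] card_image[OF inj_on_subset[OF assms(3) 0]]
    by (intro cell_prob) (auto simp: image_subset_iff subset_iff)
  also have "card (s ` R) = card R" using assms(2) 0 by (simp add: card_image inj_on_subset)
  finally show ?case by simp
next
  case (Suc N)
  let ?J = "\<lambda>R w. of_bool (\<forall>k\<in>R. fst (w (s k)) = a \<and> snd (w (t k)) = b) :: real"
  let ?M = "\<lambda>w. \<Sum>k<m. of_bool (fst (w (s k)) = a \<and> snd (w (t k)) = b) :: real"
  let ?b = "\<lambda>r. (r + real N + real m * \<rho>) ^ N"
  have finR: "finite R" using finite_subset[OF Suc.prems] by simp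
  have "E I (\<lambda>w. ?J R w * ?M w ^ Suc N) = E I (\<lambda>w. \<Sum>k<m. ?J (insert k R) w * ?M w ^ N)"
  proof (rule fexp_cong)
    fix w
    have J: "?J (insert k R) w = ?J R w * of_bool (fst (w (s k)) = a \<and> snd (w (t k)) = b)" for k
      unfolding of_bool_conj[symmetric] by (rule arg_cong[where f=of_bool]) blast
    have "?J R w * ?M w ^ Suc N = (?J R w * ?M w) * ?M w ^ N" by (simp only: power_Suc mult.assoc)
    also have "\<dots> = (\<Sum>k<m. ?J (insert k R) w) * ?M w ^ N" by (simp only: sum_distrib_left J)
    also have "\<dots> = (\<Sum>k<m. ?J (insert k R) w * ?M w ^ N)" by (rule sum_distrib_right)
    finally show "?J R w * ?M w ^ Suc N = (\<Sum>k<m. ?J (insert k R) w * ?M w ^ N)" .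
  qed
  also have "\<dots> = (\<Sum>k<m. E I (\<lambda>w. ?J (insert k R) w * ?M w ^ N))" by (rule fexp_sum)
  also have "\<dots> \<le> (\<Sum>k<m. ?b (real (card (insert k R))) * \<rho> ^ card (insert k R))"
    by (intro sum_mono Suc.IH) (use Suc.prems in auto)
  also have "\<dots> \<le> (\<Sum>k<m. ?b (real (card R) + 1) * \<rho> ^ card R * (if k \<in> R then 1 else \<rho>))"
  proof (rule sum_mono)
    fix k
    have "?b (real (card R)) \<le> ?b (real (card R) + 1)" using rho_nonneg by (intro power_mono) auto
    then show "?b (real (card (insert k R))) * \<rho> ^ card (insert k R)
        \<le> ?b (real (card R) + 1) * \<rho> ^ card R * (if k \<in> R then 1 else \<rho>)"
    proof (cases "k \<in> R")
      case True
      then show ?thesis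
        using mult_right_mono[OF \<open>?b (real (card R)) \<le> _\<close>, of "\<rho> ^ card R"] rho_nonneg by (simp add: insert_absorb)
    next
      case False
      then show ?thesis using finR by (simp add: mult_ac add_ac)
    qed
  qed
  also have "\<dots> = ?b (real (card R) + 1) * \<rho> ^ card R * (\<Sum>k<m. if k \<in> R then 1 else \<rho>)"
    by (simp add: sum_distrib_left)
  also have "\<dots> \<le> ?b (real (card R) + 1) * \<rho> ^ card R * (real (card R) + real (Suc N) + real m * \<rho>)"
  proof (rule mult_left_mono)
    have "(\<Sum>k<m. if k \<in> R then 1 else \<rho>) \<le> (\<Sum>k<m. of_bool (k \<in> R) + \<rho>)"
      using rho_nonneg by (intro sum_mono) auto
    also have "\<dots> = real (card R) + real m * \<rho>"
      using Suc.prems by (simp add: sum.distrib of_bool_def sum.If_cases Int_absorb1)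
    finally show "(\<Sum>k<m. if k \<in> R then 1 else \<rho>) \<le> real (card R) + real (Suc N) + real m * \<rho>" by simp
  qed (use rho_nonneg in auto)
  also have "\<dots> = (real (card R) + real (Suc N) + real m * \<rho>) ^ Suc N * \<rho> ^ card R"
    by (simp add: algebra_simps)
  finally show ?case .
qed

lemma cell_count_moment:
  assumes "finite I" "inj_on s {..<m}" "inj_on t {..<m}" "s ` {..<m} \<subseteq> I" "t ` {..<m} \<subseteq> I"
    and "a \<in> A" "b \<in> B"
  shows "E I (\<lambda>w. (\<Sum>k<m. of_bool (fst (w (s k)) = a \<and> snd (w (t k)) = b)) ^ N) \<le> (real N + real m * \<rho>) ^ N"
  using cell_count_moment_aux[OF assms, of "{}" N] by simp

end

section \<open>Variance of the U-statistic\<close>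

text \<open>A signed sum of four indicators has square at most four times their sum, by
  Cauchy-Schwarz; both brackets together give 16. Every coincidence is between the pair 0, 3 and the
  pair 1, 2, which explains the ranges of the indices.\<close>

lemma cell_kernel_sq_le:
  fixes x :: "nat \<Rightarrow> 'u \<times> 'v"
  shows "(cell_kernel (x 0) (x 1) (x 2) (x 3))\<^sup>2
    \<le> 16 * (\<Sum>e\<in>{0,3}. \<Sum>f\<in>{1,2}. \<Sum>g\<in>{0,3}. \<Sum>h\<in>{1,2}.
          of_bool (fst (x e) = fst (x f)) * of_bool (snd (x g) = snd (x h)))"
proof -
  have sq: "(of_bool P + of_bool Q - of_bool R - of_bool S)\<^sup>2
      \<le> 4 * (of_bool P + of_bool R + (of_bool S + of_bool Q) :: real)" for P Q R S
    by (cases P; cases Q; cases R; cases S) simp_all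
  have ck: "cell_kernel (x 0) (x 1) (x 2) (x 3)
    = (of_bool (fst (x 0) = fst (x 1)) + of_bool (fst (x 3) = fst (x 2))
       - of_bool (fst (x 0) = fst (x 2)) - of_bool (fst (x 3) = fst (x 1))) *
      (of_bool (snd (x 0) = snd (x 1)) + of_bool (snd (x 3) = snd (x 2))
       - of_bool (snd (x 0) = snd (x 2)) - of_bool (snd (x 3) = snd (x 1)))"
    by (simp only: cell_kernel_def eq_commute[of "fst (x 3)"] eq_commute[of "snd (x 3)"])
  have S: "(\<Sum>e\<in>{0,3}. \<Sum>f\<in>{1,2}. F e f) = F 0 1 + F 0 2 + (F 3 1 + F 3 2)" for F :: "nat \<Rightarrow> nat \<Rightarrow> real"
    by simp
  have "(cell_kernel (x 0) (x 1) (x 2) (x 3))\<^sup>2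
     \<le> (4 * (\<Sum>e\<in>{0,3}. \<Sum>f\<in>{1,2}. of_bool (fst (x e) = fst (x f))))
       * (4 * (\<Sum>g\<in>{0,3}. \<Sum>h\<in>{1,2}. of_bool (snd (x g) = snd (x h))))"
    unfolding ck power_mult_distrib S by (intro mult_mono sq) auto
  also have "\<dots> = 16 * (\<Sum>e\<in>{0,3}. \<Sum>f\<in>{1,2}. \<Sum>g\<in>{0,3}. \<Sum>h\<in>{1,2}.
          of_bool (fst (x e) = fst (x f)) * of_bool (snd (x g) = snd (x h)))"
    by (simp add: distrib_left distrib_right)
  finally show ?thesis .
qed

context cell_dist
begin

abbreviation pair_mean :: "('u \<times> 'v \<Rightarrow> 'u \<times> 'v \<Rightarrow> real) \<Rightarrow> real" where
  "pair_mean F \<equiv> \<Sum>u\<in>A \<times> B. \<Sum>v\<in>A \<times> B. p u * p v * F u v"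

lemma sum_cells: "(\<Sum>c\<in>A \<times> B. h c) = (\<Sum>a\<in>A. \<Sum>b\<in>B. h (a, b))" for h :: "'u \<times> 'v \<Rightarrow> real"
  by (simp add: sum.cartesian_product)

lemma sum_p_fst: "(\<Sum>c\<in>A \<times> B. p c * f (fst c)) = (\<Sum>a\<in>A. p1 a * f a)"
  by (simp add: sum_cells p1_def sum_distrib_right)

lemma sum_p_snd: "(\<Sum>c\<in>A \<times> B. p c * f (snd c)) = (\<Sum>b\<in>B. p2 b * f b)"
  unfolding sum_cells by (subst sum.swap) (simp add: p2_def sum_distrib_right)

lemma sum_pp_mult:
  "pair_mean (\<lambda>u v. (f u * g v)) = (\<Sum>u\<in>A \<times> B. p u * f u) * (\<Sum>v\<in>A \<times> B. p v * g v)"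
  by (simp add: sum_product mult_ac)

lemma sum_pp_cmult:
  "pair_mean (\<lambda>u v. (f u v * a)) = pair_mean (\<lambda>u v. f u v) * a"
  by (simp only: sum_distrib_right mult.assoc)

lemma sum_pp_add:
  "pair_mean (\<lambda>u v. (f u v + g u v))
    = pair_mean (\<lambda>u v. f u v) + pair_mean (\<lambda>u v. g u v)"
  by (simp add: distrib_left sum.distrib)

lemma sum_pp_sum:
  "pair_mean (\<lambda>u v. (\<Sum>c\<in>S. f c u v))
    = (\<Sum>c\<in>S. \<Sum>u\<in>A \<times> B. \<Sum>v\<in>A \<times> B. p u * p v * f c u v)"
proof -
  have "pair_mean (\<lambda>u v. (\<Sum>c\<in>S. f c u v))
      = (\<Sum>u\<in>A \<times> B. \<Sum>v\<in>A \<times> B. \<Sum>c\<in>S. p u * p v * f c u v)"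
    by (simp only: sum_distrib_left)
  also have "\<dots> = (\<Sum>u\<in>A \<times> B. \<Sum>c\<in>S. \<Sum>v\<in>A \<times> B. p u * p v * f c u v)"
    by (intro sum.cong refl sum.swap)
  also have "\<dots> = (\<Sum>c\<in>S. \<Sum>u\<in>A \<times> B. \<Sum>v\<in>A \<times> B. p u * p v * f c u v)"
    by (rule sum.swap)
  finally show ?thesis .
qed

lemma sum_pp_left: "pair_mean (\<lambda>u v. f u) = (\<Sum>u\<in>A \<times> B. p u * f u)"
  using sum_pp_mult[of f "\<lambda>_. 1"] p_sum by simp

lemma sum_pp_right: "pair_mean (\<lambda>u v. f v) = (\<Sum>u\<in>A \<times> B. p u * f u)"
  using sum_pp_mult[of "\<lambda>_. 1" f] p_sum by simp

text \<open>The form is chosen so that every term depends on one of \<open>u\<close>,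
  \<open>v\<close> only or is a product of a function of each, whose pair means are
  available.\<close>

lemma pair_feature_expand:
  "pair_feature c u v = of_bool (u = c) + of_bool (v = c)
     + (of_bool (fst u = fst c) * - of_bool (snd v = snd c))
     + (of_bool (snd u = snd c) * - of_bool (fst v = fst c))"
  by (auto simp: pair_feature_def of_bool_def prod_eq_iff)

lemma sum_p_eq: "c \<in> A \<times> B \<Longrightarrow> (\<Sum>u\<in>A \<times> B. p u * of_bool (u = c)) = p c"
  using finite_C by (simp add: of_bool_def if_distrib[of "\<lambda>x. _ * x"] cong: if_cong)

lemma sum_p_fst_eq: "a \<in> A \<Longrightarrow> (\<Sum>u\<in>A \<times> B. p u * of_bool (fst u = a)) = p1 a"
  unfolding sum_p_fst[of "\<lambda>x. of_bool (x = a)"]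
  using finite_A by (simp add: of_bool_def if_distrib[of "\<lambda>x. _ * x"] cong: if_cong)

lemma sum_p_snd_eq: "b \<in> B \<Longrightarrow> (\<Sum>u\<in>A \<times> B. p u * of_bool (snd u = b)) = p2 b"
  unfolding sum_p_snd[of "\<lambda>x. of_bool (x = b)"]
  using finite_B by (simp add: of_bool_def if_distrib[of "\<lambda>x. _ * x"] cong: if_cong)

lemma sum_pp_pair_feature:
  assumes "c \<in> A \<times> B"
  shows "pair_mean (\<lambda>u v. pair_feature c u v) = 2 * dep c"
proof -
  have c: "fst c \<in> A" "snd c \<in> B" using assms by auto
  show ?thesis
    unfolding pair_feature_expand sum_pp_add sum_pp_mult sum_pp_left sum_pp_right mult_minus_right sum_negf
    by (simp add: sum_p_eq[OF assms] sum_p_fst_eq[OF c(1)] sum_p_snd_eq[OF c(2)] dep_def)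
qed

text \<open>The conditional mean of the kernel given one of its two pairs, that is, its uncentred
  first-order Hoeffding projection: the other pair is replaced by its mean feature
  \<open>2 * dep c\<close>.\<close>

definition proj :: "'u \<times> 'v \<Rightarrow> 'u \<times> 'v \<Rightarrow> real" where
  "proj u v = (\<Sum>c\<in>A \<times> B. pair_feature c u v * (2 * dep c))"

lemma sum_pp_kernel_inner:
  assumes "u \<in> A \<times> B" "v \<in> A \<times> B"
  shows "pair_mean (\<lambda>u' v'. cell_kernel u u' v' v) = proj u v"
proof -
  have "pair_mean (\<lambda>u' v'. cell_kernel u u' v' v)
      = pair_mean (\<lambda>u' v'. (\<Sum>c\<in>A \<times> B. pair_feature c u' v' * pair_feature c u v))"
    using assms by (intro sum.cong refl) (simp add: cell_kernel_eq_sum[OF finite_A finite_B] mult.commute)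
  also have "\<dots> = proj u v"
    unfolding sum_pp_sum sum_pp_cmult proj_def
    by (intro sum.cong refl) (simp add: sum_pp_pair_feature)
  finally show ?thesis .
qed

lemma sum_pp_kernel_outer:
  assumes "u \<in> A \<times> B" "v \<in> A \<times> B"
  shows "pair_mean (\<lambda>u' v'. cell_kernel u' u v v') = proj u v"
proof -
  have "pair_mean (\<lambda>u' v'. cell_kernel u' u v v')
      = pair_mean (\<lambda>u' v'. (\<Sum>c\<in>A \<times> B. pair_feature c u' v' * pair_feature c u v))"
    using assms by (intro sum.cong refl) (simp add: cell_kernel_eq_sum[OF finite_A finite_B])
  also have "\<dots> = proj u v"
    unfolding sum_pp_sum sum_pp_cmult proj_def
    by (intro sum.cong refl) (simp add: sum_pp_pair_feature)
  finally show ?thesis .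
qed

lemma sum_pp_proj: "pair_mean (\<lambda>u v. proj u v) = 4 * \<theta>"
proof -
  have "pair_mean (\<lambda>u v. proj u v) = (\<Sum>c\<in>A \<times> B. 2 * dep c * (2 * dep c))"
    unfolding proj_def sum_pp_sum sum_pp_cmult
    by (intro sum.cong refl) (simp add: sum_pp_pair_feature)
  also have "\<dots> = 4 * \<theta>" unfolding \<theta>_def sum_distrib_left by (simp add: power2_eq_square)
  finally show ?thesis .
qed

text \<open>The indicators in the feature select single cells. With only four values of
  \<open>dep\<close> left, the second moment of the projection is of order
  \<open>\<rho> * \<theta>\<close>, without a factor counting cells.\<close>

lemma proj_eq:
  assumes "u \<in> A \<times> B" "v \<in> A \<times> B"
  shows "proj u v = 2 * (dep u + dep v - dep (fst u, snd v) - dep (fst v, snd u))"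
proof -
  have s: "(\<Sum>c\<in>A \<times> B. of_bool (d = c) * h c) = (h d :: real)" if "d \<in> A \<times> B" for d h
    using sum_of_bool_eq[OF finite_C that] .
  have "proj u v = (\<Sum>c\<in>A \<times> B. of_bool (u = c) * (2 * dep c) + of_bool (v = c) * (2 * dep c)
      - of_bool ((fst u, snd v) = c) * (2 * dep c) - of_bool ((fst v, snd u) = c) * (2 * dep c))"
    unfolding proj_def
  proof (intro sum.cong refl)
    fix c :: "'u \<times> 'v"
    have *: "of_bool ((x, y) = c) = (of_bool (x = fst c) * of_bool (y = snd c) :: real)" for x y
      by (cases c) simp
    show "pair_feature c u v * (2 * dep c) = of_bool (u = c) * (2 * dep c) + of_bool (v = c) * (2 * dep c)
      - of_bool ((fst u, snd v) = c) * (2 * dep c) - of_bool ((fst v, snd u) = c) * (2 * dep c)"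
      unfolding pair_feature_expand * by (simp add: algebra_simps)
  qed
  then show ?thesis
    unfolding sum_subtractf sum.distrib
    using assms by (subst (asm) (1 2 3 4) s) auto
qed

lemma sum_p_dep_sq_le: "(\<Sum>u\<in>A \<times> B. p u * (dep u)\<^sup>2) \<le> \<rho> * \<theta>"
  unfolding \<theta>_def sum_distrib_left by (intro sum_mono mult_right_mono p_le) auto

text \<open>A cell assembled from two independent observations follows the product of the marginals,
  so \<open>marg_le\<close> takes the place of \<open>p_le\<close>.\<close>

lemma sum_pp_dep_cross_le:
  "pair_mean (\<lambda>u v. (dep (fst u, snd v))\<^sup>2) \<le> \<rho> * \<theta>"
  "pair_mean (\<lambda>u v. (dep (fst v, snd u))\<^sup>2) \<le> \<rho> * \<theta>"
proof -
  have "pair_mean (\<lambda>u v. (dep (fst u, snd v))\<^sup>2)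
      = (\<Sum>u\<in>A \<times> B. p u * (\<Sum>v\<in>A \<times> B. p v * (dep (fst u, snd v))\<^sup>2))"
    by (simp add: sum_distrib_left mult.assoc)
  also have "\<dots> = (\<Sum>a\<in>A. \<Sum>b\<in>B. (p1 a * p2 b) * (dep (a, b))\<^sup>2)"
    unfolding sum_p_fst[of "\<lambda>a. \<Sum>v\<in>A \<times> B. p v * (dep (a, snd v))\<^sup>2"]
    by (intro sum.cong refl, subst sum_p_snd) (simp add: sum_distrib_left mult.assoc)
  also have "\<dots> \<le> (\<Sum>a\<in>A. \<Sum>b\<in>B. \<rho> * (dep (a, b))\<^sup>2)"
    using marg_le by (intro sum_mono mult_right_mono) (auto simp: p1_def p2_def)
  also have "\<dots> = \<rho> * \<theta>" by (simp add: \<theta>_def sum_cells sum_distrib_left)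
  finally show 1: "pair_mean (\<lambda>u v. (dep (fst u, snd v))\<^sup>2) \<le> \<rho> * \<theta>" .
  show "pair_mean (\<lambda>u v. (dep (fst v, snd u))\<^sup>2) \<le> \<rho> * \<theta>"
    by (subst sum.swap) (use 1 in \<open>simp add: mult_ac\<close>)
qed

lemma sum_pp_proj_sq_le: "pair_mean (\<lambda>u v. (proj u v)\<^sup>2) \<le> 64 * \<rho> * \<theta>"
proof -
  have sq: "(2 * (x + y - z - w))\<^sup>2 \<le> 16 * x\<^sup>2 + 16 * y\<^sup>2 + 16 * z\<^sup>2 + 16 * w\<^sup>2" for x y z w :: real
  proof -
    have "16 * x\<^sup>2 + 16 * y\<^sup>2 + 16 * z\<^sup>2 + 16 * w\<^sup>2 - (2 * (x + y - z - w))\<^sup>2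
        = 4 * ((x - y)\<^sup>2 + (x + z)\<^sup>2 + (x + w)\<^sup>2 + (y + z)\<^sup>2 + (y + w)\<^sup>2 + (z - w)\<^sup>2)"
      by (simp add: power2_eq_square algebra_simps)
    moreover have "\<dots> \<ge> 0" by simp
    ultimately show ?thesis by linarith
  qed
  have "pair_mean (\<lambda>u v. (proj u v)\<^sup>2)
     \<le> pair_mean (\<lambda>u v.
          ((dep u)\<^sup>2 * 16 + (dep v)\<^sup>2 * 16 + (dep (fst u, snd v))\<^sup>2 * 16 + (dep (fst v, snd u))\<^sup>2 * 16))"
  proof (intro sum_mono mult_left_mono)
    fix u v assume uv: "u \<in> A \<times> B" "v \<in> A \<times> B"
    show "(proj u v)\<^sup>2 \<le> (dep u)\<^sup>2 * 16 + (dep v)\<^sup>2 * 16 + (dep (fst u, snd v))\<^sup>2 * 16 + (dep (fst v, snd u))\<^sup>2 * 16"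
      unfolding proj_eq[OF uv] using sq[of "dep u" "dep v" "dep (fst u, snd v)" "dep (fst v, snd u)"] by linarith
  qed (auto simp: p_nonneg)
  also have "\<dots> = (\<Sum>u\<in>A \<times> B. p u * (dep u)\<^sup>2) * 16 + (\<Sum>u\<in>A \<times> B. p u * (dep u)\<^sup>2) * 16
      + pair_mean (\<lambda>u v. (dep (fst u, snd v))\<^sup>2) * 16
      + pair_mean (\<lambda>u v. (dep (fst v, snd u))\<^sup>2) * 16"
    unfolding sum_pp_add sum_pp_cmult sum_pp_left sum_pp_right ..
  also have "\<dots> \<le> 64 * \<rho> * \<theta>"
    using sum_p_dep_sq_le sum_pp_dep_cross_le by linarith
  finally show ?thesis .
qed

lemma fexp_four:
  assumes "finite I" "distinct [a, d, b, c]" "{a, d, b, c} \<subseteq> I"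
  shows "E I (\<lambda>w. F (w a) (w d) (w b) (w c))
    = pair_mean (\<lambda>u v. pair_mean (\<lambda>u' v'. F u v u' v'))"
proof -
  have "E I (\<lambda>w. F (w a) (w d) (w b) (w c))
      = (\<Sum>u\<in>A \<times> B. p u * (\<Sum>v\<in>A \<times> B. p v * E (I - {a} - {d}) (\<lambda>w. F u v (w b) (w c))))"
    using assms by (subst fexp_pick[of _ a], simp, simp, subst fexp_pick[of _ d]) auto
  also have "\<dots> = (\<Sum>u\<in>A \<times> B. p u * (\<Sum>v\<in>A \<times> B. p v * pair_mean (\<lambda>u' v'. F u v u' v')))"
    using assms by (subst fexp_pair) auto
  finally show ?thesis by (simp only: sum_distrib_left mult.assoc)
qed

text \<open>Two kernels that share one pair are conditionally independent given that pair. This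
  produces the squared projection in the variance.\<close>

lemma fexp_six:
  assumes "finite I" "distinct [a, d, b, c, b', c']" "{a, d, b, c, b', c'} \<subseteq> I"
  shows "E I (\<lambda>w. F (w a) (w d) (w b) (w c) * G (w a) (w d) (w b') (w c'))
    = pair_mean (\<lambda>u v. (pair_mean (\<lambda>u' v'. F u v u' v')
        * pair_mean (\<lambda>u' v'. G u v u' v')))"
proof -
  let ?I = "I - {a} - {d}"
  have "E I (\<lambda>w. F (w a) (w d) (w b) (w c) * G (w a) (w d) (w b') (w c'))
      = (\<Sum>u\<in>A \<times> B. p u * (\<Sum>v\<in>A \<times> B. p v * E ?I (\<lambda>w. F u v (w b) (w c) * G u v (w b') (w c'))))"
    using assms by (subst fexp_pick[of _ a], simp, simp, subst fexp_pick[of _ d]) auto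
  also have "\<dots> = (\<Sum>u\<in>A \<times> B. p u * (\<Sum>v\<in>A \<times> B. p v *
      (E ?I (\<lambda>w. F u v (w b) (w c)) * E ?I (\<lambda>w. G u v (w b') (w c')))))"
    using assms by (subst fexp_indep[of _ "{b, c}" "{b', c'}"]) auto
  also have "\<dots> = (\<Sum>u\<in>A \<times> B. p u * (\<Sum>v\<in>A \<times> B. p v * (pair_mean (\<lambda>u' v'. F u v u' v')
        * pair_mean (\<lambda>u' v'. G u v u' v'))))"
  proof -
    have "E ?I (\<lambda>w. F u v (w b) (w c)) = pair_mean (\<lambda>u' v'. F u v u' v')"
      "E ?I (\<lambda>w. G u v (w b') (w c')) = pair_mean (\<lambda>u' v'. G u v u' v')" for u v
      using assms by (auto intro!: fexp_pair)
    then show ?thesis by (simp only:)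
  qed
  finally show ?thesis by (simp only: sum_distrib_left mult.assoc)
qed

text \<open>Split according to the common cells: for each \<open>c\<close> two first coordinates and
  two second coordinates are prescribed, so \<open>cell_prob\<close> applies with sets of size
  two.\<close>

lemma fexp_coincidence_le:
  assumes "finite I" "i \<noteq> j" "k \<noteq> l" "{i, j, k, l} \<subseteq> I"
  shows "E I (\<lambda>w. of_bool (fst (w i) = fst (w j)) * of_bool (snd (w k) = snd (w l)))
    \<le> real (card (A \<times> B)) * \<rho>\<^sup>2"
proof -
  have "E I (\<lambda>w. of_bool (fst (w i) = fst (w j)) * of_bool (snd (w k) = snd (w l)))
     = E I (\<lambda>w. \<Sum>c\<in>A \<times> B. of_bool ((\<forall>x\<in>{i, j}. fst (w x) = fst c) \<and> (\<forall>x\<in>{k, l}. snd (w x) = snd c)))"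
  proof (rule fexp_cong)
    fix w assume "w \<in> PiE I (\<lambda>_. A \<times> B)"
    then have "w i \<in> A \<times> B" "w k \<in> A \<times> B" using assms(4) by auto
    then have m: "(fst (w i), snd (w k)) \<in> A \<times> B" by auto
    have "(\<Sum>c\<in>A \<times> B. of_bool ((\<forall>x\<in>{i, j}. fst (w x) = fst c) \<and> (\<forall>x\<in>{k, l}. snd (w x) = snd c)))
      = (\<Sum>c\<in>A \<times> B. of_bool ((fst (w i), snd (w k)) = c)
          * (of_bool (fst (w i) = fst (w j)) * of_bool (snd (w k) = snd (w l)) :: real))"
      by (intro sum.cong refl) auto
    then show "of_bool (fst (w i) = fst (w j)) * of_bool (snd (w k) = snd (w l))
      = (\<Sum>c\<in>A \<times> B. of_bool ((\<forall>x\<in>{i, j}. fst (w x) = fst c) \<and> (\<forall>x\<in>{k, l}. snd (w x) = snd c)) :: real)"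
      using sum_of_bool_eq[OF finite_C m] by simp
  qed
  also have "\<dots> \<le> (\<Sum>c\<in>A \<times> B. \<rho> ^ card {i, j})"
    unfolding fexp_sum by (intro sum_mono cell_prob) (use assms in auto)
  also have "\<dots> = real (card (A \<times> B)) * \<rho>\<^sup>2" using assms(2) by (simp add: power2_eq_square)
  finally show ?thesis .
qed

lemma fexp_kernel_sq_le:
  assumes "finite I" "distinct [i, j, k, l]" "{i, j, k, l} \<subseteq> I"
  shows "E I (\<lambda>w. (cell_kernel (w i) (w j) (w k) (w l))\<^sup>2) \<le> 256 * real (card (A \<times> B)) * \<rho>\<^sup>2"
proof -
  \<comment> \<open>The default value \<open>l\<close> serves as \<open>y 3\<close>. The constant
    256 is 16 from \<open>cell_kernel_sq_le\<close> times 16 patterns of coincidence.\<close>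
  define y where "y = (\<lambda>_::nat. l)(0 := i, 1 := j, 2 := k)"
  have y: "y 0 = i" "y 1 = j" "y 2 = k" "y 3 = l" by (simp_all add: y_def)
  have ne: "y e \<noteq> y f" if "e \<in> {0, 3}" "f \<in> {1, 2}" for e f
    using that assms(2) y by auto
  have yI: "y e \<in> I" if "e \<in> {0, 3} \<union> {1, 2}" for e using that assms(3) y by auto
  have "E I (\<lambda>w. (cell_kernel (w i) (w j) (w k) (w l))\<^sup>2)
     \<le> E I (\<lambda>w. 16 * (\<Sum>e\<in>{0,3}. \<Sum>f\<in>{1,2}. \<Sum>g\<in>{0,3}. \<Sum>h\<in>{1,2}.
          of_bool (fst (w (y e)) = fst (w (y f))) * of_bool (snd (w (y g)) = snd (w (y h)))))"
    by (rule fexp_mono) (use cell_kernel_sq_le[of "\<lambda>e. w (y e)" for w] y in metis)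
  also have "\<dots> = 16 * (\<Sum>e\<in>{0,3}. \<Sum>f\<in>{1,2}. \<Sum>g\<in>{0,3}. \<Sum>h\<in>{1,2}.
          E I (\<lambda>w. of_bool (fst (w (y e)) = fst (w (y f))) * of_bool (snd (w (y g)) = snd (w (y h)))))"
    by (simp only: fexp_cmult fexp_sum)
  also have "\<dots> \<le> 16 * (\<Sum>e\<in>{0::nat,3}. \<Sum>f\<in>{1::nat,2}. \<Sum>g\<in>{0::nat,3}. \<Sum>h\<in>{1::nat,2}. real (card (A \<times> B)) * \<rho>\<^sup>2)"
    by (intro mult_left_mono sum_mono fexp_coincidence_le assms(1) ne) (use yI in auto)
  finally show ?thesis by simp
qed

end

section \<open>Averaging over relabellings and swaps\<close>

lemma average_power_even_le:
  fixes y :: "'a \<Rightarrow> real"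
  assumes "finite J" "J \<noteq> {}"
  shows "((\<Sum>j\<in>J. y j) / card J) ^ (2 * p) \<le> (\<Sum>j\<in>J. y j ^ (2 * p)) / card J"
proof -
  have N: "real (card J) > 0" using assms by (simp add: card_gt_0_iff)
  have "(\<Sum>j\<in>J. (1 / card J) *\<^sub>R y j) ^ (2 * p) \<le> (\<Sum>j\<in>J. (1 / card J) * y j ^ (2 * p))"
    by (rule convex_on_sum[OF assms convex_power_even]) (use N in auto)
  then show ?thesis by (simp add: sum_divide_distrib)
qed

text \<open>The reflection of \<open>e\<close> to \<open>3 - e\<close> exchanges the two members of
  a pair, blocks 0 and 3 or blocks 1 and 2. \<open>P\<close> and \<open>Q\<close> select the offsets
  at which the outer and the inner pairs are exchanged.\<close>

lemma slot_swap_permutation: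
  assumes "4 * m \<le> n"
  shows "\<exists>s. s permutes {1..n} \<and> (\<forall>k<m. \<forall>e<4.
    s (slot m e k) = slot m (if k \<in> (if e \<in> {0, 3} then P else Q) then 3 - e else e) k)"
proof -
  define S where "S e k \<longleftrightarrow> k \<in> (if e \<in> {0, 3} then P else Q)" for e k :: nat
  define A where "A = (\<lambda>(e, k). slot m e k) ` ({..<4} \<times> {..<m})"
  define f where "f x = (let e = (x - 1) div m; k = (x - 1) mod m in slot m (if S e k then 3 - e else e) k)" for x
  have f: "f (slot m e k) = slot m (if S e k then 3 - e else e) k" if "k < m" for e k
    using that by (simp add: f_def slot_def Let_def)
  have four: "e < 4 \<longleftrightarrow> e = 0 \<or> e = 1 \<or> e = 2 \<or> e = (3::nat)" for e by auto
  have "inj_on f A"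
  proof (rule inj_onI)
    fix x y assume "x \<in> A" "y \<in> A" and eq: "f x = f y"
    then obtain e k e' k' where x: "x = slot m e k" "e < 4" "k < m" and y: "y = slot m e' k'" "e' < 4" "k' < m"
      unfolding A_def by auto
    from eq have "(if S e k then 3 - e else e) = (if S e' k' then 3 - e' else e') \<and> k = k'"
      unfolding x(1) y(1) f[OF x(3)] f[OF y(3)] slot_eq_iff[OF x(3) y(3)] .
    then have "k = k'" and "(if S e k then 3 - e else e) = (if S e' k then 3 - e' else e')" by auto
    \<comment> \<open>\<open>e\<close> and \<open>3 - e\<close> lie in the same class, {0, 3} or {1,
      2}, so both consult the same set of switches and the reflection can be undone.\<close>
    then have "e = e'"
      using x(2) y(2) unfolding four S_def by (elim disjE) (auto split: if_splits)
    then show "x = y" using x y \<open>k = k'\<close> by simp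
  qed
  moreover have "A \<subseteq> {1..n}" unfolding A_def using assms slot_range by auto
  moreover have "f ` A \<subseteq> {1..n}"
  proof
    fix x assume "x \<in> f ` A"
    then obtain e k where ek: "e < 4" "k < m" "x = f (slot m e k)" unfolding A_def by auto
    have "(if S e k then 3 - e else e) < 4" using ek(1) by auto
    then show "x \<in> {1..n}" unfolding ek(3) f[OF ek(2)] using ek(2) assms by (intro slot_range) auto
  qed
  ultimately obtain s where s: "s permutes {1..n}" "\<And>x. x \<in> A \<Longrightarrow> s x = f x"
    using permutes_extend[of "{1..n}" f A] by auto
  show ?thesis
  proof (intro exI[of _ s] conjI s(1) allI impI)
    fix k e :: nat assume ke: "k < m" "e < 4"
    then have "slot m e k \<in> A" unfolding A_def by auto
    then show "s (slot m e k) = slot m (if k \<in> (if e \<in> {0, 3} then P else Q) then 3 - e else e) k"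
      using s(2) f[OF ke(1)] unfolding S_def by simp
  qed
qed

text \<open>The two components carry separate relabellings: permuting the sample by
  \<open>\<pi>\<close> and then relabelling by \<open>\<sigma>\<close> means
  \<open>\<tau> = \<pi> \<circ> \<sigma>\<close>. For fixed \<open>\<sigma>\<close>, summing over
  all \<open>\<pi>\<close> is therefore summing over all \<open>\<tau>\<close>.\<close>

definition perm_kernel :: "nat \<Rightarrow> (nat \<Rightarrow> nat) \<Rightarrow> (nat \<Rightarrow> nat) \<Rightarrow> (nat \<Rightarrow> 'u \<times> 'v) \<Rightarrow> nat \<Rightarrow> nat \<Rightarrow> real" where
  "perm_kernel m \<sigma> \<tau> w k l = (let x = (\<lambda>i. (fst (w (\<sigma> i)), snd (w (\<tau> i))))
     in cell_kernel (x (slot m 0 k)) (x (slot m 1 l)) (x (slot m 2 l)) (x (slot m 3 k)))"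

text \<open>The second bracket of the kernel is antisymmetric under exchanging arguments 1 and 4,
  and likewise under exchanging 2 and 3.\<close>

lemma cell_kernel_swap:
  "cell_kernel (a1, if P then b4 else b1) (a2, if Q then b3 else b2) (a3, if Q then b2 else b3) (a4, if P then b1 else b4)
    = (if P then -1 else 1) * (if Q then -1 else 1) * cell_kernel (a1, b1) (a2, b2) (a3, b3) (a4, b4)"
  by (cases P; cases Q)
     (simp_all add: cell_kernel_def eq_commute[of b4 b2] eq_commute[of b3 b1] eq_commute[of b4 b3]
      eq_commute[of b2 b1] algebra_simps)

text \<open>Symmetrization: swapping second components between blocks 0 and 3, or 1 and 2, only produces signs.\<close>
lemma sum_perm_kernel_power_le:
  assumes "0 < m" "4 * m \<le> n" "1 \<le> p"
  shows "(\<Sum>\<tau> | \<tau> permutes {1..n}. (\<Sum>k<m. \<Sum>l<m. perm_kernel m \<sigma> \<tau> w k l) ^ (2 * p))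
    \<le> (24 * real p) ^ (2 * p) * (\<Sum>\<tau> | \<tau> permutes {1..n}. (\<Sum>k<m. \<Sum>l<m. (perm_kernel m \<sigma> \<tau> w k l)\<^sup>2) ^ p)"
proof -
  let ?P = "{\<tau>. \<tau> permutes {1..n}}" and ?W = "Pow {..<m}"
  let ?F = "\<lambda>\<tau>. (\<Sum>k<m. \<Sum>l<m. perm_kernel m \<sigma> \<tau> w k l) ^ (2 * p)"
  have sw: "(\<Sum>\<tau>\<in>?P. ?F \<tau>)
      = (\<Sum>\<tau>\<in>?P. (\<Sum>k<m. \<Sum>l<m. sign_of P k * sign_of Q l * perm_kernel m \<sigma> \<tau> w k l) ^ (2 * p))" for P Q
  proof -
    from slot_swap_permutation[OF assms(2), of P Q] obtain s where s: "s permutes {1..n}" and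
      sl': "\<forall>k<m. \<forall>e<4. s (slot m e k) = slot m (if k \<in> (if e \<in> {0, 3} then P else Q) then 3 - e else e) k"
      by (elim exE conjE)
    have sl: "s (slot m 0 k) = slot m (if k \<in> P then 3 else 0) k" "s (slot m 3 k) = slot m (if k \<in> P then 0 else 3) k"
      "s (slot m 1 k) = slot m (if k \<in> Q then 2 else 1) k" "s (slot m 2 k) = slot m (if k \<in> Q then 1 else 2) k"
      if "k < m" for k
      using sl'[THEN spec, THEN mp, OF that, THEN spec, of 0] sl'[THEN spec, THEN mp, OF that, THEN spec, of 1]
        sl'[THEN spec, THEN mp, OF that, THEN spec, of 2] sl'[THEN spec, THEN mp, OF that, THEN spec, of 3]
      by simp_all
    have pk: "perm_kernel m \<sigma> (\<tau> \<circ> s) w k l = sign_of P k * sign_of Q l * perm_kernel m \<sigma> \<tau> w k l"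
      if "k < m" "l < m" for k l \<tau>
    proof -
      have "perm_kernel m \<sigma> (\<tau> \<circ> s) w k l = cell_kernel
          (fst (w (\<sigma> (slot m 0 k))), if k \<in> P then snd (w (\<tau> (slot m 3 k))) else snd (w (\<tau> (slot m 0 k))))
          (fst (w (\<sigma> (slot m 1 l))), if l \<in> Q then snd (w (\<tau> (slot m 2 l))) else snd (w (\<tau> (slot m 1 l))))
          (fst (w (\<sigma> (slot m 2 l))), if l \<in> Q then snd (w (\<tau> (slot m 1 l))) else snd (w (\<tau> (slot m 2 l))))
          (fst (w (\<sigma> (slot m 3 k))), if k \<in> P then snd (w (\<tau> (slot m 0 k))) else snd (w (\<tau> (slot m 3 k))))"
        unfolding perm_kernel_def Let_def comp_def sl[OF that(1)] sl[OF that(2)]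
        by (cases "k \<in> P"; cases "l \<in> Q") (simp_all only: if_True if_False)
      then show ?thesis
        unfolding cell_kernel_swap by (simp add: sign_of_def perm_kernel_def Let_def)
    qed
    have "(\<Sum>\<tau>\<in>?P. ?F \<tau>) = (\<Sum>\<tau>\<in>?P. ?F (\<tau> \<circ> s))"
      by (rule sum_permutations_compose_right[OF s])
    also have "\<dots> = (\<Sum>\<tau>\<in>?P. (\<Sum>k<m. \<Sum>l<m. sign_of P k * sign_of Q l * perm_kernel m \<sigma> \<tau> w k l) ^ (2 * p))"
      by (intro sum.cong arg_cong2[where f="(^)"] refl pk) auto
    finally show ?thesis .
  qed
  \<comment> \<open>The sum over \<open>\<tau>\<close> is the same for all 4^m choices of swaps, so
    it may be averaged over them; for fixed \<open>\<tau>\<close> that average is a Rademacher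
    chaos.\<close>
  have "(2 ^ m * 2 ^ m) * (\<Sum>\<tau>\<in>?P. ?F \<tau>) = (\<Sum>P\<in>?W. \<Sum>Q\<in>?W. \<Sum>\<tau>\<in>?P. ?F \<tau>)"
    by (simp add: card_Pow)
  also have "\<dots> = (\<Sum>P\<in>?W. \<Sum>Q\<in>?W. \<Sum>\<tau>\<in>?P.
      (\<Sum>k<m. \<Sum>l<m. sign_of P k * sign_of Q l * perm_kernel m \<sigma> \<tau> w k l) ^ (2 * p))"
    by (intro sum.cong refl sw)
  also have "\<dots> = (\<Sum>P\<in>?W. \<Sum>\<tau>\<in>?P. \<Sum>Q\<in>?W.
      (\<Sum>k<m. \<Sum>l<m. sign_of P k * sign_of Q l * perm_kernel m \<sigma> \<tau> w k l) ^ (2 * p))"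
    by (intro sum.cong refl sum.swap)
  also have "\<dots> = (\<Sum>\<tau>\<in>?P. \<Sum>P\<in>?W. \<Sum>Q\<in>?W.
      (\<Sum>k<m. \<Sum>l<m. sign_of P k * sign_of Q l * perm_kernel m \<sigma> \<tau> w k l) ^ (2 * p))"
    by (rule sum.swap)
  also have "\<dots> \<le> (\<Sum>\<tau>\<in>?P. 2 ^ card {..<m} * 2 ^ card {..<m} * (24 * real p) ^ (2 * p) *
       (\<Sum>k<m. \<Sum>l<m. (perm_kernel m \<sigma> \<tau> w k l)\<^sup>2) ^ p)"
    by (intro sum_mono rademacher_chaos assms) auto
  also have "\<dots> = (2 ^ m * 2 ^ m) * ((24 * real p) ^ (2 * p) *
      (\<Sum>\<tau>\<in>?P. (\<Sum>k<m. \<Sum>l<m. (perm_kernel m \<sigma> \<tau> w k l)\<^sup>2) ^ p))"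
    by (simp add: sum_distrib_left mult.assoc)
  finally show ?thesis by (rule mult_left_le_imp_le) simp
qed

context cell_dist
begin

text \<open>Two summands are correlated only through shared pairs. Sharing one pair happens for
  about 2 m^3 index combinations and costs the second moment of \<open>proj\<close>; sharing both
  happens m^2 times and costs that of the kernel. Division by m^4 gives the two terms.\<close>

lemma split_U_mean_sq_error:
  assumes "\<sigma> permutes {1..n}" "0 < m" "4 * m \<le> n"
  shows "E {1..n} (\<lambda>w. (split_U m (w \<circ> \<sigma>) - 4 * \<theta>)\<^sup>2)
    \<le> 128 * \<rho> * \<theta> / m + 256 * real (card (A \<times> B)) * \<rho>\<^sup>2 / (real m)\<^sup>2"
proof -
  let ?I = "{1..n}"
  define E1 where "E1 = 64 * \<rho> * \<theta>"
  define E2 where "E2 = 256 * real (card (A \<times> B)) * \<rho>\<^sup>2"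
  have th: "\<theta> \<ge> 0" by (simp add: \<theta>_def sum_nonneg)
  have E12: "0 \<le> E1" "0 \<le> E2" using rho_nonneg th by (auto simp: E1_def E2_def)
  define i where "i e k = \<sigma> (slot m e k)" for e k
  have i_eq: "i e k = i f l \<longleftrightarrow> e = f \<and> k = l" if "k < m" "l < m" for e f k l
    using that assms(1) by (simp add: i_def slot_eq_iff inj_eq[OF permutes_inj])
  have iI: "i e k \<in> ?I" if "k < m" "e < 4" for e k
    unfolding i_def permutes_in_image[OF assms(1)] using that assms(3) by (rule slot_range)
  define Y where "Y k l w = cell_kernel (w (i 0 k)) (w (i 1 l)) (w (i 2 l)) (w (i 3 k))"
    for k l and w :: "nat \<Rightarrow> 'u \<times> 'v"
  have EY: "E ?I (Y k l) = 4 * \<theta>" if "k < m" "l < m" for k l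
  proof -
    have "E ?I (Y k l) = pair_mean (\<lambda>u v.
        pair_mean (\<lambda>u' v'. cell_kernel u u' v' v))"
      unfolding Y_def using that iI by (intro fexp_four) (auto simp: i_eq)
    also have "\<dots> = pair_mean (\<lambda>u v. proj u v)"
      by (intro sum.cong refl arg_cong2[where f="(*)"] sum_pp_kernel_inner)
    finally show ?thesis by (simp add: sum_pp_proj)
  qed
  \<comment> \<open>The leading term is granted in every case, also when indices coincide, so that
    these terms add up to the squared mean and cancel in the end.\<close>
  have EYY: "E ?I (\<lambda>w. Y k l w * Y k' l' w)
      \<le> (4 * \<theta>)\<^sup>2 + (of_bool (k = k' \<and> l = l') * E2 + of_bool (k = k') * E1 + of_bool (l = l') * E1)"
    if "k < m" "l < m" "k' < m" "l' < m" for k l k' l'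
  proof -
    consider "k = k'" "l = l'" | "k = k'" "l \<noteq> l'" | "k \<noteq> k'" "l = l'" | "k \<noteq> k'" "l \<noteq> l'" by blast
    then show ?thesis
    proof cases
      case 1
      have "E ?I (\<lambda>w. Y k l w * Y k l w) \<le> E2"
        unfolding Y_def power2_eq_square[symmetric] E2_def using that iI by (intro fexp_kernel_sq_le) (auto simp: i_eq)
      then show ?thesis using 1 E12 by (simp add: add_increasing)
    next
      case 2
      have "E ?I (\<lambda>w. Y k l w * Y k l' w) = pair_mean (\<lambda>u v.
          (pair_mean (\<lambda>u' v'. cell_kernel u u' v' v) *
           pair_mean (\<lambda>u' v'. cell_kernel u u' v' v)))"
        unfolding Y_def using that iI 2 by (intro fexp_six) (auto simp: i_eq)
      also have "\<dots> = pair_mean (\<lambda>u v. (proj u v)\<^sup>2)"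
        unfolding power2_eq_square by (intro sum.cong refl arg_cong2[where f="(*)"] sum_pp_kernel_inner)
      also have "\<dots> \<le> E1" unfolding E1_def by (rule sum_pp_proj_sq_le)
      finally show ?thesis using 2 E12 by (simp add: add_increasing)
    next
      case 3
      have "E ?I (\<lambda>w. Y k l w * Y k' l w) = pair_mean (\<lambda>u v.
          (pair_mean (\<lambda>u' v'. cell_kernel u' u v v') *
           pair_mean (\<lambda>u' v'. cell_kernel u' u v v')))"
        unfolding Y_def using that iI 3
        by (intro fexp_six[where F = "\<lambda>u v u' v'. cell_kernel u' u v v'" and G = "\<lambda>u v u' v'. cell_kernel u' u v v'"])
          (auto simp: i_eq)
      also have "\<dots> = pair_mean (\<lambda>u v. (proj u v)\<^sup>2)"
        unfolding power2_eq_square by (intro sum.cong refl arg_cong2[where f="(*)"] sum_pp_kernel_outer)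
      also have "\<dots> \<le> E1" unfolding E1_def by (rule sum_pp_proj_sq_le)
      finally show ?thesis using 3 E12 by (simp add: add_increasing)
    next
      case 4
      have "E ?I (\<lambda>w. Y k l w * Y k' l' w) = E ?I (Y k l) * E ?I (Y k' l')"
        by (rule fexp_indep[of _ "{i 0 k, i 1 l, i 2 l, i 3 k}" "{i 0 k', i 1 l', i 2 l', i 3 k'}"])
           (use that iI 4 in \<open>auto simp: i_eq Y_def simp del: atLeastAtMost_iff\<close>)
      then show ?thesis using 4 that EY by (simp add: power2_eq_square)
    qed
  qed
  define S where "S w = (\<Sum>k<m. \<Sum>l<m. Y k l w)" for w
  have ES: "E ?I S = (real m)\<^sup>2 * (4 * \<theta>)"
  proof -
    have "E ?I S = (\<Sum>k<m. \<Sum>l<m. 4 * \<theta>)"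
      unfolding S_def fexp_sum by (intro sum.cong refl EY) auto
    then show ?thesis by (simp add: power2_eq_square)
  qed
  have "E ?I (\<lambda>w. (S w)\<^sup>2) = (\<Sum>k<m. \<Sum>l<m. \<Sum>k'<m. \<Sum>l'<m. E ?I (\<lambda>w. Y k l w * Y k' l' w))"
  proof -
    have "(S w)\<^sup>2 = (\<Sum>k<m. \<Sum>l<m. \<Sum>k'<m. \<Sum>l'<m. Y k l w * Y k' l' w)" for w
    proof -
      have "(S w)\<^sup>2 = (\<Sum>k<m. \<Sum>l<m. Y k l w) * S w" by (simp only: power2_eq_square S_def)
      also have "\<dots> = (\<Sum>k<m. \<Sum>l<m. Y k l w * S w)" by (simp only: sum_distrib_right)
      also have "\<dots> = (\<Sum>k<m. \<Sum>l<m. \<Sum>k'<m. \<Sum>l'<m. Y k l w * Y k' l' w)"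
        by (simp only: S_def sum_distrib_left)
      finally show ?thesis .
    qed
    then show ?thesis by (simp only: fexp_sum)
  qed
  also have "\<dots> \<le> (\<Sum>k<m. \<Sum>l<m. \<Sum>k'<m. \<Sum>l'<m. (4 * \<theta>)\<^sup>2 +
      (of_bool (k = k' \<and> l = l') * E2 + of_bool (k = k') * E1 + of_bool (l = l') * E1))"
    by (intro sum_mono EYY) auto
  also have "\<dots> = real m ^ 4 * (4 * \<theta>)\<^sup>2 + (real m)\<^sup>2 * E2 + 2 * real m ^ 3 * E1"
  proof -
    have d: "(\<Sum>k'<m. if k = k' then z else 0) = z" if "k < m" for k and z :: real
      using that by (simp add: sum.delta')
    have "(\<Sum>k'<m. \<Sum>l'<m. (4 * \<theta>)\<^sup>2 +
      (of_bool (k = k' \<and> l = l') * E2 + of_bool (k = k') * E1 + of_bool (l = l') * E1))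
      = real m ^ 2 * (4 * \<theta>)\<^sup>2 + E2 + 2 * real m * E1" if "k < m" "l < m" for k l
      unfolding sum.distrib of_bool_conj sum_distrib_right[symmetric] sum_distrib_left[symmetric]
      using that by (simp add: of_bool_def d power2_eq_square sum_distrib_left[symmetric])
    then have "(\<Sum>k<m. \<Sum>l<m. \<Sum>k'<m. \<Sum>l'<m. (4 * \<theta>)\<^sup>2 +
      (of_bool (k = k' \<and> l = l') * E2 + of_bool (k = k') * E1 + of_bool (l = l') * E1))
      = (\<Sum>k<m. \<Sum>l<m. real m ^ 2 * (4 * \<theta>)\<^sup>2 + E2 + 2 * real m * E1)"
      by (intro sum.cong refl) auto
    also have "\<dots> = real m ^ 4 * (4 * \<theta>)\<^sup>2 + (real m)\<^sup>2 * E2 + 2 * real m ^ 3 * E1"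
      by (simp add: algebra_simps power2_eq_square power3_eq_cube power4_eq_xxxx)
    finally show ?thesis .
  qed
  finally have ESS: "E ?I (\<lambda>w. (S w)\<^sup>2) \<le> real m ^ 4 * (4 * \<theta>)\<^sup>2 + (real m)\<^sup>2 * E2 + 2 * real m ^ 3 * E1" .
  have "E ?I (\<lambda>w. (split_U m (w \<circ> \<sigma>) - 4 * \<theta>)\<^sup>2)
      = E ?I (\<lambda>w. (1 / real m ^ 4) * (S w)\<^sup>2 + ((- 8 * \<theta> / (real m)\<^sup>2) * S w + (4 * \<theta>)\<^sup>2))"
    using assms(2) by (intro fexp_cong)
      (simp add: split_U_def S_def Y_def i_def power2_diff power_divide field_simps)
  also have "\<dots> = (1 / real m ^ 4) * E ?I (\<lambda>w. (S w)\<^sup>2) + ((- 8 * \<theta> / (real m)\<^sup>2) * E ?I S + (4 * \<theta>)\<^sup>2)"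
    by (simp only: fexp_add fexp_cmult fexp_const finite_atLeastAtMost)
  also have "\<dots> \<le> (1 / real m ^ 4) * (real m ^ 4 * (4 * \<theta>)\<^sup>2 + (real m)\<^sup>2 * E2 + 2 * real m ^ 3 * E1)
       + ((- 8 * \<theta> / (real m)\<^sup>2) * E ?I S + (4 * \<theta>)\<^sup>2)"
    by (intro add_right_mono mult_left_mono ESS) auto
  also have "\<dots> = 2 * E1 / m + E2 / (real m)\<^sup>2"
    unfolding ES using assms(2) by (simp add: field_simps power2_eq_square power3_eq_cube power4_eq_xxxx)
  finally show ?thesis by (simp add: E1_def E2_def)
qed

text \<open>Convexity of the square carries the bound from the decoupled statistics to their
  average.\<close>

lemma cell_U_mean_sq_error:
  assumes "0 < m" "4 * m \<le> n"
  shows "E {1..n} (\<lambda>w. (cell_U n w - 4 * \<theta>)\<^sup>2)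
    \<le> 128 * \<rho> * \<theta> / m + 256 * real (card (A \<times> B)) * \<rho>\<^sup>2 / (real m)\<^sup>2"
proof -
  let ?P = "{\<sigma>. \<sigma> permutes {1..n}}"
  have "id \<in> ?P" using permutes_id by blast
  then have "?P \<noteq> {}" by blast
  moreover have "finite ?P" "card ?P = fact n"
    by (auto simp: finite_permutations card_permutations simp del: One_nat_def)
  ultimately have fin: "finite ?P" "?P \<noteq> {}" "card ?P = fact n" by blast+
  have "E {1..n} (\<lambda>w. (cell_U n w - 4 * \<theta>)\<^sup>2)
      \<le> E {1..n} (\<lambda>w. (1 / fact n) * (\<Sum>\<sigma>\<in>?P. (split_U m (w \<circ> \<sigma>) - 4 * \<theta>)\<^sup>2))"
  proof (rule fexp_mono)
    fix w :: "nat \<Rightarrow> 'u \<times> 'v"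
    have "cell_U n w - 4 * \<theta> = (\<Sum>\<sigma>\<in>?P. split_U m (w \<circ> \<sigma>) - 4 * \<theta>) / card ?P"
      unfolding cell_U_eq_average[OF assms] sum_subtractf by (simp add: fin(3) diff_divide_distrib del: One_nat_def)
    then show "(cell_U n w - 4 * \<theta>)\<^sup>2 \<le> (1 / fact n) * (\<Sum>\<sigma>\<in>?P. (split_U m (w \<circ> \<sigma>) - 4 * \<theta>)\<^sup>2)"
      using average_power_even_le[OF fin(1,2), of "\<lambda>\<sigma>. split_U m (w \<circ> \<sigma>) - 4 * \<theta>" 1] fin(3) by (simp del: One_nat_def)
  qed
  also have "\<dots> = (1 / fact n) * (\<Sum>\<sigma>\<in>?P. E {1..n} (\<lambda>w. (split_U m (w \<circ> \<sigma>) - 4 * \<theta>)\<^sup>2))"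
    by (simp only: fexp_cmult fexp_sum)
  also have "\<dots> \<le> (1 / fact n) * (\<Sum>\<sigma>\<in>?P. 128 * \<rho> * \<theta> / m + 256 * real (card (A \<times> B)) * \<rho>\<^sup>2 / (real m)\<^sup>2)"
    by (intro mult_left_mono sum_mono split_U_mean_sq_error assms) auto
  finally show ?thesis by (simp add: fin(3) del: One_nat_def)
qed

end

section \<open>Moments of the permuted U-statistic\<close>

context cell_dist
begin

text \<open>Summing the squared kernel over \<open>k\<close> and \<open>l\<close> turns coincidences
  into products of two cell counts. The inequality of arithmetic and geometric means replaces the
  products by squares of single counts, whose moments are known, and the power mean over the 16 *
  card (A \<times> B) terms in \<open>J\<close> does the rest; 256 is 16 * 16.\<close>

lemma fexp_perm_kernel_moment:
  assumes "\<sigma> permutes {1..n}" "\<tau> permutes {1..n}" "0 < m" "4 * m \<le> n"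
  shows "E {1..n} (\<lambda>w. (\<Sum>k<m. \<Sum>l<m. (perm_kernel m \<sigma> \<tau> w k l)\<^sup>2) ^ q)
    \<le> (256 * real (card (A \<times> B))) ^ q * (2 * real q + real m * \<rho>) ^ (2 * q)"
proof -
  define ind where "ind e g c w k = (of_bool (fst (w (\<sigma> (slot m e k))) = fst c \<and> snd (w (\<tau> (slot m g k))) = snd c) :: real)"
    for e g c and w :: "nat \<Rightarrow> 'u \<times> 'v" and k
  define M where "M e g c w = (\<Sum>k<m. ind e g c w k)" for e g c w
  define J where "J = ({0::nat, 3} \<times> {1::nat, 2} \<times> {0::nat, 3} \<times> {1::nat, 2}) \<times> (A \<times> B)"
  define y where "y = (\<lambda>((e, f, g, h), c) w. (1 / 2) * (M e g c w)\<^sup>2 + (1 / 2) * (M f h c w)\<^sup>2)"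
  have cardJ: "card J = 16 * card (A \<times> B)" by (simp add: J_def card_cartesian_product)
  have AB: "A \<times> B \<noteq> {}" using p_sum by auto
  have J: "finite J" "J \<noteq> {}" using AB finite_A finite_B by (auto simp: J_def)
  have y0: "0 \<le> y j w" for j w by (auto simp: y_def split: prod.splits)
  have s_in: "\<sigma> (slot m e k) \<in> {1..n}" "\<tau> (slot m e k) \<in> {1..n}" if "e < 4" "k < m" for e k
    unfolding permutes_in_image[OF assms(1)] permutes_in_image[OF assms(2)]
    using slot_range[OF that(2,1) assms(4)] by blast+
  have Mom: "E {1..n} (\<lambda>w. M e g c w ^ (2 * q)) \<le> (2 * real q + real m * \<rho>) ^ (2 * q)"
    if "e < 4" "g < 4" "c \<in> A \<times> B" for e g c
  proof -
    have inj: "inj_on (\<lambda>k. \<sigma> (slot m e k)) {..<m}" "inj_on (\<lambda>k. \<tau> (slot m g k)) {..<m}"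
      using permutes_inj[OF assms(1)] permutes_inj[OF assms(2)]
      by (auto intro!: inj_onI simp: inj_eq slot_eq_iff)
    have "E {1..n} (\<lambda>w. (\<Sum>k<m. of_bool (fst (w (\<sigma> (slot m e k))) = fst c \<and> snd (w (\<tau> (slot m g k))) = snd c)) ^ (2 * q))
        \<le> (real (2 * q) + real m * \<rho>) ^ (2 * q)"
      by (rule cell_count_moment[OF _ inj]) (use that s_in in \<open>auto simp del: atLeastAtMost_iff\<close>)
    then show ?thesis by (simp add: M_def ind_def)
  qed
  have Ey: "E {1..n} (\<lambda>w. y j w ^ q) \<le> (2 * real q + real m * \<rho>) ^ (2 * q)" if "j \<in> J" for j
  proof -
    obtain e f g h c where j: "j = ((e, f, g, h), c)" by (metis surj_pair)
    have lt: "e < 4" "f < 4" "g < 4" "h < 4" "c \<in> A \<times> B" using that by (auto simp: j J_def)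
    have "E {1..n} (\<lambda>w. y j w ^ q) \<le> E {1..n} (\<lambda>w. (1 / 2) * M e g c w ^ (2 * q) + (1 / 2) * M f h c w ^ (2 * q))"
    proof (rule fexp_mono)
      fix w
      have "(\<Sum>b\<in>{True, False}. (1 / 2) * (if b then (M e g c w)\<^sup>2 else (M f h c w)\<^sup>2)) ^ q
          \<le> (\<Sum>b\<in>{True, False}. (1 / 2) * (if b then (M e g c w)\<^sup>2 else (M f h c w)\<^sup>2) ^ q)"
        by (rule sum_power_le) auto
      then show "y j w ^ q \<le> (1 / 2) * M e g c w ^ (2 * q) + (1 / 2) * M f h c w ^ (2 * q)"
        by (simp add: y_def j power_mult)
    qed
    also have "\<dots> = (1 / 2) * E {1..n} (\<lambda>w. M e g c w ^ (2 * q)) + (1 / 2) * E {1..n} (\<lambda>w. M f h c w ^ (2 * q))"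
      by (simp only: fexp_add fexp_cmult)
    finally show ?thesis using Mom[OF lt(1,3,5)] Mom[OF lt(2,4,5)] by linarith
  qed
  have "E {1..n} (\<lambda>w. (\<Sum>k<m. \<Sum>l<m. (perm_kernel m \<sigma> \<tau> w k l)\<^sup>2) ^ q)
     \<le> E {1..n} (\<lambda>w. (16 ^ q * (real (card J) ^ q / card J)) * (\<Sum>j\<in>J. y j w ^ q))"
  proof (rule fexp_mono)
    fix w assume w: "w \<in> PiE {1..n} (\<lambda>_. A \<times> B)"
    define x where "x k l = (\<lambda>e::nat. let i = slot m e (if e \<in> {0, 3} then k else l) in
       (fst (w (\<sigma> i)), snd (w (\<tau> i))))" for k l
    have "(\<Sum>k<m. \<Sum>l<m. (perm_kernel m \<sigma> \<tau> w k l)\<^sup>2)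
        = (\<Sum>k<m. \<Sum>l<m. (cell_kernel (x k l 0) (x k l 1) (x k l 2) (x k l 3))\<^sup>2)"
      by (simp add: perm_kernel_def x_def Let_def)
    also have "\<dots> \<le> (\<Sum>k<m. \<Sum>l<m. 16 * (\<Sum>e\<in>{0,3}. \<Sum>f\<in>{1,2}. \<Sum>g\<in>{0,3}. \<Sum>h\<in>{1,2}.
          of_bool (fst (x k l e) = fst (x k l f)) * of_bool (snd (x k l g) = snd (x k l h))))"
      by (intro sum_mono cell_kernel_sq_le)
    also have "\<dots> = (\<Sum>k<m. \<Sum>l<m. 16 * (\<Sum>e\<in>{0,3}. \<Sum>f\<in>{1,2}. \<Sum>g\<in>{0,3}. \<Sum>h\<in>{1,2}.
          \<Sum>c\<in>A \<times> B. ind e g c w k * ind f h c w l))"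
    proof (intro sum.cong refl arg_cong2[where f="(*)"])
      fix k l e f g h :: nat
      assume *: "k \<in> {..<m}" "l \<in> {..<m}" "e \<in> {0, 3}" "f \<in> {1, 2}" "g \<in> {0, 3}" "h \<in> {1, 2}"
      have "w (\<sigma> (slot m e k)) \<in> A \<times> B" "w (\<tau> (slot m g k)) \<in> A \<times> B"
        using PiE_mem[OF w] s_in * by auto
      then have mem: "(fst (x k l e), snd (x k l g)) \<in> A \<times> B"
        using *(3,5) by (auto simp: x_def Let_def mem_Times_iff)
      have xe: "fst (x k l e) = fst (w (\<sigma> (slot m e k)))" "snd (x k l g) = snd (w (\<tau> (slot m g k)))"
        "fst (x k l f) = fst (w (\<sigma> (slot m f l)))" "snd (x k l h) = snd (w (\<tau> (slot m h l)))"
        using * by (auto simp: x_def Let_def)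
      have "(\<Sum>c\<in>A \<times> B. ind e g c w k * ind f h c w l)
          = (\<Sum>c\<in>A \<times> B. of_bool ((fst (x k l e), snd (x k l g)) = c) *
             (of_bool (fst (x k l e) = fst (x k l f)) * of_bool (snd (x k l g) = snd (x k l h))))"
        by (intro sum.cong refl) (auto simp: ind_def xe)
      then show "of_bool (fst (x k l e) = fst (x k l f)) * of_bool (snd (x k l g) = snd (x k l h))
          = (\<Sum>c\<in>A \<times> B. ind e g c w k * ind f h c w l)"
        using sum_of_bool_eq[OF finite_C mem] by simp
    qed
    also have "\<dots> = (\<Sum>k<m. \<Sum>l<m. 16 * (\<Sum>((e, f, g, h), c)\<in>J. ind e g c w k * ind f h c w l))"
      by (simp only: J_def sum.cartesian_product' split_def fst_conv snd_conv)
    also have "\<dots> = 16 * (\<Sum>k<m. \<Sum>l<m. \<Sum>((e, f, g, h), c)\<in>J. ind e g c w k * ind f h c w l)"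
      by (simp only: sum_distrib_left)
    also have "(\<Sum>k<m. \<Sum>l<m. \<Sum>((e, f, g, h), c)\<in>J. ind e g c w k * ind f h c w l)
        = (\<Sum>k<m. \<Sum>((e, f, g, h), c)\<in>J. \<Sum>l<m. ind e g c w k * ind f h c w l)"
      unfolding split_def by (intro sum.cong refl sum.swap)
    also have "\<dots> = (\<Sum>((e, f, g, h), c)\<in>J. \<Sum>k<m. \<Sum>l<m. ind e g c w k * ind f h c w l)"
      unfolding split_def by (rule sum.swap)
    also have "\<dots> = (\<Sum>((e, f, g, h), c)\<in>J. M e g c w * M f h c w)"
      by (simp only: M_def sum_product)
    also have "16 * (\<Sum>((e, f, g, h), c)\<in>J. M e g c w * M f h c w) \<le> 16 * (\<Sum>j\<in>J. y j w)"
    proof (intro mult_left_mono sum_mono)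
      fix j assume "j \<in> J"
      obtain e f g h c where j: "j = ((e, f, g, h), c)" by (metis surj_pair)
      have "2 * (M e g c w * M f h c w) \<le> (M e g c w)\<^sup>2 + (M f h c w)\<^sup>2"
        using sum_squares_bound[of "M e g c w" "M f h c w"] by simp
      then show "(\<lambda>((e, f, g, h), c). M e g c w * M f h c w) j \<le> y j w"
        by (simp add: j y_def)
    qed auto
    finally have "(\<Sum>k<m. \<Sum>l<m. (perm_kernel m \<sigma> \<tau> w k l)\<^sup>2) ^ q \<le> (16 * (\<Sum>j\<in>J. y j w)) ^ q"
      by (intro power_mono sum_nonneg) auto
    also have "\<dots> = 16 ^ q * (\<Sum>j\<in>J. y j w) ^ q" by (rule power_mult_distrib)
    also have "\<dots> \<le> 16 ^ q * (real (card J) ^ q * (\<Sum>j\<in>J. y j w ^ q) / card J)"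
      by (intro mult_left_mono sum_power_card_le J y0) auto
    also have "\<dots> = (16 ^ q * (real (card J) ^ q / card J)) * (\<Sum>j\<in>J. y j w ^ q)" by simp
    finally show "(\<Sum>k<m. \<Sum>l<m. (perm_kernel m \<sigma> \<tau> w k l)\<^sup>2) ^ q
        \<le> (16 ^ q * (real (card J) ^ q / card J)) * (\<Sum>j\<in>J. y j w ^ q)" .
  qed
  also have "\<dots> = (16 ^ q * (real (card J) ^ q / card J)) * (\<Sum>j\<in>J. E {1..n} (\<lambda>w. y j w ^ q))"
    by (simp only: fexp_cmult fexp_sum)
  also have "\<dots> \<le> (16 ^ q * (real (card J) ^ q / card J)) * (\<Sum>j\<in>J. (2 * real q + real m * \<rho>) ^ (2 * q))"
    by (intro mult_left_mono sum_mono Ey) auto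
  also have "\<dots> = 16 ^ q * real (card J) ^ q * (2 * real q + real m * \<rho>) ^ (2 * q)"
    using J by simp
  also have "\<dots> = (256 * real (card (A \<times> B))) ^ q * (2 * real q + real m * \<rho>) ^ (2 * q)"
    unfolding cardJ power_mult_distrib[symmetric] by simp
  finally show ?thesis .
qed

text \<open>Symmetrization holds for each fixed sample, so it is applied first and the expectation
  is taken afterwards. The constant is 384 = 24 * 16, with 24 from Khinchine and 16 the square root
  of the 256 in \<open>fexp_perm_kernel_moment\<close>.\<close>

lemma permutation_moment:
  assumes "0 < m" "4 * m \<le> n" "1 \<le> q"
  shows "(\<Sum>\<pi> | \<pi> permutes {1..n}. E {1..n} (\<lambda>w. cell_U n (permuted_sample \<pi> w) ^ (2 * q)))
    \<le> fact n * (384 * real q * sqrt (card (A \<times> B)) * (2 * real q + real m * \<rho>) / (real m)\<^sup>2) ^ (2 * q)"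
proof -
  define P where "P = {\<sigma>. \<sigma> permutes {1..n}}"
  define b where "b = (256 * real (card (A \<times> B))) ^ q * (2 * real q + real m * \<rho>) ^ (2 * q)"
  define c where "c = (24 * real q) ^ (2 * q) / (real m)\<^sup>2 ^ (2 * q)"
  define f where "f = (fact n :: real)"
  define V where "V \<sigma> \<tau> w = (\<Sum>k<m. \<Sum>l<m. (perm_kernel m \<sigma> \<tau> w k l)\<^sup>2) ^ q"
    for \<sigma> \<tau> and w :: "nat \<Rightarrow> 'u \<times> 'v"
  have "id \<in> P" using permutes_id by (auto simp: P_def)
  then have "P \<noteq> {}" by blast
  moreover have "finite P" "real (card P) = f"
    by (auto simp: finite_permutations card_permutations P_def f_def simp del: One_nat_def)
  ultimately have fin: "finite P" "P \<noteq> {}" "real (card P) = f" by blast+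
  have f: "f > 0" by (simp add: f_def)
  have c: "c \<ge> 0" by (simp add: c_def)
  have split: "split_U m (permuted_sample \<pi> w \<circ> \<sigma>)
      = (\<Sum>k<m. \<Sum>l<m. perm_kernel m \<sigma> (\<pi> \<circ> \<sigma>) w k l) / (real m)\<^sup>2" for \<pi> \<sigma> w
    by (simp add: split_U_def permuted_sample_def perm_kernel_def)
  have "(\<Sum>\<pi>\<in>P. E {1..n} (\<lambda>w. cell_U n (permuted_sample \<pi> w) ^ (2 * q)))
     = E {1..n} (\<lambda>w. \<Sum>\<pi>\<in>P. cell_U n (permuted_sample \<pi> w) ^ (2 * q))"
    by (simp only: fexp_sum)
  also have "\<dots> \<le> E {1..n} (\<lambda>w. (c / f) * (\<Sum>\<sigma>\<in>P. \<Sum>\<tau>\<in>P. V \<sigma> \<tau> w))"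
  proof (rule fexp_mono)
    fix w :: "nat \<Rightarrow> 'u \<times> 'v"
    have "(\<Sum>\<pi>\<in>P. cell_U n (permuted_sample \<pi> w) ^ (2 * q))
        \<le> (\<Sum>\<pi>\<in>P. (\<Sum>\<sigma>\<in>P. split_U m (permuted_sample \<pi> w \<circ> \<sigma>) ^ (2 * q)) / f)"
    proof (rule sum_mono)
      fix \<pi>
      show "cell_U n (permuted_sample \<pi> w) ^ (2 * q) \<le> (\<Sum>\<sigma>\<in>P. split_U m (permuted_sample \<pi> w \<circ> \<sigma>) ^ (2 * q)) / f"
        using average_power_even_le[OF fin(1,2), of "\<lambda>\<sigma>. split_U m (permuted_sample \<pi> w \<circ> \<sigma>)" q]
        unfolding cell_U_eq_average[OF assms(1,2)] fin(3) P_def[symmetric] f_def[symmetric] .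
    qed
    also have "\<dots> = (\<Sum>\<sigma>\<in>P. \<Sum>\<pi>\<in>P. split_U m (permuted_sample \<pi> w \<circ> \<sigma>) ^ (2 * q)) / f"
      unfolding sum_divide_distrib[symmetric] by (subst sum.swap) simp
    also have "\<dots> = (\<Sum>\<sigma>\<in>P. \<Sum>\<tau>\<in>P. (\<Sum>k<m. \<Sum>l<m. perm_kernel m \<sigma> \<tau> w k l) ^ (2 * q)) / (real m)\<^sup>2 ^ (2 * q) / f"
    proof -
      have "(\<Sum>\<pi>\<in>P. split_U m (permuted_sample \<pi> w \<circ> \<sigma>) ^ (2 * q))
          = (\<Sum>\<tau>\<in>P. (\<Sum>k<m. \<Sum>l<m. perm_kernel m \<sigma> \<tau> w k l) ^ (2 * q)) / (real m)\<^sup>2 ^ (2 * q)"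
        if "\<sigma> \<in> P" for \<sigma>
        unfolding split power_divide sum_divide_distrib[symmetric] P_def
        using sum_permutations_compose_right[of \<sigma> "{1..n}" "\<lambda>\<tau>. (\<Sum>k<m. \<Sum>l<m. perm_kernel m \<sigma> \<tau> w k l) ^ (2 * q)"] that
        by (simp add: P_def)
      then show ?thesis by (simp add: sum_divide_distrib)
    qed
    also have "\<dots> \<le> (\<Sum>\<sigma>\<in>P. (24 * real q) ^ (2 * q) * (\<Sum>\<tau>\<in>P. V \<sigma> \<tau> w)) / (real m)\<^sup>2 ^ (2 * q) / f"
      unfolding V_def P_def using f
      by (intro divide_right_mono sum_mono sum_perm_kernel_power_le assms) auto
    also have "\<dots> = (c / f) * (\<Sum>\<sigma>\<in>P. \<Sum>\<tau>\<in>P. V \<sigma> \<tau> w)"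
      by (simp add: c_def sum_distrib_left[symmetric])
    finally show "(\<Sum>\<pi>\<in>P. cell_U n (permuted_sample \<pi> w) ^ (2 * q)) \<le> (c / f) * (\<Sum>\<sigma>\<in>P. \<Sum>\<tau>\<in>P. V \<sigma> \<tau> w)" .
  qed
  also have "\<dots> = (c / f) * (\<Sum>\<sigma>\<in>P. \<Sum>\<tau>\<in>P. E {1..n} (V \<sigma> \<tau>))"
    by (simp only: fexp_cmult fexp_sum)
  also have "\<dots> \<le> (c / f) * (\<Sum>\<sigma>\<in>P. \<Sum>\<tau>\<in>P. b)"
    unfolding V_def b_def using c f
    by (intro mult_left_mono sum_mono fexp_perm_kernel_moment assms) (auto simp: P_def)
  also have "\<dots> = f * (c * b)" using f by (simp add: fin(3) field_simps)
  also have "c * b = (384 * real q * sqrt (card (A \<times> B)) * (2 * real q + real m * \<rho>) / (real m)\<^sup>2) ^ (2 * q)"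
  proof -
    have "(256 * real (card (A \<times> B))) ^ q = (16 * sqrt (card (A \<times> B))) ^ (2 * q)"
      by (simp add: power_mult power_mult_distrib)
    then have "c * b = (24 * real q * (16 * sqrt (card (A \<times> B))) * (2 * real q + real m * \<rho>) / (real m)\<^sup>2) ^ (2 * q)"
      unfolding c_def b_def
      by (simp only: power_mult_distrib power_divide times_divide_eq_left times_divide_eq_right mult.assoc)
    also have "24 * real q * (16 * sqrt (card (A \<times> B))) * (2 * real q + real m * \<rho>) / (real m)\<^sup>2
        = 384 * real q * sqrt (card (A \<times> B)) * (2 * real q + real m * \<rho>) / (real m)\<^sup>2" by simp
    finally show ?thesis .
  qed
  finally show ?thesis unfolding P_def f_def .
qed

end

section \<open>Error probabilities for a discretized sample\<close>

text \<open>\<open>crit_value\<close> as a function of the permuted statistics alone, so that it can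
  be used for the sample and for its labels alike.\<close>

definition perm_crit :: "real \<Rightarrow> nat \<Rightarrow> ((nat \<Rightarrow> nat) \<Rightarrow> real) \<Rightarrow> real" where
  "perm_crit a n V = Inf {t. 1 / fact n * (\<Sum>\<pi> | \<pi> permutes {1..n}. of_bool (V \<pi> \<le> t)) \<ge> 1 - a}"

lemma perm_crit_set_eq:
  "(1 / fact n * (\<Sum>\<pi> | \<pi> permutes {1..n}. of_bool (V \<pi> \<le> t)) \<ge> 1 - a) \<longleftrightarrow>
    (\<Sum>\<pi> | \<pi> permutes {1..n}. of_bool (V \<pi> > t)) \<le> a * fact n" for V :: "(nat \<Rightarrow> nat) \<Rightarrow> real" and a :: real
proof -
  have "(\<Sum>\<pi> | \<pi> permutes {1..n}. of_bool (V \<pi> \<le> t)) + (\<Sum>\<pi> | \<pi> permutes {1..n}. of_bool (V \<pi> > t))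
      = (\<Sum>\<pi> | \<pi> permutes {1..n}. 1 :: real)"
    unfolding sum.distrib[symmetric] by (intro sum.cong) auto
  also have "\<dots> = fact n" using card_permutations[of "{1..n}" n] by (simp del: One_nat_def)
  finally have "(\<Sum>\<pi> | \<pi> permutes {1..n}. of_bool (V \<pi> \<le> t))
      = fact n - (\<Sum>\<pi> | \<pi> permutes {1..n}. of_bool (V \<pi> > t) :: real)" by linarith
  moreover have "1 - a \<le> 1 / f * (f - s) \<longleftrightarrow> s \<le> a * f" if "f > 0" for f s :: real
    using that by (simp add: field_simps)
  ultimately show ?thesis by (simp del: One_nat_def)
qed

text \<open>The admissible thresholds form a set that is bounded below because a < 1 and nonempty
  because 0 < a. The number of strict exceedances is right-continuous in the threshold, so the
  infimum is itself admissible.\<close>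

lemma
  fixes V :: "(nat \<Rightarrow> nat) \<Rightarrow> real"
  assumes "0 < a" "a < 1"
  shows perm_crit_le: "(\<Sum>\<pi> | \<pi> permutes {1..n}. of_bool (V \<pi> > t)) \<le> a * fact n \<Longrightarrow> perm_crit a n V \<le> t"
    and perm_crit_count: "(\<Sum>\<pi> | \<pi> permutes {1..n}. of_bool (V \<pi> > perm_crit a n V)) \<le> a * fact n"
proof -
  define P where "P = {\<pi>. \<pi> permutes {1..n}}"
  define f where "f = (fact n :: real)"
  define T where "T = {t. (\<Sum>\<pi>\<in>P. of_bool (V \<pi> > t)) \<le> a * f}"
  have f: "f > 0" by (simp add: f_def)
  have "id \<in> P" using permutes_id by (auto simp: P_def)
  then have ne: "P \<noteq> {}" by blast
  have fin: "finite P" by (simp add: P_def finite_permutations)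
  have card: "real (card P) = f" using card_permutations[of "{1..n}" n] by (simp add: P_def f_def del: One_nat_def)
  have crit: "perm_crit a n V = Inf T"
    unfolding perm_crit_def perm_crit_set_eq T_def P_def f_def ..
  have lb: "Min (V ` P) \<le> t" if "t \<in> T" for t
  proof (rule ccontr)
    assume "\<not> ?thesis"
    then have "V \<pi> > t" if "\<pi> \<in> P" for \<pi>
    proof -
      have "Min (V ` P) \<le> V \<pi>" using fin that by (intro Min_le) auto
      then show ?thesis using \<open>\<not> Min (V ` P) \<le> t\<close> by linarith
    qed
    then have "(\<Sum>\<pi>\<in>P. of_bool (V \<pi> > t)) = (\<Sum>\<pi>\<in>P. 1 :: real)" by (intro sum.cong) auto
    then have "f \<le> a * f" using that card by (simp add: T_def)
    then show False using assms f by (simp add: mult_le_cancel_right2)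
  qed
  then have bdd: "bdd_below T" by (auto simp: bdd_below_def)
  have "Max (V ` P) \<in> T"
  proof -
    have "\<not> V \<pi> > Max (V ` P)" if "\<pi> \<in> P" for \<pi>
      unfolding not_less using fin that by (intro Max_ge) auto
    then have "(\<Sum>\<pi>\<in>P. of_bool (V \<pi> > Max (V ` P))) = (\<Sum>\<pi>\<in>P. 0 :: real)" by (intro sum.cong) auto
    then show ?thesis using assms f by (simp add: T_def)
  qed
  then have T: "T \<noteq> {}" by blast
  show "perm_crit a n V \<le> t" if "(\<Sum>\<pi> | \<pi> permutes {1..n}. of_bool (V \<pi> > t)) \<le> a * fact n"
    unfolding crit by (rule cInf_lower[OF _ bdd]) (use that in \<open>simp add: T_def P_def f_def\<close>)
  have "(\<Sum>\<pi>\<in>P. of_bool (V \<pi> > Inf T)) \<le> a * f"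
  proof (cases "\<exists>\<pi>\<in>P. V \<pi> > Inf T")
    case False
    then have "(\<Sum>\<pi>\<in>P. of_bool (V \<pi> > Inf T)) = (\<Sum>\<pi>\<in>P. 0 :: real)" by (intro sum.cong) auto
    then show ?thesis using assms f by simp
  next
    case True
    \<comment> \<open>Only finitely many values exceed the infimum, so some admissible
      \<open>t\<close> lies below all of them and has at least as many exceedances.\<close>
    define S where "S = {\<pi>\<in>P. V \<pi> > Inf T}"
    have S: "finite S" "S \<noteq> {}" using fin True by (auto simp: S_def)
    have "Inf T < Min (V ` S)" using S by (subst Min_gr_iff) (auto simp: S_def)
    then obtain t where t: "t \<in> T" "t < Min (V ` S)" using cInf_lessD[OF T] by blast
    have "V \<pi> > t" if "\<pi> \<in> S" for \<pi>
    proof -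
      have "Min (V ` S) \<le> V \<pi>" using S(1) that by (intro Min_le) auto
      then show ?thesis using t(2) by linarith
    qed
    then have "(\<Sum>\<pi>\<in>P. of_bool (V \<pi> > Inf T)) \<le> (\<Sum>\<pi>\<in>P. of_bool (V \<pi> > t) :: real)"
      by (intro sum_mono) (auto simp: S_def)
    also have "\<dots> \<le> a * f" using t(1) by (simp add: T_def)
    finally show ?thesis .
  qed
  then show "(\<Sum>\<pi> | \<pi> permutes {1..n}. of_bool (V \<pi> > perm_crit a n V)) \<le> a * fact n"
    unfolding crit P_def f_def .
qed

lemma permuted_sample_comp: "permuted_sample \<rho> (permuted_sample \<pi> w) = permuted_sample (\<pi> \<circ> \<rho>) w"
  by (simp add: permuted_sample_def fun_eq_iff)

text \<open>Composition with \<open>\<pi>\<close> merely reorders the set of all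
  permutations.\<close>

lemma perm_crit_permuted:
  assumes "\<pi> permutes {1..n}"
  shows "perm_crit a n (\<lambda>\<rho>. V (permuted_sample \<rho> (permuted_sample \<pi> w))) = perm_crit a n (\<lambda>\<rho>. V (permuted_sample \<rho> w))"
proof -
  have "(\<Sum>\<rho> | \<rho> permutes {1..n}. of_bool (V (permuted_sample \<rho> w) \<le> t))
      = (\<Sum>\<rho> | \<rho> permutes {1..n}. of_bool (V (permuted_sample (\<pi> \<circ> \<rho>) w) \<le> t) :: real)" for t
    by (rule sum.reindex_bij_witness[where i = "\<lambda>\<rho>. \<pi> \<circ> \<rho>" and j = "\<lambda>\<rho>. inv \<pi> \<circ> \<rho>"])
       (auto simp: comp_assoc[symmetric] permutes_inv_o[OF assms]
         intro: permutes_compose[OF _ assms] permutes_compose[OF _ permutes_inv[OF assms]] simp del: One_nat_def)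
  then show ?thesis unfolding perm_crit_def permuted_sample_comp by simp
qed

lemma cell_U_cong: "(\<And>i. i \<in> {1..n} \<Longrightarrow> w i = w' i) \<Longrightarrow> cell_U n w = cell_U n w'"
  unfolding cell_U_def by (intro arg_cong2[where f="(/)"] sum.cong) (auto simp: distinct_quadruples_def)

lemma permuted_cell_U_cong:
  assumes "\<pi> permutes {1..n}" "\<And>i. i \<in> {1..n} \<Longrightarrow> w i = w' i"
  shows "cell_U n (permuted_sample \<pi> w) = cell_U n (permuted_sample \<pi> w')"
  by (intro cell_U_cong) (use assms permutes_in_image[OF assms(1)] in \<open>auto simp: permuted_sample_def\<close>)

abbreviation cell_crit :: "real \<Rightarrow> nat \<Rightarrow> (nat \<Rightarrow> 'u \<times> 'v) \<Rightarrow> real" where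
  "cell_crit a n w \<equiv> perm_crit a n (\<lambda>\<pi>. cell_U n (permuted_sample \<pi> w))"

lemma perm_crit_cong:
  assumes "\<And>i. i \<in> {1..n} \<Longrightarrow> w i = w' i"
  shows "cell_crit a n w = cell_crit a n w'"
proof -
  have "(\<Sum>\<pi> | \<pi> permutes {1..n}. of_bool (cell_U n (permuted_sample \<pi> w) \<le> t))
     = (\<Sum>\<pi> | \<pi> permutes {1..n}. of_bool (cell_U n (permuted_sample \<pi> w') \<le> t) :: real)" for t
    by (intro sum.cong refl) (use permuted_cell_U_cong[of _ n w w'] assms in auto)
  then show ?thesis unfolding perm_crit_def by simp
qed

context cell_dist
begin

text \<open>The statistic has mean \<open>4 * \<theta>\<close>, and the cut is made at
  \<open>2 * \<theta>\<close>. Acceptance means that the statistic falls below the cut, which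
  Chebyshev bounds, or that the critical value exceeds it. In the latter case more than a fraction
  \<open>a\<close> of the permuted statistics exceed the cut, which Markov's inequality of order 2 q
  bounds.\<close>

lemma type_two_error_le:
  assumes "0 < m" "4 * m \<le> n" "1 \<le> q" "0 < a" "a < 1" "0 < \<theta>"
  shows "E {1..n} (\<lambda>w. of_bool (cell_U n w \<le> cell_crit a n w))
    \<le> (128 * \<rho> * \<theta> / m + 256 * real (card (A \<times> B)) * \<rho>\<^sup>2 / (real m)\<^sup>2) / (4 * \<theta>\<^sup>2)
      + (384 * real q * sqrt (card (A \<times> B)) * (2 * real q + real m * \<rho>) / (real m)\<^sup>2 / (2 * \<theta>)) ^ (2 * q) / a"
proof -
  let ?I = "{1..n}" and ?P = "{\<pi>. \<pi> permutes {1..n}}"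
  have f0: "(fact n :: real) > 0" by simp
  define z where "z = 1 / (a * fact n * (2 * \<theta>) ^ (2 * q))"
  have z: "z > 0" using assms by (simp add: z_def)
  define X where "X = 384 * real q * sqrt (card (A \<times> B)) * (2 * real q + real m * \<rho>) / (real m)\<^sup>2"
  have "E ?I (\<lambda>w. of_bool (cell_U n w \<le> cell_crit a n w))
     \<le> E ?I (\<lambda>w. (1 / (4 * \<theta>\<^sup>2)) * (cell_U n w - 4 * \<theta>)\<^sup>2
          + z * (\<Sum>\<pi>\<in>?P. cell_U n (permuted_sample \<pi> w) ^ (2 * q)))"
  proof (rule fexp_mono)
    fix w :: "nat \<Rightarrow> 'u \<times> 'v"
    let ?V = "\<lambda>\<pi>. cell_U n (permuted_sample \<pi> w)"
    have nn: "0 \<le> (1 / (4 * \<theta>\<^sup>2)) * (cell_U n w - 4 * \<theta>)\<^sup>2" "0 \<le> z * (\<Sum>\<pi>\<in>?P. ?V \<pi> ^ (2 * q))"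
      using z by (auto intro!: mult_nonneg_nonneg sum_nonneg)
    show "of_bool (cell_U n w \<le> perm_crit a n ?V) \<le> (1 / (4 * \<theta>\<^sup>2)) * (cell_U n w - 4 * \<theta>)\<^sup>2
          + z * (\<Sum>\<pi>\<in>?P. ?V \<pi> ^ (2 * q))"
    proof (cases "cell_U n w \<le> perm_crit a n ?V")
      case False then show ?thesis using nn by simp
    next
      case True
      show ?thesis
      proof (cases "cell_U n w \<le> 2 * \<theta>")
        case le: True
        have "(2 * \<theta>)\<^sup>2 \<le> (4 * \<theta> - cell_U n w)\<^sup>2" using le assms(6) by (intro power_mono) auto
        then have "4 * \<theta>\<^sup>2 \<le> (cell_U n w - 4 * \<theta>)\<^sup>2"
          by (simp add: power2_commute power_mult_distrib)
        then have "1 \<le> (1 / (4 * \<theta>\<^sup>2)) * (cell_U n w - 4 * \<theta>)\<^sup>2" using assms(6) by (simp add: field_simps)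
        then show ?thesis using nn True by simp
      next
        case gt: False
        then have "\<not> perm_crit a n ?V \<le> 2 * \<theta>" using True by linarith
        then have "a * fact n < (\<Sum>\<pi>\<in>?P. of_bool (?V \<pi> > 2 * \<theta>))"
          using perm_crit_le[OF assms(4,5), where n = n and V = ?V and t = "2 * \<theta>"] by linarith
        also have "\<dots> \<le> (\<Sum>\<pi>\<in>?P. ?V \<pi> ^ (2 * q) / (2 * \<theta>) ^ (2 * q))"
        proof (rule sum_mono)
          fix \<pi>
          show "of_bool (?V \<pi> > 2 * \<theta>) \<le> ?V \<pi> ^ (2 * q) / (2 * \<theta>) ^ (2 * q)"
          proof (cases "?V \<pi> > 2 * \<theta>")
            case True
            then have "(2 * \<theta>) ^ (2 * q) \<le> ?V \<pi> ^ (2 * q)" using assms(6) by (intro power_mono) auto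
            then show ?thesis using True assms(6) by simp
          qed simp
        qed
        also have "\<dots> = (\<Sum>\<pi>\<in>?P. ?V \<pi> ^ (2 * q)) / (2 * \<theta>) ^ (2 * q)" by (simp only: sum_divide_distrib)
        finally have "1 \<le> (\<Sum>\<pi>\<in>?P. ?V \<pi> ^ (2 * q)) / (2 * \<theta>) ^ (2 * q) / (a * fact n)"
          using mult_pos_pos[OF assms(4) f0] by (simp only: le_divide_eq_1_pos less_imp_le)
        also have "\<dots> = z * (\<Sum>\<pi>\<in>?P. ?V \<pi> ^ (2 * q))" by (simp add: z_def mult_ac)
        finally have "1 \<le> z * (\<Sum>\<pi>\<in>?P. ?V \<pi> ^ (2 * q))" .
        moreover have "of_bool (cell_U n w \<le> perm_crit a n ?V) = (1 :: real)" using True by simp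
        ultimately show ?thesis using nn(1) by linarith
      qed
    qed
  qed
  also have "\<dots> = (1 / (4 * \<theta>\<^sup>2)) * E ?I (\<lambda>w. (cell_U n w - 4 * \<theta>)\<^sup>2)
      + z * (\<Sum>\<pi>\<in>?P. E ?I (\<lambda>w. cell_U n (permuted_sample \<pi> w) ^ (2 * q)))"
    by (simp only: fexp_add fexp_cmult fexp_sum)
  also have "\<dots> \<le> (1 / (4 * \<theta>\<^sup>2)) * (128 * \<rho> * \<theta> / m + 256 * real (card (A \<times> B)) * \<rho>\<^sup>2 / (real m)\<^sup>2)
      + z * (fact n * X ^ (2 * q))"
    unfolding X_def using z assms by (intro add_mono mult_left_mono cell_U_mean_sq_error permutation_moment) auto
  also have "\<dots> = (128 * \<rho> * \<theta> / m + 256 * real (card (A \<times> B)) * \<rho>\<^sup>2 / (real m)\<^sup>2) / (4 * \<theta>\<^sup>2)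
      + (X / (2 * \<theta>)) ^ (2 * q) / a"
    by (simp add: z_def power_divide)
  also note X_def
  finally show ?thesis .
qed

text \<open>Under independence the weight of a labelled sample is a product over Y-labels times a
  product over Z-labels, and each is invariant under reordering.\<close>

lemma fexp_permuted:
  assumes indep: "\<And>c. c \<in> A \<times> B \<Longrightarrow> p c = p1 (fst c) * p2 (snd c)" and pi: "\<pi> permutes {1..n}"
    and F: "\<And>w w'. (\<And>i. i \<in> {1..n} \<Longrightarrow> w i = w' i) \<Longrightarrow> F w = F w'"
  shows "E {1..n} (\<lambda>w. F (permuted_sample \<pi> w)) = E {1..n} F"
proof -
  let ?I = "{1..n}"
  \<comment> \<open>The restriction keeps the permuted sample extensional, so that
    \<open>T \<pi>\<close> and \<open>T (inv \<pi>)\<close> are inverse bijections of the index set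
    of the sum.\<close>
  define T where "T \<rho> w = restrict (permuted_sample \<rho> w) ?I" for \<rho> and w :: "nat \<Rightarrow> 'u \<times> 'v"
  have pin: "inv \<pi> permutes ?I" by (rule permutes_inv[OF pi])
  have TP: "T \<rho> w \<in> PiE ?I (\<lambda>_. A \<times> B)" if "\<rho> permutes ?I" "w \<in> PiE ?I (\<lambda>_. A \<times> B)" for \<rho> w
  proof -
    have "permuted_sample \<rho> w i \<in> A \<times> B" if i: "i \<in> ?I" for i
      using PiE_mem[OF \<open>w \<in> _\<close> i] PiE_mem[OF \<open>w \<in> _\<close>, of "\<rho> i"] i permutes_in_image[OF \<open>\<rho> permutes ?I\<close>]
      by (auto simp: permuted_sample_def mem_Times_iff simp del: atLeastAtMost_iff)
    then show ?thesis unfolding T_def by (intro restrict_PiE_iff[THEN iffD2]) auto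
  qed
  have TT: "T \<rho> (T \<rho>' w) = w" if "w \<in> PiE ?I (\<lambda>_. A \<times> B)" "\<rho> permutes ?I" "\<And>i. \<rho>' (\<rho> i) = i" for \<rho> \<rho>' w
  proof
    fix i
    show "T \<rho> (T \<rho>' w) i = w i"
      using that(3) permutes_in_image[OF that(2)] PiE_arb[OF that(1)]
      by (cases "i \<in> ?I") (auto simp: T_def permuted_sample_def simp del: atLeastAtMost_iff)
  qed
  have TT1: "T \<pi> (T (inv \<pi>) w) = w" and TT2: "T (inv \<pi>) (T \<pi> w) = w" if "w \<in> PiE ?I (\<lambda>_. A \<times> B)" for w
    using TT[OF that pi] TT[OF that pin] permutes_inverses[OF pi] by blast+
  have pr: "(\<Prod>i\<in>?I. p (T \<pi> w i)) = (\<Prod>i\<in>?I. p (w i))" if w: "w \<in> PiE ?I (\<lambda>_. A \<times> B)" for w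
  proof -
    have "(\<Prod>i\<in>?I. p (T \<pi> w i)) = (\<Prod>i\<in>?I. p1 (fst (w i)) * p2 (snd (w (\<pi> i))))"
      using indep PiE_mem[OF TP[OF pi w]] by (intro prod.cong) (auto simp: T_def permuted_sample_def simp del: atLeastAtMost_iff)
    also have "\<dots> = (\<Prod>i\<in>?I. p1 (fst (w i))) * (\<Prod>i\<in>?I. p2 (snd (w i)))"
      unfolding prod.distrib using prod.permute[OF pi, of "\<lambda>i. p2 (snd (w i))"] by (simp add: comp_def)
    also have "\<dots> = (\<Prod>i\<in>?I. p (w i))"
      unfolding prod.distrib[symmetric] using indep PiE_mem[OF w] by (intro prod.cong) auto
    finally show ?thesis .
  qed
  have "E ?I F = (\<Sum>w\<in>PiE ?I (\<lambda>_. A \<times> B). (\<Prod>i\<in>?I. p (w i)) * F w)" by (simp add: fexp_def)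
  also have "\<dots> = (\<Sum>w\<in>PiE ?I (\<lambda>_. A \<times> B). (\<Prod>i\<in>?I. p (T \<pi> w i)) * F (T \<pi> w))"
    by (rule sum.reindex_bij_witness[where i = "T \<pi>" and j = "T (inv \<pi>)"])
       (auto simp: TT1 TT2 intro!: TP pi pin simp del: One_nat_def)
  also have "\<dots> = (\<Sum>w\<in>PiE ?I (\<lambda>_. A \<times> B). (\<Prod>i\<in>?I. p (w i)) * F (permuted_sample \<pi> w))"
    by (intro sum.cong refl arg_cong2[where f="(*)"] pr F) (auto simp: T_def)
  finally show ?thesis by (simp add: fexp_def)
qed

text \<open>Exchangeability: the rejection probability may be averaged over all permuted samples.
  They share one critical value, and by its definition at most a fraction \<open>a\<close> of them
  exceed it.\<close>

lemma type_one_error_le: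
  assumes indep: "\<And>c. c \<in> A \<times> B \<Longrightarrow> p c = p1 (fst c) * p2 (snd c)" and a: "0 < a" "a < 1"
  shows "E {1..n} (\<lambda>w. of_bool (cell_U n w > cell_crit a n w)) \<le> a"
proof -
  let ?I = "{1..n}" and ?P = "{\<pi>. \<pi> permutes {1..n}}"
  define c where "c w = cell_crit a n w" for w :: "nat \<Rightarrow> 'u \<times> 'v"
  define F where "F w = (of_bool (cell_U n w > c w) :: real)" for w
  have F: "F w = F w'" if "\<And>i. i \<in> ?I \<Longrightarrow> w i = w' i" for w w'
    unfolding F_def c_def using cell_U_cong[OF that] perm_crit_cong[OF that] by simp
  have "fact n * E ?I F = (\<Sum>\<pi>\<in>?P. E ?I F)"
    using card_permutations[of "{1..n}" n] by (simp del: One_nat_def)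
  also have "\<dots> = (\<Sum>\<pi>\<in>?P. E ?I (\<lambda>w. F (permuted_sample \<pi> w)))"
    by (intro sum.cong refl fexp_permuted[symmetric] indep F) auto
  also have "\<dots> = E ?I (\<lambda>w. \<Sum>\<pi>\<in>?P. F (permuted_sample \<pi> w))" by (simp only: fexp_sum)
  also have "\<dots> = E ?I (\<lambda>w. \<Sum>\<pi>\<in>?P. of_bool (cell_U n (permuted_sample \<pi> w) > c w))"
    unfolding F_def c_def
    by (intro fexp_cong sum.cong refl) (simp add: perm_crit_permuted del: One_nat_def)
  also have "\<dots> \<le> E ?I (\<lambda>w. a * fact n)"
    unfolding c_def by (intro fexp_mono perm_crit_count a)
  also have "\<dots> = a * fact n" by (simp add: fexp_const)
  finally have "fact n * E ?I F \<le> fact n * a" by (simp only: mult.commute)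
  then have "E ?I F \<le> a" by (rule mult_left_le_imp_le) simp
  then show ?thesis unfolding F_def c_def .
qed

end

section \<open>Reconstruction of smooth functions from cell averages\<close>

text \<open>The nodes are 0, ..., n, the endpoints of consecutive unit intervals.\<close>

definition lagrange_basis :: "nat \<Rightarrow> nat \<Rightarrow> real poly" where
  "lagrange_basis n j = (\<Prod>i\<in>{..n} - {j}. smult (1 / (real j - real i)) [:- real i, 1:])"

lemma degree_lagrange_basis: "j \<le> n \<Longrightarrow> degree (lagrange_basis n j) \<le> n"
proof -
  assume j: "j \<le> n"
  have "degree (lagrange_basis n j) \<le> (\<Sum>i\<in>{..n} - {j}. degree (smult (1 / (real j - real i)) [:- real i, 1:]))"
    using degree_prod_sum_le[of "{..n} - {j}" "\<lambda>i. smult (1 / (real j - real i)) [:- real i, 1:]"]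
    by (simp add: lagrange_basis_def o_def)
  also have "\<dots> \<le> (\<Sum>i\<in>{..n} - {j}. 1)" by (intro sum_mono) (auto intro: order_trans[OF degree_smult_le])
  also have "\<dots> = n" using j by simp
  finally show ?thesis .
qed

lemma poly_lagrange_basis:
  assumes "i \<le> n" "j \<le> n"
  shows "poly (lagrange_basis n j) (real i) = of_bool (i = j)"
proof (cases "i = j")
  case True
  then show ?thesis
    by (auto simp: lagrange_basis_def poly_prod diff_divide_distrib[symmetric] intro!: prod.neutral)
next
  case False
  then show ?thesis using assms by (auto simp: lagrange_basis_def poly_prod intro!: prod_zero)
qed

lemma lagrange_interpolation:
  assumes "degree q \<le> n"
  shows "q = (\<Sum>j\<le>n. smult (poly q (real j)) (lagrange_basis n j))"
proof (rule poly_eqI_degree[of "real ` {..n}"])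
  fix x assume "x \<in> real ` {..n}"
  then obtain i where i: "i \<le> n" "x = real i" by auto
  have "poly (\<Sum>j\<le>n. smult (poly q (real j)) (lagrange_basis n j)) x
      = (\<Sum>j\<le>n. poly q (real j) * of_bool (i = j))"
    using i by (simp add: poly_sum poly_lagrange_basis)
  also have "\<dots> = poly q x" using i by (simp add: of_bool_def if_distrib[of "\<lambda>z. _ * z"] cong: if_cong)
  finally show "poly q x = poly (\<Sum>j\<le>n. smult (poly q (real j)) (lagrange_basis n j)) x" by simp
next
  have c: "card (real ` {..n}) = Suc n" by (simp add: card_image)
  then show "degree q < card (real ` {..n})" using assms by simp
  have "degree (\<Sum>j\<le>n. smult (poly q (real j)) (lagrange_basis n j)) \<le> n"
    by (rule degree_sum_le) (auto intro: order_trans[OF degree_smult_le] degree_lagrange_basis)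
  then show "degree (\<Sum>j\<le>n. smult (poly q (real j)) (lagrange_basis n j)) < card (real ` {..n})"
    using c by simp
qed

lemma pderiv_sum: "pderiv (\<Sum>j\<in>S. f j) = (\<Sum>j\<in>S. pderiv (f j))"
  by (induction S rule: infinite_finite_induct) (auto simp: pderiv_add)

text \<open>
  Polynomials of degree at most \<open>k\<close> can be recovered pointwise from their integrals over \<open>k + 1\<close>
  consecutive unit intervals: interpolate the primitive at the \<open>k + 2\<close> endpoints and differentiate.
\<close>
lemma averages_determine_polynomials:
  "\<exists>W>0. \<forall>u\<in>{0..real k + 1}. \<exists>w. (\<Sum>i\<le>k. \<bar>w i\<bar>) \<le> W \<and>
     (\<forall>a\<le>k. (\<Sum>i\<le>k. w i * (((real i + 1 - u) ^ (a + 1) - (real i - u) ^ (a + 1)) / (a + 1))) = 0 ^ a)"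
proof -
  define l where "l j = pderiv (lagrange_basis (Suc k) j)" for j
  have "\<exists>B. \<forall>u\<in>{0..real k + 1}. \<bar>poly (l j) u\<bar> \<le> B" for j
  proof -
    have "bounded ((\<lambda>u. poly (l j) u) ` {0..real k + 1})"
      by (intro compact_imp_bounded compact_continuous_image continuous_intros) auto
    then show ?thesis by (auto simp: bounded_iff)
  qed
  then obtain B where B: "\<And>j u. u \<in> {0..real k + 1} \<Longrightarrow> \<bar>poly (l j) u\<bar> \<le> B j" by metis
  \<comment> \<open>Adding 1 makes the bound strictly positive.\<close>
  define W where "W = (\<Sum>i\<le>k. \<Sum>j\<in>{i<..Suc k}. B j) + 1"
  \<comment> \<open>Summation by parts: q (j) - q (0) is the sum of the increments over the
    intervals i < j, so interval i collects the coefficients of all nodes above it.\<close>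
  define w where "w u i = (\<Sum>j\<in>{i<..Suc k}. poly (l j) u)" for u i
  have wW: "(\<Sum>i\<le>k. \<bar>w u i\<bar>) \<le> W" if "u \<in> {0..real k + 1}" for u
  proof -
    have "(\<Sum>i\<le>k. \<bar>w u i\<bar>) \<le> (\<Sum>i\<le>k. \<Sum>j\<in>{i<..Suc k}. B j)"
      unfolding w_def by (intro sum_mono order_trans[OF sum_abs] B that)
    then show ?thesis by (simp add: W_def)
  qed
  have "0 \<le> W" using order_trans[OF sum_nonneg wW[of 0]] by simp
  moreover have "W \<noteq> 0"
  proof -
    have "(\<Sum>i\<le>k. \<bar>w 0 i\<bar>) \<le> W - 1"
      unfolding w_def W_def using B[of 0] by (auto intro!: sum_mono order_trans[OF sum_abs])
    moreover have "0 \<le> (\<Sum>i\<le>k. \<bar>w 0 i\<bar>)" by (rule sum_nonneg) auto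
    ultimately show ?thesis by linarith
  qed
  ultimately have W: "W > 0" by simp
  have w_moment: "(\<Sum>i\<le>k. w u i * (poly q (real i + 1) - poly q (real i))) = poly (pderiv q) u"
    if "degree q \<le> Suc k" for q u
  proof -
    have pd: "poly (pderiv r) u = (\<Sum>j\<le>Suc k. poly r (real j) * poly (l j) u)" if "degree r \<le> Suc k" for r
      by (subst (1) lagrange_interpolation[OF that]) (simp only: pderiv_sum pderiv_smult poly_sum poly_smult l_def)
    \<comment> \<open>Applied to the constant 1, this removes the contribution of q (0).\<close>
    have zero: "(\<Sum>j\<le>Suc k. poly (l j) u) = 0" using pd[of 1] by simp
    have "(\<Sum>i\<le>k. w u i * (poly q (real i + 1) - poly q (real i)))
       = (\<Sum>i\<le>k. \<Sum>j\<in>{i<..Suc k}. poly (l j) u * (poly q (real (Suc i)) - poly q (real i)))"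
      by (simp add: w_def sum_distrib_right add.commute)
    also have "\<dots> = (\<Sum>(i, j)\<in>Sigma {..k} (\<lambda>i. {i<..Suc k}). poly (l j) u * (poly q (real (Suc i)) - poly q (real i)))"
      by (rule sum.Sigma) auto
    also have "\<dots> = (\<Sum>(j, i)\<in>Sigma {..Suc k} (\<lambda>j. {..<j}). poly (l j) u * (poly q (real (Suc i)) - poly q (real i)))"
      by (rule sum.reindex_bij_witness[where i = "\<lambda>(j, i). (i, j)" and j = "\<lambda>(i, j). (j, i)"]) auto
    also have "\<dots> = (\<Sum>j\<le>Suc k. \<Sum>i<j. poly (l j) u * (poly q (real (Suc i)) - poly q (real i)))"
      by (rule sum.Sigma[symmetric]) auto
    also have "\<dots> = (\<Sum>j\<le>Suc k. poly (l j) u * (poly q (real j) - poly q (real 0)))"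
      by (intro sum.cong refl)
         (simp only: sum_distrib_left[symmetric] sum_lessThan_telescope[of "\<lambda>i. poly q (real i)"])
    also have "\<dots> = (\<Sum>j\<le>Suc k. poly q (real j) * poly (l j) u) - poly q 0 * (\<Sum>j\<le>Suc k. poly (l j) u)"
      by (simp add: sum_distrib_left sum_subtractf algebra_simps)
    finally show ?thesis using pd[OF that] zero by simp
  qed
  have "(\<Sum>i\<le>k. w u i * (((real i + 1 - u) ^ (a + 1) - (real i - u) ^ (a + 1)) / (a + 1))) = 0 ^ a"
    if "a \<le> k" for u a
  proof -
    \<comment> \<open>The primitive of (x - u)^a that vanishes at u; its derivative at u is
      \<open>0 ^ a\<close>.\<close>
    define q where "q = smult (1 / (real a + 1)) ([:- u, 1:] ^ (a + 1))"
    have "degree q \<le> Suc k"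
      using that degree_power_le[of "[:- u, 1:]" "a + 1"] by (auto simp: q_def)
    from w_moment[OF this, of u] show ?thesis
      by (simp add: q_def pderiv_smult pderiv_power_Suc pderiv_pCons diff_divide_distrib add_divide_distrib
          del: power_Suc)
         (simp add: field_simps)
  qed
  then show ?thesis using W wW by (intro exI[of _ W]) blast
qed

section \<open>Cell averages in one dimension\<close>

definition unit_cell :: "nat \<Rightarrow> nat \<Rightarrow> real set" where
  "unit_cell N i = {t \<in> {0..1}. cell_index N t = int i}"

text \<open>The half-open convention and the exceptional last cell matter only at endpoints, hence
  on a null set.\<close>

lemma unit_cell_bounds:
  assumes "i < N"
  shows "{real i / N<..<(real i + 1) / N} \<subseteq> unit_cell N i" "unit_cell N i \<subseteq> {real i / N..(real i + 1) / N}"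
proof -
  have N: "real N > 0" using assms by simp
  show "{real i / N<..<(real i + 1) / N} \<subseteq> unit_cell N i"
  proof
    fix t assume "t \<in> {real i / N<..<(real i + 1) / N}"
    then have t: "real i < N * t" "N * t < real i + 1" using N by (auto simp: field_simps)
    then have "\<lfloor>N * t\<rfloor> = int i" by (simp add: floor_eq_iff)
    moreover have "0 \<le> t" using t(1) N by (smt (verit) mult_nonneg_nonpos of_nat_0_le_iff)
    moreover have "real N * t \<le> real N * 1" using t(2) assms by linarith
    then have "t \<le> 1" using N by (simp only: mult_le_cancel_left_pos)
    ultimately show "t \<in> unit_cell N i" using assms by (simp add: unit_cell_def cell_index_def)
  qed
  show "unit_cell N i \<subseteq> {real i / N..(real i + 1) / N}"
  proof
    fix t assume t: "t \<in> unit_cell N i"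
    then have t01: "0 \<le> t" "t \<le> 1" and c: "min (int N - 1) \<lfloor>N * t\<rfloor> = int i"
      by (auto simp: unit_cell_def cell_index_def)
    have "int i \<le> \<lfloor>N * t\<rfloor>" using c by linarith
    then have "real i \<le> N * t" by (simp add: le_floor_iff)
    moreover have "N * t \<le> real i + 1"
    proof (cases "\<lfloor>N * t\<rfloor> = int i")
      case True
      then show ?thesis by linarith
    next
      case False
      then have "int N - 1 = int i" using c by linarith
      then have "real N = real i + 1" by linarith
      moreover have "real N * t \<le> real N * 1" using t01 N by (intro mult_left_mono) auto
      ultimately show ?thesis by simp
    qed
    ultimately show "t \<in> {real i / N..(real i + 1) / N}" using N by (simp add: field_simps)
  qed
qed

lemma cell_index_measurable[measurable]: "cell_index N \<in> measurable borel (count_space UNIV)"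
  unfolding cell_index_def by measurable

lemma unit_cell_sets[measurable]: "unit_cell N i \<in> sets borel"
  unfolding unit_cell_def by measurable

lemma unit_cell_measure:
  assumes "i < N"
  shows "AE t in lborel. indicator (unit_cell N i) t = (indicator {real i / N..(real i + 1) / N} t :: real)"
proof -
  have "AE t in lborel. t \<noteq> real i / N" "AE t in lborel. t \<noteq> (real i + 1) / N"
    by (rule AE_lborel_singleton)+
  then show ?thesis
  proof eventually_elim
    case (elim t)
    then show ?case using unit_cell_bounds[OF assms] by (auto simp: indicator_def)
  qed
qed

lemma integral_unit_cell_power:
  assumes "i < N"
  shows "(\<integral>t. indicator (unit_cell N i) t * (t - x) ^ a \<partial>lborel)
     = (((real i + 1) / N - x) ^ (a + 1) - (real i / N - x) ^ (a + 1)) / (real a + 1)"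
    "integrable lborel (\<lambda>t. indicator (unit_cell N i) t * (t - x) ^ a)"
proof -
  let ?l = "real i / N" and ?u = "(real i + 1) / N"
  have lu: "?l \<le> ?u" by (simp add: divide_right_mono)
  have F: "DERIV (\<lambda>t. (t - x) ^ (a + 1) / (real a + 1)) t :> (t - x) ^ a" for t
  proof -
    have "DERIV (\<lambda>t. (t - x) ^ Suc a) t :> (1 + real a) * (1 * (t - x) ^ a)"
      by (rule DERIV_power_Suc) (auto intro!: derivative_eq_intros)
    then have "DERIV (\<lambda>t. (t - x) ^ Suc a / (real a + 1)) t :> (1 + real a) * (1 * (t - x) ^ a) / (real a + 1)"
      by (rule DERIV_cdivide)
    moreover have "(1 + real a) * (1 * (t - x) ^ a) / (real a + 1) = (t - x) ^ a" by (simp add: field_simps)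
    ultimately show ?thesis by simp
  qed
  have ae: "AE t in lborel. indicator (unit_cell N i) t * (t - x) ^ a = (t - x) ^ a * indicator {?l..?u} t"
    using unit_cell_measure[OF assms] by eventually_elim simp
  have "(\<integral>t. indicator (unit_cell N i) t * (t - x) ^ a \<partial>lborel) = (\<integral>t. (t - x) ^ a * indicator {?l..?u} t \<partial>lborel)"
    by (rule integral_cong_AE[OF _ _ ae]) auto
  also have "\<dots> = (?u - x) ^ (a + 1) / (real a + 1) - (?l - x) ^ (a + 1) / (real a + 1)"
    by (rule integral_FTC_Icc_real[OF lu]) (use F in auto)
  finally show "(\<integral>t. indicator (unit_cell N i) t * (t - x) ^ a \<partial>lborel)
     = (((real i + 1) / N - x) ^ (a + 1) - (real i / N - x) ^ (a + 1)) / (real a + 1)"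
    by (simp add: diff_divide_distrib)
  have "integrable lborel (\<lambda>t. (t - x) ^ a * indicator {?l..?u} t)"
    by (rule borel_integrable_atLeastAtMost) auto
  then show "integrable lborel (\<lambda>t. indicator (unit_cell N i) t * (t - x) ^ a)"
    by (subst integrable_cong_AE[OF _ _ ae]) auto
qed

text \<open>The order of the quantifiers is essential: the weights are chosen from \<open>N\<close>,
  \<open>r\<close> and \<open>x\<close> before \<open>\<phi>\<close>, so one choice serves all
  parallel lines at the same coordinate. The factor \<open>N\<close> turns a cell integral into a
  cell average, and (k + 1) / N is the width of the window.\<close>

definition cell_reconstruction :: "nat \<Rightarrow> real \<Rightarrow> bool" where
  "cell_reconstruction k W \<longleftrightarrow> (\<forall>N r x. r + k < N \<and> x \<in> {real r / N..(real r + real k + 1) / N} \<longrightarrow>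
     (\<exists>w. (\<Sum>i\<le>k. \<bar>w i\<bar>) \<le> W \<and>
       (\<forall>\<phi> c H e M. \<phi> \<in> borel_measurable borel \<and> (\<forall>t\<in>{0..1}. \<bar>\<phi> t\<bar> \<le> M) \<and> 0 \<le> H \<and> 0 < e \<and> c 0 = \<phi> x \<and>
          (\<forall>t\<in>{0..1}. \<bar>\<phi> t - (\<Sum>a\<le>k. c a * (t - x) ^ a)\<bar> \<le> H * \<bar>t - x\<bar> powr e) \<longrightarrow>
          \<bar>\<phi> x - (\<Sum>i\<le>k. w i * (N * (\<integral>t. indicator (unit_cell N (r + i)) t * \<phi> t \<partial>lborel)))\<bar>
            \<le> W * H * ((real k + 1) / N) powr e)))"

text \<open>Scaling by \<open>N\<close> and shifting by \<open>r\<close> maps the window onto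
  [0, k + 1]. The weights found there reproduce the polynomial part exactly, while the remainder
  passes through with total weight at most \<open>W\<close>.\<close>

lemma cell_reconstruction_exists: "\<exists>W\<ge>1. cell_reconstruction k W"
proof -
  obtain W where W: "W > 0" and ex: "\<And>u. u \<in> {0..real k + 1} \<Longrightarrow> \<exists>w. (\<Sum>i\<le>k. \<bar>w i\<bar>) \<le> W \<and>
     (\<forall>a\<le>k. (\<Sum>i\<le>k. w i * (((real i + 1 - u) ^ (a + 1) - (real i - u) ^ (a + 1)) / (a + 1))) = 0 ^ a)"
    using averages_determine_polynomials[of k] by blast
  show ?thesis
    unfolding cell_reconstruction_def
  \<comment> \<open>The increase by 1 ensures a constant of at least 1, whose powers grow with the
    number of coordinates.\<close>
  proof (intro exI[of _ "W + 1"] conjI allI impI, goal_cases)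
    case 1 show ?case using W by simp
  next
    case (2 N r x)
    then have rk: "r + k < N" and x: "real r / N \<le> x" "x \<le> (real r + real k + 1) / N" by auto
    have N: "real N > 0" using rk by simp
    define u where "u = N * x - real r"
    define h where "h = (real k + 1) / N"
    have "u \<in> {0..real k + 1}" using x N by (auto simp: u_def field_simps)
    from ex[OF this] obtain w where w: "(\<Sum>i\<le>k. \<bar>w i\<bar>) \<le> W" and
      mom: "\<And>a. a \<le> k \<Longrightarrow> (\<Sum>i\<le>k. w i * (((real i + 1 - u) ^ (a + 1) - (real i - u) ^ (a + 1)) / (a + 1))) = 0 ^ a"
      by blast
    show ?case
    proof (intro exI[of _ w] conjI allI impI)
      show "(\<Sum>i\<le>k. \<bar>w i\<bar>) \<le> W + 1" using w by simp
    next
      fix \<phi> :: "real \<Rightarrow> real" and c :: "nat \<Rightarrow> real" and H e M :: real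
      assume as: "\<phi> \<in> borel_measurable borel \<and> (\<forall>t\<in>{0..1}. \<bar>\<phi> t\<bar> \<le> M) \<and> 0 \<le> H \<and> 0 < e \<and> c 0 = \<phi> x \<and>
          (\<forall>t\<in>{0..1}. \<bar>\<phi> t - (\<Sum>a\<le>k. c a * (t - x) ^ a)\<bar> \<le> H * \<bar>t - x\<bar> powr e)"
      then have [measurable]: "\<phi> \<in> borel_measurable borel" and M: "\<And>t. t \<in> {0..1} \<Longrightarrow> \<bar>\<phi> t\<bar> \<le> M"
        and H: "0 \<le> H" and e: "0 < e" and c0: "c 0 = \<phi> x"
        and T: "\<And>t. t \<in> {0..1} \<Longrightarrow> \<bar>\<phi> t - (\<Sum>a\<le>k. c a * (t - x) ^ a)\<bar> \<le> H * \<bar>t - x\<bar> powr e" by auto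
      define T where "T t = (\<Sum>a\<le>k. c a * (t - x) ^ a)" for t
      let ?I = "\<lambda>i. indicator (unit_cell N (r + i)) :: real \<Rightarrow> real"
      have lt: "r + i < N" if "i \<le> k" for i using that rk by simp
      have int1: "integrable lborel (?I i)" "(\<integral>t. ?I i t \<partial>lborel) = 1 / N" if "i \<le> k" for i
        using integral_unit_cell_power[OF lt[OF that], of x 0] N by (auto simp: field_simps)
      have int\<phi>: "integrable lborel (\<lambda>t. ?I i t * \<phi> t)" if "i \<le> k" for i
      proof (rule Bochner_Integration.integrable_bound[OF integrable_mult_right[OF int1(1)[OF that], of M]])
        show "AE t in lborel. norm (?I i t * \<phi> t) \<le> norm (M * ?I i t)"
          using M by (intro AE_I2) (force simp: indicator_def unit_cell_def)
      qed measurable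
      have intT: "integrable lborel (\<lambda>t. ?I i t * T t)" if "i \<le> k" for i
        unfolding T_def sum_distrib_left mult.left_commute[of "indicator _ _"]
        by (intro Bochner_Integration.integrable_sum integrable_mult_right integral_unit_cell_power lt that)
      have IT: "N * (\<integral>t. ?I i t * T t \<partial>lborel)
          = (\<Sum>a\<le>k. c a / N ^ a * (((real i + 1 - u) ^ (a + 1) - (real i - u) ^ (a + 1)) / (a + 1)))" if "i \<le> k" for i
      proof -
        have "(\<integral>t. ?I i t * T t \<partial>lborel) = (\<Sum>a\<le>k. c a * (\<integral>t. ?I i t * (t - x) ^ a \<partial>lborel))"
          unfolding T_def sum_distrib_left mult.left_commute[of "indicator _ _"]
          by (subst Bochner_Integration.integral_sum)
             (auto intro!: integrable_mult_right integral_unit_cell_power lt that)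
        also have "\<dots> = (\<Sum>a\<le>k. c a * ((((real (r + i) + 1) / N - x) ^ (a + 1) - (real (r + i) / N - x) ^ (a + 1)) / (real a + 1)))"
          by (simp only: integral_unit_cell_power(1)[OF lt[OF that]])
        also have "\<dots> = (\<Sum>a\<le>k. c a * ((((real i + 1 - u) / N) ^ (a + 1) - ((real i - u) / N) ^ (a + 1)) / (real a + 1)))"
        proof -
          have "(real (r + i) + 1) / N - x = (real i + 1 - u) / N" "real (r + i) / N - x = (real i - u) / N"
            using N by (auto simp: u_def field_simps)
          then show ?thesis by (simp only:)
        qed
        finally have *: "(\<integral>t. ?I i t * T t \<partial>lborel)
          = (\<Sum>a\<le>k. c a * ((((real i + 1 - u) / N) ^ (a + 1) - ((real i - u) / N) ^ (a + 1)) / (real a + 1)))" .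
        have "N * (c a * (((X / N) ^ (a + 1) - (Y / N) ^ (a + 1)) / (real a + 1)))
            = c a / N ^ a * ((X ^ (a + 1) - Y ^ (a + 1)) / (a + 1))" for a X Y
        proof -
          have "N * (((X / N) ^ (a + 1) - (Y / N) ^ (a + 1))) = (X ^ (a + 1) - Y ^ (a + 1)) / N ^ a"
            using N by (simp add: power_divide diff_divide_distrib[symmetric])
          then have "c a * (N * (((X / N) ^ (a + 1) - (Y / N) ^ (a + 1)))) / (real a + 1)
             = c a * ((X ^ (a + 1) - Y ^ (a + 1)) / N ^ a) / (real a + 1)" by simp
          then show ?thesis by (simp add: mult_ac)
        qed
        then show ?thesis unfolding * sum_distrib_left by (simp add: add.commute)
      qed
      have "(\<Sum>i\<le>k. w i * (N * (\<integral>t. ?I i t * T t \<partial>lborel)))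
         = (\<Sum>i\<le>k. \<Sum>a\<le>k. c a / N ^ a * (w i * (((real i + 1 - u) ^ (a + 1) - (real i - u) ^ (a + 1)) / (a + 1))))"
        by (intro sum.cong refl) (simp add: IT sum_distrib_left mult.left_commute)
      also have "\<dots> = (\<Sum>a\<le>k. c a / N ^ a * (\<Sum>i\<le>k. w i * (((real i + 1 - u) ^ (a + 1) - (real i - u) ^ (a + 1)) / (a + 1))))"
        by (subst sum.swap) (simp only: sum_distrib_left)
      \<comment> \<open>The polynomial is centred at \<open>x\<close>, so the moment conditions
        leave only its constant term, the value at \<open>x\<close>.\<close>
      also have "\<dots> = (\<Sum>a\<le>k. c a / N ^ a * 0 ^ a)"
        by (intro sum.cong refl arg_cong2[where f="(*)"] mom) auto
      also have "\<dots> = (\<Sum>a\<le>k. if a = 0 then c 0 else 0)" by (intro sum.cong) auto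
      also have "\<dots> = \<phi> x" using c0 by (simp add: sum.delta)
      finally have wT: "\<phi> x = (\<Sum>i\<le>k. w i * (N * (\<integral>t. ?I i t * T t \<partial>lborel)))" by simp
      have bd: "\<bar>N * (\<integral>t. ?I i t * T t \<partial>lborel) - N * (\<integral>t. ?I i t * \<phi> t \<partial>lborel)\<bar> \<le> H * h powr e" if i: "i \<le> k" for i
      proof -
        have "(\<integral>t. ?I i t * T t \<partial>lborel) - (\<integral>t. ?I i t * \<phi> t \<partial>lborel) = (\<integral>t. ?I i t * T t - ?I i t * \<phi> t \<partial>lborel)"
          by (rule Bochner_Integration.integral_diff[symmetric]) (intro intT int\<phi> i)+
        also have "\<bar>\<dots>\<bar> \<le> (\<integral>t. H * h powr e * ?I i t \<partial>lborel)"
        proof (rule order_trans[OF integral_abs_bound integral_mono])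
          show "integrable lborel (\<lambda>t. \<bar>?I i t * T t - ?I i t * \<phi> t\<bar>)"
            by (intro integrable_abs Bochner_Integration.integrable_diff intT int\<phi> i)
          show "integrable lborel (\<lambda>t. H * h powr e * ?I i t)" by (intro integrable_mult_right int1 i)
          fix t
          show "\<bar>?I i t * T t - ?I i t * \<phi> t\<bar> \<le> H * h powr e * ?I i t"
          proof (cases "t \<in> unit_cell N (r + i)")
            case True
            then have "real (r + i) / N \<le> t" "t \<le> (real (r + i) + 1) / N"
              using unit_cell_bounds(2)[OF lt[OF i]] by auto
            moreover have "real r / N \<le> real (r + i) / N" "(real (r + i) + 1) / N \<le> (real r + real k + 1) / N"
              using i by (auto intro!: divide_right_mono)
            ultimately have "\<bar>t - x\<bar> \<le> (real r + real k + 1) / N - real r / N" using x by linarith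
            also have "\<dots> = h" by (simp add: h_def diff_divide_distrib[symmetric])
            finally have "\<bar>t - x\<bar> powr e \<le> h powr e" using e by (intro powr_mono2) auto
            then have "H * \<bar>t - x\<bar> powr e \<le> H * h powr e" using H by (rule mult_left_mono)
            moreover have "\<bar>\<phi> t - T t\<bar> \<le> H * \<bar>t - x\<bar> powr e"
              using T[of t] True by (simp add: T_def unit_cell_def)
            ultimately show ?thesis using True by (simp add: abs_minus_commute)
          qed simp
        qed
        also have "\<dots> = H * h powr e / N" using int1(2)[OF i] by simp
        finally have "N * \<bar>(\<integral>t. ?I i t * T t \<partial>lborel) - (\<integral>t. ?I i t * \<phi> t \<partial>lborel)\<bar> \<le> N * (H * h powr e / N)"
          using N by (intro mult_left_mono) auto
        then show ?thesis
          unfolding right_diff_distrib[symmetric] abs_mult using N by simp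
      qed
      have "\<bar>\<phi> x - (\<Sum>i\<le>k. w i * (N * (\<integral>t. ?I i t * \<phi> t \<partial>lborel)))\<bar>
          = \<bar>\<Sum>i\<le>k. w i * (N * (\<integral>t. ?I i t * T t \<partial>lborel) - N * (\<integral>t. ?I i t * \<phi> t \<partial>lborel))\<bar>"
        unfolding right_diff_distrib[of "w _"] sum_subtractf by (subst wT) simp
      also have "\<dots> \<le> (\<Sum>i\<le>k. \<bar>w i\<bar> * (H * h powr e))"
        by (rule order_trans[OF sum_abs]) (auto simp: abs_mult intro!: sum_mono mult_left_mono bd)
      also have "\<dots> = (\<Sum>i\<le>k. \<bar>w i\<bar>) * (H * h powr e)" by (simp add: sum_distrib_right)
      also have "\<dots> \<le> (W + 1) * (H * h powr e)" using w H by (intro mult_right_mono) auto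
      finally show "\<bar>\<phi> x - (\<Sum>i\<le>k. w i * (N * (\<integral>t. ?I i t * \<phi> t \<partial>lborel)))\<bar>
            \<le> (W + 1) * H * ((real k + 1) / N) powr e" by (simp add: h_def mult.assoc)
    qed
  qed
qed

section \<open>From coordinate lines to the cube\<close>

lemma sum_PiE_insert:
  fixes F :: "('i \<Rightarrow> 'c) \<Rightarrow> real"
  assumes "finite I" "i \<notin> I"
  shows "(\<Sum>x\<in>PiE (insert i I) (\<lambda>_. C). F x) = (\<Sum>c\<in>C. \<Sum>x\<in>PiE I (\<lambda>_. C). F (x(i := c)))"
  using fexp_insert[OF assms, of "\<lambda>_. 1" C F] by (simp add: fexp_def)

lemma sum_PiE_prod:
  fixes g :: "'i \<Rightarrow> 'c \<Rightarrow> real"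
  assumes "finite I" "finite C"
  shows "(\<Sum>x\<in>PiE I (\<lambda>_. C). \<Prod>i\<in>I. g i (x i)) = (\<Prod>i\<in>I. \<Sum>c\<in>C. g i c)"
  using prod_sum_PiE[of I "\<lambda>_. C" g] assms by simp

definition coord_upd :: "'a::euclidean_space \<Rightarrow> 'a \<Rightarrow> real \<Rightarrow> 'a" where
  "coord_upd x b t = x + (t - x \<bullet> b) *\<^sub>R b"

definition mix_point :: "'a set \<Rightarrow> 'a::euclidean_space \<Rightarrow> ('a \<Rightarrow> real) \<Rightarrow> 'a" where
  "mix_point S x t = (\<Sum>b\<in>Basis. (if b \<in> S then t b else x \<bullet> b) *\<^sub>R b)"

lemma mix_point_inner: "b \<in> Basis \<Longrightarrow> mix_point S x t \<bullet> b = (if b \<in> S then t b else x \<bullet> b)"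
  unfolding mix_point_def by (subst inner_sum_left_Basis) auto

lemma mem_unit_cube: "x \<in> unit_cube \<longleftrightarrow> (\<forall>b\<in>Basis. 0 \<le> x \<bullet> b \<and> x \<bullet> b \<le> 1)"
  by (simp add: unit_cube_def mem_box)

lemma coord_upd_mix_point:
  assumes "b \<in> Basis" "b \<notin> S"
  shows "coord_upd (mix_point S x t) b v = mix_point (insert b S) x (t(b := v))"
  by (rule euclidean_eqI)
     (use assms in \<open>auto simp: coord_upd_def inner_add_left mix_point_inner inner_not_same_Basis\<close>)

lemma mix_point_measurable[measurable]:
  fixes x :: "'a::euclidean_space"
  shows "mix_point S x \<in> measurable (PiM S (\<lambda>_. lborel)) borel"
  unfolding mix_point_def
proof (intro borel_measurable_sum)
  fix b :: 'a
  show "(\<lambda>t. (if b \<in> S then t b else x \<bullet> b) *\<^sub>R b) \<in> borel_measurable (PiM S (\<lambda>_. lborel))"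
    by (cases "b \<in> S") simp_all
qed

text \<open>The average over one-dimensional cells in the directions \<open>S\<close>, with the
  remaining coordinates frozen at those of \<open>x\<close>. It interpolates between the value at
  \<open>x\<close> for empty \<open>S\<close> and the cell average for
  \<open>S = Basis\<close>.\<close>

definition box_mean :: "nat \<Rightarrow> ('a::euclidean_space \<Rightarrow> real) \<Rightarrow> 'a set \<Rightarrow> 'a \<Rightarrow> ('a \<Rightarrow> nat) \<Rightarrow> real" where
  "box_mean N F S x c = real N ^ card S *
     (\<integral>t. (\<Prod>b\<in>S. indicator (unit_cell N (c b)) (t b)) * F (mix_point S x t) \<partial>PiM S (\<lambda>_. lborel))"

text \<open>Smoothness is stated line by line, with coefficients that may vary with the line, so
  that the reconstruction can treat one coordinate at a time and avoids a multivariate Taylor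
  expansion.\<close>

locale line_approx =
  fixes F :: "'a::euclidean_space \<Rightarrow> real" and k :: nat and H e M :: real
  assumes F_meas[measurable]: "F \<in> borel_measurable borel" and F_bound: "\<And>x. \<bar>F x\<bar> \<le> M"
    and H_nonneg: "0 \<le> H" and e_pos: "0 < e"
    and line: "\<And>x b. x \<in> unit_cube \<Longrightarrow> b \<in> Basis \<Longrightarrow>
      \<exists>c. c 0 = F x \<and> (\<forall>t\<in>{0..1}. \<bar>F (coord_upd x b t) - (\<Sum>a\<le>k. c a * (t - x \<bullet> b) ^ a)\<bar> \<le> H * \<bar>t - x \<bullet> b\<bar> powr e)"
begin

interpretation L: product_sigma_finite "\<lambda>_::'a. lborel :: real measure" by standard

lemma integrable_cell:
  "i < N \<Longrightarrow> integrable lborel (indicator (unit_cell N i) :: real \<Rightarrow> real)"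
  "i < N \<Longrightarrow> (\<integral>t. indicator (unit_cell N i) t \<partial>lborel) = 1 / real N"
  using integral_unit_cell_power[of i N 0 0] by (auto simp: field_simps)

lemma integrable_box:
  assumes "finite S" "\<And>b. b \<in> S \<Longrightarrow> c b < N"
  shows "integrable (PiM S (\<lambda>_. lborel)) (\<lambda>t. (\<Prod>b\<in>S. indicator (unit_cell N (c b)) (t b)) * F (mix_point S x t))"
    and "integrable (PiM S (\<lambda>_. lborel)) (\<lambda>t. \<Prod>b\<in>S. indicator (unit_cell N (c b)) (t b) :: real)"
    and "(\<integral>t. (\<Prod>b\<in>S. indicator (unit_cell N (c b)) (t b)) \<partial>PiM S (\<lambda>_. lborel)) = 1 / real N ^ card S"
proof -
  show i: "integrable (PiM S (\<lambda>_. lborel)) (\<lambda>t. \<Prod>b\<in>S. indicator (unit_cell N (c b)) (t b) :: real)"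
    by (rule L.product_integrable_prod[OF assms(1)]) (intro integrable_cell assms)
  have "(\<integral>t. (\<Prod>b\<in>S. indicator (unit_cell N (c b)) (t b) :: real) \<partial>PiM S (\<lambda>_. lborel))
      = (\<Prod>b\<in>S. \<integral>t. indicator (unit_cell N (c b)) t \<partial>lborel)"
    by (rule L.product_integral_prod[OF assms(1)]) (intro integrable_cell assms)
  also have "\<dots> = (\<Prod>b\<in>S. 1 / real N)" by (intro prod.cong refl integrable_cell assms)
  finally show "(\<integral>t. (\<Prod>b\<in>S. indicator (unit_cell N (c b)) (t b)) \<partial>PiM S (\<lambda>_. lborel)) = 1 / real N ^ card S"
    by (simp add: power_one_over)
  show "integrable (PiM S (\<lambda>_. lborel)) (\<lambda>t. (\<Prod>b\<in>S. indicator (unit_cell N (c b)) (t b)) * F (mix_point S x t))"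
  proof (rule Bochner_Integration.integrable_bound[OF integrable_mult_right[OF i, of M]])
    show "AE t in PiM S (\<lambda>_. lborel). norm ((\<Prod>b\<in>S. indicator (unit_cell N (c b)) (t b)) * F (mix_point S x t))
        \<le> norm (M * (\<Prod>b\<in>S. indicator (unit_cell N (c b)) (t b)))"
      using order_trans[OF F_bound abs_ge_self]
      by (intro AE_I2) (auto simp: abs_mult mult.commute[of _ "\<bar>F _\<bar>"] intro!: mult_right_mono)
  qed measurable
qed

lemma box_mean_insert:
  assumes "finite S" "S \<subseteq> Basis" "b \<in> Basis" "b \<notin> S" "\<And>b'. b' \<in> insert b S \<Longrightarrow> c b' < N"
  shows "box_mean N F (insert b S) x c = real N ^ card S *
    (\<integral>t. (\<Prod>b\<in>S. indicator (unit_cell N (c b)) (t b)) *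
      (N * (\<integral>v. indicator (unit_cell N (c b)) v * F (coord_upd (mix_point S x t) b v) \<partial>lborel)) \<partial>PiM S (\<lambda>_. lborel))"
proof -
  let ?f = "\<lambda>t. (\<Prod>b\<in>insert b S. indicator (unit_cell N (c b)) (t b)) * F (mix_point (insert b S) x t)"
  have pr: "(\<Prod>b'\<in>insert b S. indicator (unit_cell N (c b')) ((t(b := v)) b'))
      = indicator (unit_cell N (c b)) v * (\<Prod>b\<in>S. indicator (unit_cell N (c b)) (t b) :: real)" for t v
  proof -
    have "(\<Prod>b'\<in>S. indicator (unit_cell N (c b')) ((t(b := v)) b')) = (\<Prod>b\<in>S. indicator (unit_cell N (c b)) (t b) :: real)"
      using assms(4) by (intro prod.cong) auto
    then show ?thesis using assms(1,4) by simp
  qed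
  have "integral\<^sup>L (PiM (insert b S) (\<lambda>_. lborel)) ?f
      = (\<integral>t. (\<integral>v. ?f (t(b := v)) \<partial>lborel) \<partial>PiM S (\<lambda>_. lborel))"
    by (rule L.product_integral_insert[OF assms(1,4)]) (intro integrable_box, use assms in auto)
  also have "\<dots> = (\<integral>t. (\<Prod>b\<in>S. indicator (unit_cell N (c b)) (t b)) *
      (\<integral>v. indicator (unit_cell N (c b)) v * F (coord_upd (mix_point S x t) b v) \<partial>lborel) \<partial>PiM S (\<lambda>_. lborel))"
    unfolding pr coord_upd_mix_point[OF assms(3,4)]
    by (simp only: mult.assoc mult.left_commute[of "indicator _ _" "prod _ _"] integral_mult_right_zero)
  finally show ?thesis
    unfolding box_mean_def using assms(1,4)
    by (simp add: mult_ac)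
qed

lemma abs_prod_sum_PiE_le:
  fixes w :: "'i \<Rightarrow> nat \<Rightarrow> real" and W :: real
  assumes "finite S" "1 \<le> W" "\<And>b. b \<in> S \<Longrightarrow> (\<Sum>i\<le>k. \<bar>w b i\<bar>) \<le> W"
  shows "(\<Sum>i\<in>PiE S (\<lambda>_. {..k}). \<bar>\<Prod>b\<in>S. w b (i b)\<bar>) \<le> W ^ card S"
proof -
  have "(\<Sum>i\<in>PiE S (\<lambda>_. {..k}). \<bar>\<Prod>b\<in>S. w b (i b)\<bar>) = (\<Prod>b\<in>S. \<Sum>i\<le>k. \<bar>w b i\<bar>)"
    unfolding abs_prod by (rule sum_PiE_prod[OF assms(1)]) simp
  also have "\<dots> \<le> (\<Prod>b\<in>S. W)" by (intro prod_mono) (auto intro!: sum_nonneg assms(3))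
  finally show ?thesis by simp
qed

text \<open>Tensor product of the one-dimensional reconstructions. Averaging in a new direction
  \<open>b\<close> replaces each box mean by a weighted sum of box means with an error at most
  \<open>\<delta>\<close>, which the weights already accumulated amplify by at most
  \<open>W ^ card S\<close>.\<close>

lemma box_mean_approx:
  fixes W \<delta> :: real
  assumes S: "finite S" "S \<subseteq> Basis" and x: "x \<in> unit_cube" and W: "1 \<le> W" and \<delta>: "0 \<le> \<delta>"
    and rk: "\<And>b. b \<in> Basis \<Longrightarrow> r b + k < N"
    and w: "\<And>b. b \<in> Basis \<Longrightarrow> (\<Sum>i\<le>k. \<bar>w b i\<bar>) \<le> W"
    and rec: "\<And>b y. b \<in> Basis \<Longrightarrow> y \<in> unit_cube \<Longrightarrow> y \<bullet> b = x \<bullet> b \<Longrightarrow>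
       \<bar>F y - (\<Sum>i\<le>k. w b i * (N * (\<integral>v. indicator (unit_cell N (r b + i)) v * F (coord_upd y b v) \<partial>lborel)))\<bar> \<le> \<delta>"
  shows "\<bar>F x - (\<Sum>i\<in>PiE S (\<lambda>_. {..k}). (\<Prod>b\<in>S. w b (i b)) * box_mean N F S x (\<lambda>b. r b + i b))\<bar>
     \<le> card S * W ^ card S * \<delta>"
  using S
proof (induction S rule: finite_induct)
  case empty
  have "mix_point {} x t = x" for t
    by (rule euclidean_eqI) (simp add: mix_point_inner)
  then show ?case using x by (simp add: box_mean_def PiM_empty lebesgue_integral_count_space_finite)
next
  case (insert b S)
  then have b: "b \<in> Basis" and SB: "S \<subseteq> Basis" by auto
  have N: "real N > 0" using rk[OF b] by simp
  define c where "c i = (\<lambda>b. r b + i b)" for i :: "'a \<Rightarrow> nat"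
  have ci: "c i b' < N" if "i \<in> PiE S (\<lambda>_. {..k})" "b' \<in> S" for i b'
    using PiE_mem[OF that] rk[of b'] that SB by (auto simp: c_def)
  \<comment> \<open>All points averaged over \<open>S\<close> keep the coordinate of
    \<open>x\<close> in direction \<open>b\<close>, so the same weights \<open>w b\<close> work for
    each of them and can be pulled out of the integral.\<close>
  have step: "\<bar>box_mean N F S x (c i) - (\<Sum>j\<le>k. w b j * box_mean N F (insert b S) x (c (i(b := j))))\<bar> \<le> \<delta>"
    if i: "i \<in> PiE S (\<lambda>_. {..k})" for i
  proof -
    let ?P = "\<lambda>t. \<Prod>b\<in>S. indicator (unit_cell N (c i b)) (t b) :: real"
    let ?J = "\<lambda>j t. N * (\<integral>v. indicator (unit_cell N (r b + j)) v * F (coord_upd (mix_point S x t) b v) \<partial>lborel)"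
    have cj: "c (i(b := j)) b' < N" if "j \<le> k" "b' \<in> insert b S" for j b'
      using ci[OF i, of b'] that rk[OF b] by (auto simp: c_def)
    have bm: "box_mean N F (insert b S) x (c (i(b := j))) = real N ^ card S * (\<integral>t. ?P t * ?J j t \<partial>PiM S (\<lambda>_. lborel))"
      if "j \<le> k" for j
    proof -
      have "(\<Prod>b'\<in>S. indicator (unit_cell N (c (i(b := j)) b')) (t b') :: real) = ?P t" for t
        using insert.hyps by (intro prod.cong) (auto simp: c_def)
      then show ?thesis
        using box_mean_insert[OF insert.hyps(1) SB b insert.hyps(2) cj[OF that], where x = x] by (simp add: c_def)
    qed
    have int: "integrable (PiM S (\<lambda>_. lborel)) (\<lambda>t. ?P t * ?J j t)" if "j \<le> k" for j
    proof (rule Bochner_Integration.integrable_bound[OF integrable_mult_right[OF integrable_box(2)[OF insert.hyps(1) ci[OF i]], of M]])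
      have [measurable]: "(\<lambda>t. \<integral>v. indicator (unit_cell N (r b + j)) v * F (mix_point S x t + (v - mix_point S x t \<bullet> b) *\<^sub>R b) \<partial>lborel)
          \<in> borel_measurable (PiM S (\<lambda>_. lborel))"
        by measurable
      show "(\<lambda>t. ?P t * ?J j t) \<in> borel_measurable (PiM S (\<lambda>_. lborel))"
        unfolding coord_upd_def by measurable
      have jn: "r b + j < N" using rk[OF b] that by simp
      have "\<bar>?J j t\<bar> \<le> M" for t
      proof -
        have "\<bar>\<integral>v. indicator (unit_cell N (r b + j)) v * F (coord_upd (mix_point S x t) b v) \<partial>lborel\<bar>
            \<le> (\<integral>v. M * indicator (unit_cell N (r b + j)) v \<partial>lborel)"
        proof (rule order_trans[OF integral_abs_bound integral_mono'])
          show "integrable lborel (\<lambda>v. M * indicator (unit_cell N (r b + j)) v)"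
            by (intro integrable_mult_right integrable_cell jn)
        next
          fix v
          show "\<bar>indicator (unit_cell N (r b + j)) v * F (coord_upd (mix_point S x t) b v)\<bar>
              \<le> M * indicator (unit_cell N (r b + j)) v"
            using F_bound[of "coord_upd (mix_point S x t) b v"] by (simp add: abs_mult indicator_def)
          show "0 \<le> M * indicator (unit_cell N (r b + j)) v"
            using order_trans[OF abs_ge_zero F_bound] by simp
        qed
        also have "\<dots> = M / N" using integrable_cell(2)[OF jn] by simp
        finally show ?thesis using N by (simp add: abs_mult field_simps)
      qed
      then show "AE t in PiM S (\<lambda>_. lborel). norm (?P t * ?J j t) \<le> norm (M * ?P t)"
        using order_trans[OF _ abs_ge_self] by (intro AE_I2) (auto simp: abs_mult mult.commute[of M] intro!: mult_left_mono)
    qed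
    have "box_mean N F S x (c i) - (\<Sum>j\<le>k. w b j * box_mean N F (insert b S) x (c (i(b := j))))
       = real N ^ card S * ((\<integral>t. ?P t * F (mix_point S x t) \<partial>PiM S (\<lambda>_. lborel))
          - (\<Sum>j\<le>k. w b j * (\<integral>t. ?P t * ?J j t \<partial>PiM S (\<lambda>_. lborel))))"
      unfolding box_mean_def[of N F S] right_diff_distrib sum_distrib_left
      by (intro arg_cong2[where f="(-)"] sum.cong refl) (simp_all add: bm mult_ac)
    also have "(\<integral>t. ?P t * F (mix_point S x t) \<partial>PiM S (\<lambda>_. lborel))
          - (\<Sum>j\<le>k. w b j * (\<integral>t. ?P t * ?J j t \<partial>PiM S (\<lambda>_. lborel)))
        = (\<integral>t. ?P t * F (mix_point S x t) - (\<Sum>j\<le>k. w b j * (?P t * ?J j t)) \<partial>PiM S (\<lambda>_. lborel))"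
      using integrable_box(1)[OF insert.hyps(1) ci[OF i]] int
      by (subst Bochner_Integration.integral_diff)
         (auto intro!: Bochner_Integration.integrable_sum integrable_mult_right simp: Bochner_Integration.integral_sum)
    also have "\<bar>real N ^ card S * \<dots>\<bar> \<le> real N ^ card S * (\<integral>t. \<delta> * ?P t \<partial>PiM S (\<lambda>_. lborel))"
      unfolding abs_mult abs_of_nonneg[OF zero_le_power[OF less_imp_le[OF N]]]
    proof (rule mult_left_mono[OF order_trans[OF integral_abs_bound integral_mono']])
      show "integrable (PiM S (\<lambda>_. lborel)) (\<lambda>t. \<delta> * ?P t)"
        by (intro integrable_mult_right integrable_box(2) insert.hyps ci[OF i])
      fix t :: "'a \<Rightarrow> real"
      show "0 \<le> \<delta> * ?P t" using \<delta> by (auto intro!: mult_nonneg_nonneg prod_nonneg)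
      show "\<bar>?P t * F (mix_point S x t) - (\<Sum>j\<le>k. w b j * (?P t * ?J j t))\<bar> \<le> \<delta> * ?P t"
      proof (cases "\<forall>b'\<in>S. t b' \<in> unit_cell N (c i b')")
        case True
        have P: "?P t = 1" using True by simp
        have "mix_point S x t \<in> unit_cube"
          using True x by (auto simp: mem_unit_cube mix_point_inner unit_cell_def)
        moreover have "mix_point S x t \<bullet> b = x \<bullet> b" using b insert.hyps by (simp add: mix_point_inner)
        ultimately show ?thesis unfolding P using rec[OF b] by simp
      next
        case False
        then have P: "?P t = 0" using insert.hyps(1) by (intro prod_zero) (auto simp: indicator_def)
        show ?thesis unfolding P by simp
      qed
    qed (use N in simp)
    also have "\<dots> = \<delta>" using integrable_box(3)[OF insert.hyps(1) ci[OF i]] N by simp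
    finally show ?thesis .
  qed
  let ?pw = "\<lambda>i. \<Prod>b\<in>S. w b (i b)"
  have pw: "(\<Prod>b'\<in>insert b S. w b' ((i(b := j)) b')) = w b j * ?pw i" for i j
  proof -
    have "(\<Prod>b'\<in>S. w b' ((i(b := j)) b')) = ?pw i" using insert.hyps by (intro prod.cong) auto
    then show ?thesis using insert.hyps by simp
  qed
  have eq: "(\<Sum>i\<in>PiE (insert b S) (\<lambda>_. {..k}). (\<Prod>b\<in>insert b S. w b (i b)) * box_mean N F (insert b S) x (c i))
     = (\<Sum>i\<in>PiE S (\<lambda>_. {..k}). ?pw i * (\<Sum>j\<le>k. w b j * box_mean N F (insert b S) x (c (i(b := j)))))"
    unfolding sum_PiE_insert[OF insert.hyps] pw
    by (subst sum.swap) (simp add: sum_distrib_left mult_ac)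
  have IH: "\<bar>F x - (\<Sum>i\<in>PiE S (\<lambda>_. {..k}). ?pw i * box_mean N F S x (c i))\<bar> \<le> card S * W ^ card S * \<delta>"
    unfolding c_def by (rule insert.IH[OF SB])
  have "\<bar>(\<Sum>i\<in>PiE S (\<lambda>_. {..k}). ?pw i * box_mean N F S x (c i))
      - (\<Sum>i\<in>PiE S (\<lambda>_. {..k}). ?pw i * (\<Sum>j\<le>k. w b j * box_mean N F (insert b S) x (c (i(b := j)))))\<bar>
      \<le> (\<Sum>i\<in>PiE S (\<lambda>_. {..k}). \<bar>?pw i\<bar> * \<delta>)"
    unfolding sum_subtractf[symmetric] right_diff_distrib[symmetric]
    by (rule order_trans[OF sum_abs]) (auto simp: abs_mult intro!: sum_mono mult_left_mono step)
  also have "\<dots> \<le> W ^ card S * \<delta>"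
    unfolding sum_distrib_right[symmetric]
    by (intro mult_right_mono abs_prod_sum_PiE_le insert.hyps W \<delta> w) (use SB in auto)
  finally have "\<bar>F x - (\<Sum>i\<in>PiE (insert b S) (\<lambda>_. {..k}). (\<Prod>b\<in>insert b S. w b (i b)) * box_mean N F (insert b S) x (c i))\<bar>
      \<le> card S * W ^ card S * \<delta> + W ^ card S * \<delta>"
    unfolding eq using IH by linarith
  also have "\<dots> = (real (card S) + 1) * W ^ card S * \<delta>" by (simp add: algebra_simps)
  also have "\<dots> \<le> (real (card S) + 1) * W ^ Suc (card S) * \<delta>"
    using W \<delta> by (intro mult_right_mono mult_left_mono power_increasing) auto
  also have "\<dots> = real (card (insert b S)) * W ^ card (insert b S) * \<delta>"
    using insert.hyps by (simp add: add.commute)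
  finally show ?case by (simp add: c_def)
qed

end

definition cube_cell :: "nat \<Rightarrow> ('a::euclidean_space \<Rightarrow> nat) \<Rightarrow> 'a set" where
  "cube_cell N c = {z \<in> unit_cube. \<forall>b\<in>Basis. cell_index N (z \<bullet> b) = int (c b)}"

lemma unit_cube_sets[measurable]: "unit_cube \<in> sets borel"
  unfolding unit_cube_def by simp

lemma cube_cell_sets[measurable]: "cube_cell N c \<in> sets (borel :: 'a::euclidean_space measure)"
proof -
  have "cube_cell N c = unit_cube \<inter> (\<Inter>b\<in>Basis. {z \<in> space borel. cell_index N (z \<bullet> b) = int (c b)})"
    by (auto simp: cube_cell_def)
  also have "\<dots> \<in> sets (borel :: 'a measure)"
    by (intro sets.Int unit_cube_sets sets.finite_INT) auto
  finally show ?thesis .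
qed

lemma unit_cube_split:
  fixes z :: "'a::euclidean_space"
  assumes "0 < N"
  shows "indicator unit_cube z = (\<Sum>c\<in>PiE Basis (\<lambda>_. {..<N}). indicator (cube_cell N c) z :: real)"
    and "z \<in> unit_cube \<Longrightarrow> \<exists>c\<in>PiE Basis (\<lambda>_. {..<N}). z \<in> cube_cell N c"
proof -
  define d where "d = (\<lambda>b\<in>Basis. nat (cell_index N (z \<bullet> b)))"
  have range: "0 \<le> cell_index N (z \<bullet> b) \<and> cell_index N (z \<bullet> b) < N" if "z \<in> unit_cube" "b \<in> Basis" for b
    using that assms by (auto simp: mem_unit_cube cell_index_def)
  have d: "d \<in> PiE Basis (\<lambda>_. {..<N})" if "z \<in> unit_cube"
    using range[OF that] by (auto simp: d_def nat_less_iff)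
  have iff: "z \<in> cube_cell N c \<longleftrightarrow> c = d" if "z \<in> unit_cube" "c \<in> PiE Basis (\<lambda>_. {..<N})" for c
  proof
    assume "z \<in> cube_cell N c"
    then have "c b = d b" if "b \<in> Basis" for b using that by (simp add: cube_cell_def d_def)
    then show "c = d" using PiE_arb[OF that(2)] by (auto simp: fun_eq_iff d_def restrict_def)
  next
    assume "c = d"
    then show "z \<in> cube_cell N c" using that(1) range[OF that(1)] by (auto simp: cube_cell_def d_def)
  qed
  show "z \<in> unit_cube \<Longrightarrow> \<exists>c\<in>PiE Basis (\<lambda>_. {..<N}). z \<in> cube_cell N c"
    using iff d by blast
  show "indicator unit_cube z = (\<Sum>c\<in>PiE Basis (\<lambda>_. {..<N}). indicator (cube_cell N c) z :: real)"
  proof (cases "z \<in> unit_cube")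
    case True
    then have "(\<Sum>c\<in>PiE Basis (\<lambda>_. {..<N}). indicator (cube_cell N c) z :: real)
        = (\<Sum>c\<in>PiE Basis (\<lambda>_. {..<N}). if c = d then 1 else 0)"
      by (intro sum.cong refl) (auto simp: iff indicator_def)
    also have "\<dots> = 1" using d[OF True] by (simp add: finite_PiE)
    finally show ?thesis using True by simp
  next
    case False
    then show ?thesis by (auto simp: cube_cell_def indicator_def)
  qed
qed

context line_approx
begin

definition cell_mass :: "nat \<Rightarrow> ('a \<Rightarrow> nat) \<Rightarrow> real" where
  "cell_mass N c = (\<integral>z. indicator (cube_cell N c) z * F z \<partial>lborel)"

lemma prod_indicator_cell:
  "(\<Prod>b\<in>Basis. indicator (unit_cell N (c b)) (t b)) = (indicator (cube_cell N c) (\<Sum>b\<in>Basis. t b *\<^sub>R b :: 'a) :: real)"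
proof -
  have b: "(\<Sum>b\<in>Basis. t b *\<^sub>R b :: 'a) \<bullet> b = t b" if "b \<in> Basis" for b
    using that by (rule inner_sum_left_Basis)
  show ?thesis
  proof (cases "\<forall>b\<in>Basis. t b \<in> unit_cell N (c b)")
    case True
    then have "(\<Sum>b\<in>Basis. t b *\<^sub>R b :: 'a) \<in> cube_cell N c"
      by (auto simp: cube_cell_def mem_unit_cube b unit_cell_def)
    then show ?thesis using True by simp
  next
    case False
    then have "(\<Prod>b\<in>Basis. indicator (unit_cell N (c b)) (t b)) = (0 :: real)"
      by (intro prod_zero) (auto simp: indicator_def)
    moreover have "(\<Sum>b\<in>Basis. t b *\<^sub>R b :: 'a) \<notin> cube_cell N c"
      using False by (auto simp: cube_cell_def mem_unit_cube b unit_cell_def)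
    ultimately show ?thesis by simp
  qed
qed

lemma box_mean_Basis: "box_mean N F Basis x c = real N ^ DIM('a) * cell_mass N c"
proof -
  have m: "mix_point Basis x t = (\<Sum>b\<in>Basis. t b *\<^sub>R b)" for t
    unfolding mix_point_def by (intro sum.cong) auto
  have "cell_mass N c = (\<integral>t. indicator (cube_cell N c) (\<Sum>b\<in>Basis. t b *\<^sub>R b) * F (\<Sum>b\<in>Basis. t b *\<^sub>R b) \<partial>PiM Basis (\<lambda>_. lborel))"
    unfolding cell_mass_def by (subst lborel_eq, subst integral_distr) auto
  then show ?thesis unfolding box_mean_def m prod_indicator_cell by simp
qed

lemma cell_volume:
  assumes "\<And>b. b \<in> Basis \<Longrightarrow> c b < N"
  shows "integrable lborel (indicator (cube_cell N c) :: 'a \<Rightarrow> real)"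
    "(\<integral>z. indicator (cube_cell N c) z \<partial>(lborel :: 'a measure)) = 1 / real N ^ DIM('a)"
proof -
  have "(\<integral>z. indicator (cube_cell N c) z \<partial>(lborel :: 'a measure))
      = (\<integral>t. (indicator (cube_cell N c) (\<Sum>b\<in>Basis. t b *\<^sub>R b :: 'a) :: real) \<partial>PiM Basis (\<lambda>_. lborel))"
    by (subst lborel_eq, subst integral_distr) auto
  also have "\<dots> = 1 / real N ^ DIM('a)"
    unfolding prod_indicator_cell[symmetric] by (rule integrable_box(3)) (use assms in auto)
  finally show "(\<integral>z. indicator (cube_cell N c) z \<partial>(lborel :: 'a measure)) = 1 / real N ^ DIM('a)" .
  have "emeasure lborel (cube_cell N c :: 'a set) \<le> emeasure lborel (unit_cube :: 'a set)"
    by (intro emeasure_mono) (auto simp: cube_cell_def)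
  also have "\<dots> < \<infinity>" by (simp add: unit_cube_def emeasure_lborel_cbox_eq)
  finally show "integrable lborel (indicator (cube_cell N c) :: 'a \<Rightarrow> real)" by simp
qed

definition near :: "nat \<Rightarrow> ('a \<Rightarrow> nat) \<Rightarrow> ('a \<Rightarrow> nat) \<Rightarrow> bool" where
  "near q c c' \<longleftrightarrow> (\<forall>b\<in>Basis. c b \<le> c' b + q \<and> c' b \<le> c b + q)"

lemma card_near_le: "card {c \<in> PiE Basis (\<lambda>_. {..<N}). near q c c'} \<le> (2 * q + 1) ^ DIM('a)"
proof -
  have "{c \<in> PiE Basis (\<lambda>_. {..<N}). near q c c'} \<subseteq> PiE Basis (\<lambda>b. {c' b - q..c' b + q})"
    by (auto simp: near_def PiE_iff extensional_def)
  then have "card {c \<in> PiE Basis (\<lambda>_. {..<N}). near q c c'} \<le> card (PiE Basis (\<lambda>b. {c' b - q..c' b + q}))"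
    by (intro card_mono finite_PiE) auto
  also have "\<dots> = (\<Prod>b\<in>(Basis::'a set). Suc (c' b + q) - (c' b - q))" by (simp add: card_PiE)
  also have "\<dots> \<le> (\<Prod>b\<in>(Basis::'a set). 2 * q + 1)" by (intro prod_mono) auto
  finally show ?thesis by simp
qed

lemma cell_mass_cong: "(\<And>b. b \<in> Basis \<Longrightarrow> c b = c' b) \<Longrightarrow> cell_mass N c = cell_mass N c'"
  unfolding cell_mass_def cube_cell_def by simp

text \<open>The reconstruction bounds the value at \<open>z\<close> by the averages over the (k +
  1)^d cells of a window. Each of these is at most the Euclidean norm of all of them, which leads to
  a sum of squares and hence to \<open>\<theta>\<close> after integration.\<close>

lemma pointwise_sq_le:
  fixes W :: real
  assumes W: "1 \<le> W" and rec: "cell_reconstruction k W"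
    and N: "k < N" and c: "c \<in> PiE Basis (\<lambda>_. {..<N})" and z: "z \<in> cube_cell N c"
  shows "(F z)\<^sup>2 \<le> 2 * W ^ (2 * DIM('a)) * (\<Sum>c'\<in>{c' \<in> PiE Basis (\<lambda>_. {..<N}). near k c c'}. (real N ^ DIM('a) * cell_mass N c')\<^sup>2)
    + 2 * (DIM('a) * W ^ DIM('a) * (W * H * ((real k + 1) / N) powr e))\<^sup>2"
proof -
  let ?d = "DIM('a)"
  have N0: "real N > 0" using N by simp
  have zc: "z \<in> unit_cube" "\<And>b. b \<in> Basis \<Longrightarrow> cell_index N (z \<bullet> b) = int (c b)" using z by (auto simp: cube_cell_def)
  \<comment> \<open>The window starts at the cell of \<open>z\<close>, but is shifted back near the
    upper boundary so that its \<open>k + 1\<close> cells fit into the cube; it still contains that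
    cell.\<close>
  define r where "r b = min (c b) (N - 1 - k)" for b
  have cb: "c b < N" if "b \<in> Basis" for b using PiE_mem[OF c that] by simp
  have rk: "r b + k < N" and rc: "r b \<le> c b" "c b \<le> r b + k" if "b \<in> Basis" for b
    using N cb[OF that] by (auto simp: r_def)
  have zr: "z \<bullet> b \<in> {real (r b) / N..(real (r b) + real k + 1) / N}" if b: "b \<in> Basis" for b
  proof -
    have "z \<bullet> b \<in> unit_cell N (c b)" using zc b by (auto simp: unit_cell_def mem_unit_cube)
    then have "real (c b) / N \<le> z \<bullet> b" "z \<bullet> b \<le> (real (c b) + 1) / N" using unit_cell_bounds(2)[OF cb[OF b]] by auto
    moreover have "real (r b) / N \<le> real (c b) / N" "(real (c b) + 1) / N \<le> (real (r b) + real k + 1) / N"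
      using rc[OF b] by (auto intro!: divide_right_mono)
    ultimately show ?thesis by auto
  qed
  define \<delta> where "\<delta> = W * H * ((real k + 1) / N) powr e"
  have \<delta>: "0 \<le> \<delta>" using W H_nonneg by (simp add: \<delta>_def)
  have "\<exists>w. \<forall>b\<in>Basis. (\<Sum>i\<le>k. \<bar>w b i\<bar>) \<le> W \<and>
       (\<forall>\<phi> c H e M. \<phi> \<in> borel_measurable borel \<and> (\<forall>t\<in>{0..1}. \<bar>\<phi> t\<bar> \<le> M) \<and> 0 \<le> H \<and> 0 < e \<and> c 0 = \<phi> (z \<bullet> b) \<and>
          (\<forall>t\<in>{0..1}. \<bar>\<phi> t - (\<Sum>a\<le>k. c a * (t - z \<bullet> b) ^ a)\<bar> \<le> H * \<bar>t - z \<bullet> b\<bar> powr e) \<longrightarrow>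
          \<bar>\<phi> (z \<bullet> b) - (\<Sum>i\<le>k. w b i * (N * (\<integral>t. indicator (unit_cell N (r b + i)) t * \<phi> t \<partial>lborel)))\<bar>
            \<le> W * H * ((real k + 1) / N) powr e)"
    using rec[unfolded cell_reconstruction_def, rule_format, OF conjI, OF rk zr] by (intro bchoice ballI) blast
  then obtain w where w: "\<And>b. b \<in> Basis \<Longrightarrow> (\<Sum>i\<le>k. \<bar>w b i\<bar>) \<le> W" and
    wr: "\<And>b \<phi> c H e M. b \<in> Basis \<Longrightarrow> \<phi> \<in> borel_measurable borel \<and> (\<forall>t\<in>{0..1}. \<bar>\<phi> t\<bar> \<le> M) \<and> 0 \<le> H \<and> 0 < e \<and> c 0 = \<phi> (z \<bullet> b) \<and>
          (\<forall>t\<in>{0..1}. \<bar>\<phi> t - (\<Sum>a\<le>k. c a * (t - z \<bullet> b) ^ a)\<bar> \<le> H * \<bar>t - z \<bullet> b\<bar> powr e) \<Longrightarrow>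
          \<bar>\<phi> (z \<bullet> b) - (\<Sum>i\<le>k. w b i * (N * (\<integral>t. indicator (unit_cell N (r b + i)) t * \<phi> t \<partial>lborel)))\<bar>
            \<le> W * H * ((real k + 1) / N) powr e" by blast
  have rec': "\<bar>F y - (\<Sum>i\<le>k. w b i * (N * (\<integral>v. indicator (unit_cell N (r b + i)) v * F (coord_upd y b v) \<partial>lborel)))\<bar> \<le> \<delta>"
    if b: "b \<in> Basis" and y: "y \<in> unit_cube" "y \<bullet> b = z \<bullet> b" for b y
  proof -
    obtain a where a: "a 0 = F y" "\<forall>t\<in>{0..1}. \<bar>F (coord_upd y b t) - (\<Sum>i\<le>k. a i * (t - y \<bullet> b) ^ i)\<bar> \<le> H * \<bar>t - y \<bullet> b\<bar> powr e"
      using line[OF y(1) b] by blast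
    have "coord_upd y b (y \<bullet> b) = y" by (simp add: coord_upd_def)
    moreover have "(\<lambda>t. F (coord_upd y b t)) \<in> borel_measurable borel" unfolding coord_upd_def by measurable
    ultimately show ?thesis
      using wr[OF b, of "\<lambda>t. F (coord_upd y b t)" M H e a] a F_bound H_nonneg e_pos y(2) by (simp add: \<delta>_def)
  qed
  define A where "A i = real N ^ ?d * cell_mass N (\<lambda>b. r b + i b)" for i
  let ?P = "PiE (Basis::'a set) (\<lambda>_. {..k})"
  let ?R = "sqrt (\<Sum>i\<in>?P. (A i)\<^sup>2)"
  have appr: "\<bar>F z - (\<Sum>i\<in>?P. (\<Prod>b\<in>Basis. w b (i b)) * A i)\<bar> \<le> ?d * W ^ ?d * \<delta>"
    using box_mean_approx[OF finite_Basis order_refl zc(1) W \<delta> rk w rec'] unfolding box_mean_Basis A_def .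
  have AR: "\<bar>A i\<bar> \<le> ?R" if "i \<in> ?P" for i
  proof -
    have "(A i)\<^sup>2 \<le> (\<Sum>i\<in>?P. (A i)\<^sup>2)" using that by (intro member_le_sum) (auto intro: finite_PiE)
    then have "sqrt ((A i)\<^sup>2) \<le> ?R" by (rule real_sqrt_le_mono)
    then show ?thesis by simp
  qed
  have R0: "0 \<le> ?R" by (simp add: sum_nonneg)
  have "\<bar>\<Sum>i\<in>?P. (\<Prod>b\<in>Basis. w b (i b)) * A i\<bar> \<le> (\<Sum>i\<in>?P. \<bar>\<Prod>b\<in>Basis. w b (i b)\<bar> * ?R)"
    by (rule order_trans[OF sum_abs], rule sum_mono) (simp only: abs_mult, intro mult_left_mono AR, auto)
  also have "\<dots> \<le> W ^ ?d * ?R"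
    unfolding sum_distrib_right[symmetric] using abs_prod_sum_PiE_le[OF finite_Basis W w] R0
    by (intro mult_right_mono) auto
  finally have "\<bar>F z\<bar> \<le> W ^ ?d * ?R + ?d * W ^ ?d * \<delta>" using appr by linarith
  then have "(F z)\<^sup>2 \<le> (W ^ ?d * ?R + ?d * W ^ ?d * \<delta>)\<^sup>2" using R0 W \<delta> by (subst abs_le_square_iff[symmetric]) auto
  also have "\<dots> \<le> 2 * (W ^ ?d * ?R)\<^sup>2 + 2 * (?d * W ^ ?d * \<delta>)\<^sup>2"
    using sum_squares_bound[of "W ^ ?d * ?R" "?d * W ^ ?d * \<delta>"] by (simp add: power2_sum)
  also have "(W ^ ?d * ?R)\<^sup>2 = W ^ (2 * ?d) * (\<Sum>i\<in>?P. (A i)\<^sup>2)"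
    by (simp add: power_mult_distrib sum_nonneg power_mult[symmetric] mult.commute)
  finally have sq: "(F z)\<^sup>2 \<le> 2 * (W ^ (2 * ?d) * (\<Sum>i\<in>?P. (A i)\<^sup>2)) + 2 * (?d * W ^ ?d * \<delta>)\<^sup>2" .
  have "(\<Sum>i\<in>?P. (A i)\<^sup>2) \<le> (\<Sum>c'\<in>{c' \<in> PiE Basis (\<lambda>_. {..<N}). near k c c'}. (real N ^ ?d * cell_mass N c')\<^sup>2)"
  proof -
    define j where "j i = (\<lambda>b\<in>Basis. r b + i b)" for i :: "'a \<Rightarrow> nat"
    have inj: "inj_on j ?P"
    proof (rule inj_onI)
      fix i i' assume i: "i \<in> ?P" "i' \<in> ?P" "j i = j i'"
      show "i = i'"
      proof
        fix b show "i b = i' b"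
          using fun_cong[OF i(3), of b] PiE_arb[OF i(1), of b] PiE_arb[OF i(2), of b]
          by (cases "b \<in> Basis") (auto simp: j_def)
      qed
    qed
    have "(\<Sum>i\<in>?P. (A i)\<^sup>2) = (\<Sum>i\<in>?P. (real N ^ ?d * cell_mass N (j i))\<^sup>2)"
      unfolding A_def j_def by (intro sum.cong refl arg_cong2[where f="(^)"] arg_cong2[where f="(*)"] cell_mass_cong) auto
    also have "\<dots> = (\<Sum>c'\<in>j ` ?P. (real N ^ ?d * cell_mass N c')\<^sup>2)" by (simp add: sum.reindex[OF inj])
    also have "\<dots> \<le> (\<Sum>c'\<in>{c' \<in> PiE Basis (\<lambda>_. {..<N}). near k c c'}. (real N ^ ?d * cell_mass N c')\<^sup>2)"
    proof (rule sum_mono2)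
      show "j ` ?P \<subseteq> {c' \<in> PiE Basis (\<lambda>_. {..<N}). near k c c'}"
      proof (rule image_subsetI)
        fix i assume i: "i \<in> ?P"
        have *: "r b + i b < N \<and> c b \<le> (r b + i b) + k \<and> r b + i b \<le> c b + k" if "b \<in> Basis" for b
          using PiE_mem[OF i that] rk[OF that] rc[OF that] by auto
        then show "j i \<in> {c' \<in> PiE Basis (\<lambda>_. {..<N}). near k c c'}" by (auto simp: j_def near_def)
      qed
    qed (auto intro!: finite_Collect_conjI disjI1 simp: finite_PiE)
    finally show ?thesis .
  qed
  then have "2 * W ^ (2 * ?d) * (\<Sum>i\<in>?P. (A i)\<^sup>2)
      \<le> 2 * W ^ (2 * ?d) * (\<Sum>c'\<in>{c' \<in> PiE Basis (\<lambda>_. {..<N}). near k c c'}. (real N ^ ?d * cell_mass N c')\<^sup>2)"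
    using W by (intro mult_left_mono) auto
  then show ?thesis using sq unfolding \<delta>_def by linarith
qed

text \<open>The pointwise bound is integrated cell by cell. A squared average
  \<open>N ^ d * mass\<close> on a cell of volume \<open>N ^ - d\<close> leaves one factor
  \<open>N ^ d\<close>, and each cell is charged by at most (2 k + 1)^d others.\<close>

lemma L2_le_cell_masses_fine:
  fixes W :: real
  assumes W: "1 \<le> W" and rec: "cell_reconstruction k W"
    and N: "k < N"
  shows "(\<integral>z. indicator unit_cube z * (F z)\<^sup>2 \<partial>lborel)
    \<le> 2 * W ^ (2 * DIM('a)) * real ((2 * k + 1) ^ DIM('a)) * (real N ^ DIM('a) * (\<Sum>c\<in>PiE Basis (\<lambda>_. {..<N}). (cell_mass N c)\<^sup>2))
     + 2 * (DIM('a) * W ^ DIM('a) * (W * H * ((real k + 1) / N) powr e))\<^sup>2"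
proof -
  let ?d = "DIM('a)" and ?C = "PiE (Basis::'a set) (\<lambda>_. {..<N})"
  have N0: "real N > 0" using N by simp
  have finC: "finite ?C" by (intro finite_PiE) auto
  define D where "D = 2 * (?d * W ^ ?d * (W * H * ((real k + 1) / N) powr e))\<^sup>2"
  define S where "S c = (\<Sum>c'\<in>{c' \<in> ?C. near k c c'}. (real N ^ ?d * cell_mass N c')\<^sup>2)" for c
  define V where "V = 2 * W ^ (2 * ?d)"
  have V: "0 \<le> V" using W by (simp add: V_def)
  have cellN: "c b < N" if "c \<in> ?C" "b \<in> Basis" for c b using PiE_mem[OF that] by simp
  have D: "0 \<le> D" by (simp add: D_def)
  have S: "0 \<le> S c" for c by (simp add: S_def sum_nonneg)
  have "(\<integral>z. indicator unit_cube z * (F z)\<^sup>2 \<partial>lborel)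
      \<le> (\<integral>z. (\<Sum>c\<in>?C. (V * S c + D) * indicator (cube_cell N c) z) \<partial>lborel)"
  proof (rule integral_mono')
    show "integrable lborel (\<lambda>z. \<Sum>c\<in>?C. (V * S c + D) * indicator (cube_cell N c) z)"
      by (intro Bochner_Integration.integrable_sum integrable_mult_right cell_volume cellN)
    fix z :: 'a
    show "0 \<le> (\<Sum>c\<in>?C. (V * S c + D) * indicator (cube_cell N c) z)"
      using V D S by (intro sum_nonneg mult_nonneg_nonneg add_nonneg_nonneg) auto
    show "indicator unit_cube z * (F z)\<^sup>2 \<le> (\<Sum>c\<in>?C. (V * S c + D) * indicator (cube_cell N c) z)"
      unfolding unit_cube_split(1)[of N, OF le_less_trans[OF le0 N]] sum_distrib_right
    proof (rule sum_mono)
      fix c assume c: "c \<in> ?C"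
      show "indicator (cube_cell N c) z * (F z)\<^sup>2 \<le> (V * S c + D) * indicator (cube_cell N c) z"
        using pointwise_sq_le[OF W rec N c, of z] by (cases "z \<in> cube_cell N c") (auto simp: V_def S_def D_def)
    qed
  qed
  also have "\<dots> = (\<Sum>c\<in>?C. (V * S c + D) * (\<integral>z. indicator (cube_cell N c) z \<partial>(lborel :: 'a measure)))"
    by (subst Bochner_Integration.integral_sum) (auto intro!: integrable_mult_right cell_volume cellN)
  also have "\<dots> = (\<Sum>c\<in>?C. (V * S c + D) * (1 / real N ^ ?d))"
    by (intro sum.cong refl arg_cong2[where f="(*)"] cell_volume cellN)
  also have "\<dots> = V / real N ^ ?d * (\<Sum>c\<in>?C. S c) + D"
  proof -
    have "card ?C = N ^ ?d" by (simp add: card_PiE)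
    then have "(\<Sum>c\<in>?C. D * (1 / real N ^ ?d)) = D" using N0 by simp
    moreover have "(\<Sum>c\<in>?C. V * S c * (1 / real N ^ ?d)) = V / real N ^ ?d * (\<Sum>c\<in>?C. S c)"
      by (simp add: sum_distrib_left)
    ultimately show ?thesis by (simp only: distrib_right sum.distrib)
  qed
  \<comment> \<open>Count from the charged cell instead of from the cell containing
    \<open>z\<close>.\<close>
  also have "(\<Sum>c\<in>?C. S c) = (\<Sum>c'\<in>?C. \<Sum>c\<in>{c \<in> ?C. near k c c'}. (real N ^ ?d * cell_mass N c')\<^sup>2)"
    unfolding S_def by (rule sum.swap_restrict) (use finC in auto)
  also have "\<dots> = (\<Sum>c'\<in>?C. real (card {c \<in> ?C. near k c c'}) * (real N ^ ?d * cell_mass N c')\<^sup>2)" by simp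
  finally have fin: "(\<integral>z. indicator unit_cube z * (F z)\<^sup>2 \<partial>lborel)
      \<le> V / real N ^ ?d * (\<Sum>c'\<in>?C. real (card {c \<in> ?C. near k c c'}) * (real N ^ ?d * cell_mass N c')\<^sup>2) + D" .
  have "(\<Sum>c'\<in>?C. real (card {c \<in> ?C. near k c c'}) * (real N ^ ?d * cell_mass N c')\<^sup>2)
      \<le> (\<Sum>c'\<in>?C. real ((2 * k + 1) ^ ?d) * (real N ^ ?d * cell_mass N c')\<^sup>2)"
    by (intro sum_mono mult_right_mono of_nat_mono card_near_le) auto
  then have "V / real N ^ ?d * (\<Sum>c'\<in>?C. real (card {c \<in> ?C. near k c c'}) * (real N ^ ?d * cell_mass N c')\<^sup>2)
     \<le> V / real N ^ ?d * (\<Sum>c'\<in>?C. real ((2 * k + 1) ^ ?d) * (real N ^ ?d * cell_mass N c')\<^sup>2)"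
    using V by (intro mult_left_mono) auto
  also have "\<dots> = V * real ((2 * k + 1) ^ ?d) * (real N ^ ?d * (\<Sum>c\<in>?C. (cell_mass N c)\<^sup>2))"
    using N0 by (simp add: sum_distrib_left power_mult_distrib power2_eq_square mult_ac)
  finally show ?thesis using fin unfolding V_def D_def by linarith
qed

lemma L2_le_bound:
  "(\<integral>z. indicator unit_cube z * (F z)\<^sup>2 \<partial>(lborel :: 'a measure)) \<le> M\<^sup>2"
proof -
  have v: "integrable lborel (indicator unit_cube :: 'a \<Rightarrow> real)" by (simp add: unit_cube_def emeasure_lborel_cbox_eq)
  have m: "(\<integral>z. indicator unit_cube z \<partial>(lborel :: 'a measure)) = (1 :: real)"
  proof -
    have "measure lborel (unit_cube :: 'a set) = 1"
      unfolding unit_cube_def by (subst measure_lborel_cbox_eq) (auto simp: inner_sum_left_Basis)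
    then show ?thesis by simp
  qed
  have "(\<integral>z. indicator unit_cube z * (F z)\<^sup>2 \<partial>(lborel :: 'a measure)) \<le> (\<integral>z. M\<^sup>2 * indicator unit_cube z \<partial>(lborel :: 'a measure))"
  proof (rule integral_mono')
    show "integrable lborel (\<lambda>z :: 'a. M\<^sup>2 * indicator unit_cube z :: real)" using v by (rule integrable_mult_right)
  next
    fix z :: 'a
    show "0 \<le> M\<^sup>2 * indicator unit_cube z" by simp
    have "\<bar>F z\<bar> \<le> \<bar>M\<bar>" using F_bound[of z] by linarith
    then have "(F z)\<^sup>2 \<le> M\<^sup>2" by (simp only: abs_le_square_iff)
    then show "indicator unit_cube z * (F z)\<^sup>2 \<le> M\<^sup>2 * indicator unit_cube z" by (simp add: indicator_def)
  qed
  also have "\<dots> = M\<^sup>2" unfolding integral_mult_right_zero m by simp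
  finally show ?thesis .
qed

end

section \<open>Hoelder functions\<close>

lemma coord_upd_inner:
  assumes "b \<in> Basis" "b' \<in> Basis"
  shows "coord_upd x b t \<bullet> b' = (if b' = b then t else x \<bullet> b')"
  using assms by (auto simp: coord_upd_def inner_add_left inner_not_same_Basis)

lemma coord_upd_in_unit_cube: "x \<in> unit_cube \<Longrightarrow> b \<in> Basis \<Longrightarrow> t \<in> {0..1} \<Longrightarrow> coord_upd x b t \<in> unit_cube"
  by (auto simp: mem_unit_cube coord_upd_inner)

lemma coord_upd_self: "coord_upd x b (x \<bullet> b) = x"
  by (simp add: coord_upd_def)

lemma partial_derivs_line:
  fixes f :: "'a::euclidean_space \<Rightarrow> real"
  assumes D: "partial_derivs m f D" and x: "x \<in> unit_cube" and b: "b \<in> Basis"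
    and bs: "set bs \<subseteq> Basis" "length bs < m" and t: "t \<in> {0..1}"
  shows "((\<lambda>t. D bs (coord_upd x b t)) has_real_derivative D (b # bs) (coord_upd x b t)) (at t within {0..1})"
proof -
  let ?y = "coord_upd x b t"
  have y: "?y \<in> unit_cube" using coord_upd_in_unit_cube[OF x b t] .
  have yy: "?y + (t' - t) *\<^sub>R b = coord_upd x b t'" for t' by (simp add: coord_upd_def algebra_simps)
  have "((\<lambda>h. D bs (?y + h *\<^sub>R b)) has_real_derivative D (b # bs) ?y) (at 0 within {h. ?y + h *\<^sub>R b \<in> unit_cube})"
    using D y b bs unfolding partial_derivs_def by blast
  moreover have "{h. ?y + h *\<^sub>R b \<in> unit_cube} \<supseteq> (\<lambda>t'. t' - t) ` {0..1}"
    by (rule image_subsetI) (simp add: yy coord_upd_in_unit_cube[OF x b])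
  ultimately have "((\<lambda>h. D bs (?y + h *\<^sub>R b)) has_real_derivative D (b # bs) ?y) (at (t - t) within (\<lambda>t'. t' - t) ` {0..1})"
    by (auto intro: DERIV_subset)
  moreover have "((\<lambda>t'. t' - t) has_real_derivative 1) (at t within {0..1})" by (auto intro!: derivative_eq_intros)
  ultimately
  have "((\<lambda>h. D bs (?y + h *\<^sub>R b)) \<circ> (\<lambda>t'. t' - t) has_real_derivative D (b # bs) ?y * 1) (at t within {0..1})"
    by (rule DERIV_image_chain)
  then show ?thesis by (simp add: o_def yy)
qed

text \<open>For \<open>k > 0\<close> the remainder is estimated by subtracting the degree-k monomial
  with the derivative at the centre. The corrected derivative of order \<open>k\<close> vanishes
  there and is controlled by the Hoelder condition, so Taylor's theorem of order
  \<open>k - 1\<close> already yields the exponent \<open>s\<close>.\<close>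

lemma holder_line_taylor:
  fixes f :: "'a::euclidean_space \<Rightarrow> real"
  assumes f: "f \<in> holder_class s L" and s: "0 < s" and L: "0 < L" and x: "x \<in> unit_cube" and b: "b \<in> Basis"
  shows "\<exists>c. c 0 = f x \<and> (\<forall>t\<in>{0..1}. \<bar>f (coord_upd x b t) - (\<Sum>a\<le>nat \<lfloor>s\<rfloor>. c a * (t - x \<bullet> b) ^ a)\<bar> \<le> L * \<bar>t - x \<bullet> b\<bar> powr s)"
proof -
  define k where "k = nat \<lfloor>s\<rfloor>"
  have k: "of_int \<lfloor>s\<rfloor> = real k" using s by (simp add: k_def)
  have ks: "real k \<le> s" using k of_int_floor_le[of s] by simp
  from f obtain D where D: "partial_derivs k f D"
    and hold: "\<And>bs x x'. set bs \<subseteq> Basis \<Longrightarrow> length bs = k \<Longrightarrow> x \<in> unit_cube \<Longrightarrow> x' \<in> unit_cube \<Longrightarrow>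
      \<bar>D bs x - D bs x'\<bar> \<le> L * norm (x - x') powr (s - real k)"
    unfolding holder_class_def k k_def[symmetric] by blast
  have D0: "D [] z = f z" if "z \<in> unit_cube" for z using D that by (simp add: partial_derivs_def)
  define x0 where "x0 = x \<bullet> b"
  have x0: "x0 \<in> {0..1}" using x b by (simp add: x0_def mem_unit_cube)
  define g where "g a t = D (replicate a b) (coord_upd x b t)" for a t
  have gx0: "g 0 x0 = f x" using D0[OF x] by (simp add: g_def x0_def coord_upd_self)
  have g0: "g 0 t = f (coord_upd x b t)" if "t \<in> {0..1}" for t
    using D0[OF coord_upd_in_unit_cube[OF x b that]] by (simp add: g_def)
  have sub: "set (replicate a b) \<subseteq> Basis" for a using b by auto
  have dg: "(g a has_real_derivative g (Suc a) t) (at t within {0..1})" if "a < k" "t \<in> {0..1}" for a t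
    using partial_derivs_line[OF D x b sub, of a t] that by (simp add: g_def[abs_def])
  have hg: "\<bar>g k t - g k t'\<bar> \<le> L * \<bar>t - t'\<bar> powr (s - real k)" if "t \<in> {0..1}" "t' \<in> {0..1}" for t t'
  proof -
    have "coord_upd x b t - coord_upd x b t' = (t - t') *\<^sub>R b" by (simp add: coord_upd_def algebra_simps)
    then have "norm (coord_upd x b t - coord_upd x b t') = \<bar>t - t'\<bar>" using b by simp
    then show ?thesis
      using hold[OF sub _ coord_upd_in_unit_cube[OF x b that(1)] coord_upd_in_unit_cube[OF x b that(2)], of k]
      by (simp add: g_def)
  qed
  define c where "c a = g a x0 / fact a" for a
  have "\<bar>f (coord_upd x b t) - (\<Sum>a\<le>k. c a * (t - x0) ^ a)\<bar> \<le> L * \<bar>t - x0\<bar> powr s" if t: "t \<in> {0..1}" for t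
  proof (cases k)
    case 0
    then show ?thesis using hg[OF t x0] g0[OF t] by (simp add: c_def)
  next
    case (Suc n)
    \<comment> \<open>The successive derivatives of the restriction to the line, minus those of its
      top-order Taylor monomial.\<close>
    define G where "G i u = (if i \<le> k then g i u - g k x0 * (u - x0) ^ (k - i) / fact (k - i) else 0)" for i u
    have cs: "closed_segment x0 t \<subseteq> {0..1}" using x0 t by (intro closed_segment_subset) auto
    have dG: "(G i has_field_derivative G (Suc i) u) (at u within closed_segment x0 t)"
      if "u \<in> closed_segment x0 t" "i \<le> n" for u i
    proof -
      have i: "i < k" "k - i = Suc (k - Suc i)" using that Suc by auto
      have "((\<lambda>u. (u - x0) ^ Suc (k - Suc i)) has_real_derivative (1 + real (k - Suc i)) * (1 * (u - x0) ^ (k - Suc i))) (at u within closed_segment x0 t)"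
        by (rule DERIV_power_Suc) (auto intro!: derivative_eq_intros)
      then have "((\<lambda>u. g k x0 / fact (k - i) * (u - x0) ^ (k - i)) has_real_derivative
          g k x0 / fact (k - i) * ((1 + real (k - Suc i)) * (1 * (u - x0) ^ (k - Suc i)))) (at u within closed_segment x0 t)"
        unfolding i(2)[symmetric] by (rule DERIV_cmult)
      moreover have "g k x0 / fact (k - i) * ((1 + real (k - Suc i)) * (1 * (u - x0) ^ (k - Suc i)))
          = g k x0 * (u - x0) ^ (k - Suc i) / fact (k - Suc i)"
      proof -
        have "g / ((1 + q) * F) * ((1 + q) * (1 * P)) = g * P / F" if "1 + q \<noteq> 0" for g q F P :: real
          using that by simp
        then show ?thesis unfolding i(2) fact_Suc of_nat_Suc by simp
      qed
      moreover have "(g i has_real_derivative g (Suc i) u) (at u within closed_segment x0 t)"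
        using DERIV_subset[OF dg[OF i(1)] cs] that(1) cs by blast
      ultimately have "((\<lambda>u. g i u - g k x0 / fact (k - i) * (u - x0) ^ (k - i)) has_real_derivative
          g (Suc i) u - g k x0 * (u - x0) ^ (k - Suc i) / fact (k - Suc i)) (at u within closed_segment x0 t)"
        by (auto intro: DERIV_diff)
      then show ?thesis using i(1) by (simp add: G_def[abs_def] Suc_le_eq)
    qed
    have BG: "norm (G (Suc n) u) \<le> L * \<bar>t - x0\<bar> powr (s - real k)" if u: "u \<in> closed_segment x0 t" for u
    proof -
      have "\<bar>u - x0\<bar> \<le> \<bar>t - x0\<bar>" using u by (auto simp: closed_segment_eq_real_ivl split: if_splits)
      then have "L * \<bar>u - x0\<bar> powr (s - real k) \<le> L * \<bar>t - x0\<bar> powr (s - real k)"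
        using L ks by (intro mult_left_mono powr_mono2) auto
      moreover have "G (Suc n) u = g k u - g k x0" by (simp add: G_def Suc)
      ultimately show ?thesis using hg[of u x0] u cs x0 by force
    qed
    have "norm (G 0 t - (\<Sum>i\<le>n. G i x0 * (t - x0) ^ i / fact i)) \<le> L * \<bar>t - x0\<bar> powr (s - real k) * norm (t - x0) ^ Suc n / fact n"
      by (rule field_Taylor[OF _ dG BG]) auto
    also have "\<dots> \<le> L * \<bar>t - x0\<bar> powr (s - real k) * norm (t - x0) ^ Suc n / 1"
      using L by (intro divide_left_mono) (auto simp: fact_ge_1)
    also have "\<dots> = L * \<bar>t - x0\<bar> powr s"
    proof (cases "t = x0")
      case False
      then have "norm (t - x0) ^ Suc n = \<bar>t - x0\<bar> powr real k" by (subst powr_realpow) (auto simp: Suc)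
      then show ?thesis by (simp add: powr_add[symmetric])
    qed (simp add: Suc)
    also have "G 0 t - (\<Sum>i\<le>n. G i x0 * (t - x0) ^ i / fact i) = g 0 t - (\<Sum>a\<le>k. c a * (t - x0) ^ a)"
    proof -
      have "(\<Sum>i\<le>n. G i x0 * (t - x0) ^ i / fact i) = (\<Sum>i\<le>n. c i * (t - x0) ^ i)"
        by (intro sum.cong refl) (auto simp: G_def c_def Suc)
      then show ?thesis by (simp add: Suc G_def c_def)
    qed
    finally show ?thesis using g0[OF t] by simp
  qed
  then show ?thesis
    using gx0 by (intro exI[of _ c]) (auto simp: c_def k_def x0_def)
qed

text \<open>For \<open>s < 1\<close> this is the Hoelder condition itself; for
  \<open>s \<ge> 1\<close> it is the mean value theorem with the bound on first derivatives.\<close>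

lemma holder_line_modulus:
  fixes f :: "'a::euclidean_space \<Rightarrow> real"
  assumes f: "f \<in> holder_class s L" and s: "0 < s" and L: "0 < L" and x: "x \<in> unit_cube" and b: "b \<in> Basis" and t: "t \<in> {0..1}"
  shows "\<bar>f (coord_upd x b t) - f x\<bar> \<le> L * \<bar>t - x \<bullet> b\<bar> powr (min s 1)"
proof -
  define k where "k = nat \<lfloor>s\<rfloor>"
  have k: "of_int \<lfloor>s\<rfloor> = real k" using s by (simp add: k_def)
  from f have "\<exists>D. partial_derivs k f D \<and>
     (\<forall>bs. set bs \<subseteq> Basis \<and> length bs = k \<longrightarrow>
        (\<forall>x\<in>unit_cube. \<forall>x'\<in>unit_cube. \<bar>D bs x - D bs x'\<bar> \<le> L * norm (x - x') powr (s - real k))) \<and>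
     (\<forall>k\<in>{1..k}. \<forall>bs. set bs \<subseteq> Basis \<and> length bs = k \<longrightarrow> (\<forall>x\<in>unit_cube. \<bar>D bs x\<bar> \<le> L))"
    unfolding holder_class_def k k_def[symmetric] mem_Collect_eq .
  then obtain D where D: "partial_derivs k f D"
    and hold': "\<forall>bs. set bs \<subseteq> Basis \<and> length bs = k \<longrightarrow>
        (\<forall>x\<in>unit_cube. \<forall>x'\<in>unit_cube. \<bar>D bs x - D bs x'\<bar> \<le> L * norm (x - x') powr (s - real k))"
    and bound': "\<forall>k\<in>{1..k}. \<forall>bs. set bs \<subseteq> Basis \<and> length bs = k \<longrightarrow> (\<forall>x\<in>unit_cube. \<bar>D bs x\<bar> \<le> L)"
    by (elim exE conjE)
  have hold: "\<bar>D bs x - D bs x'\<bar> \<le> L * norm (x - x') powr (s - real k)"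
    if "set bs \<subseteq> Basis" "length bs = k" "x \<in> unit_cube" "x' \<in> unit_cube" for bs x x'
    using hold' that by blast
  have bound: "\<bar>D bs x\<bar> \<le> L" if "j \<in> {1..k}" "set bs \<subseteq> Basis" "length bs = j" "x \<in> unit_cube" for j bs x
    using bspec[OF bound' that(1)] that by blast
  have D0: "D [] z = f z" if "z \<in> unit_cube" for z using D that by (simp add: partial_derivs_def)
  have y: "coord_upd x b t \<in> unit_cube" using coord_upd_in_unit_cube[OF x b t] .
  have nb: "norm (coord_upd x b t - x) = \<bar>t - x \<bullet> b\<bar>" using b by (simp add: coord_upd_def)
  show ?thesis
  proof (cases "k = 0")
    case True
    then have "s < 1" using k floor_less_iff[of s 1] by simp
    then show ?thesis using hold[of "[]" "coord_upd x b t" x] True y x nb by (simp add: D0)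
  next
    case False
    then have s1: "1 \<le> s" using k by linarith
    have xb: "x \<bullet> b \<in> {0..1}" using x b by (simp add: mem_unit_cube)
    have "norm (D [] (coord_upd x b t) - D [] (coord_upd x b (x \<bullet> b))) \<le> L * norm (t - x \<bullet> b)"
    proof (rule field_differentiable_bound[where S = "{0..1}" and f = "\<lambda>t. D [] (coord_upd x b t)" and f' = "\<lambda>t. D [b] (coord_upd x b t)"])
      fix u :: real assume u: "u \<in> {0..1}"
      show "((\<lambda>t. D [] (coord_upd x b t)) has_field_derivative D [b] (coord_upd x b u)) (at u within {0..1})"
        using partial_derivs_line[OF D x b _ _ u, of "[]"] False by simp
      show "norm (D [b] (coord_upd x b u)) \<le> L"
        using bound[of 1 "[b]"] b False coord_upd_in_unit_cube[OF x b u] by simp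
    qed (use t xb in auto)
    then show ?thesis using s1 y x by (simp add: D0 coord_upd_self)
  qed
qed

text \<open>Move from \<open>x\<close> to \<open>y\<close> by changing one coordinate at a time; the
  intermediate points stay in the cube because it is a product.\<close>

lemma holder_modulus:
  fixes f :: "'a::euclidean_space \<Rightarrow> real"
  assumes f: "f \<in> holder_class s L" and s: "0 < s" and L: "0 < L" and x: "x \<in> unit_cube" and y: "y \<in> unit_cube"
  shows "\<bar>f y - f x\<bar> \<le> (\<Sum>b\<in>Basis. L * \<bar>y \<bullet> b - x \<bullet> b\<bar> powr (min s 1))"
proof -
  have "\<bar>f (mix_point S x (\<lambda>b. y \<bullet> b)) - f x\<bar> \<le> (\<Sum>b\<in>S. L * \<bar>y \<bullet> b - x \<bullet> b\<bar> powr (min s 1))"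
    if "finite S" "S \<subseteq> Basis" for S
    using that
  proof (induction S rule: finite_induct)
    case empty
    have "mix_point {} x (\<lambda>b. y \<bullet> b) = x" by (rule euclidean_eqI) (simp add: mix_point_inner)
    then show ?case by simp
  next
    case (insert b S)
    let ?m = "mix_point S x (\<lambda>b. y \<bullet> b)"
    have b: "b \<in> Basis" using insert by auto
    have mc: "?m \<in> unit_cube" using x y by (auto simp: mem_unit_cube mix_point_inner)
    have mb: "?m \<bullet> b = x \<bullet> b" using b insert.hyps by (simp add: mix_point_inner)
    have upd: "mix_point (insert b S) x (\<lambda>b. y \<bullet> b) = coord_upd ?m b (y \<bullet> b)"
      by (rule euclidean_eqI) (use b in \<open>auto simp: mix_point_inner coord_upd_inner\<close>)
    have yb: "y \<bullet> b \<in> {0..1}" using y b by (simp add: mem_unit_cube)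
    have "\<bar>f (coord_upd ?m b (y \<bullet> b)) - f ?m\<bar> \<le> L * \<bar>y \<bullet> b - x \<bullet> b\<bar> powr (min s 1)"
      using holder_line_modulus[OF f s L mc b yb] unfolding mb .
    then show ?case using insert unfolding upd by simp
  qed
  from this[OF finite_Basis order_refl]
  have "\<bar>f (mix_point Basis x (\<lambda>b. y \<bullet> b)) - f x\<bar> \<le> (\<Sum>b\<in>Basis. L * \<bar>y \<bullet> b - x \<bullet> b\<bar> powr (min s 1))" .
  moreover have "mix_point Basis x (\<lambda>b. y \<bullet> b) = y" by (rule euclidean_eqI) (simp add: mix_point_inner)
  ultimately show ?thesis by simp
qed

lemma holder_oscillation:
  fixes f :: "'a::euclidean_space \<Rightarrow> real"
  assumes f: "f \<in> holder_class s L" and s: "0 < s" and L: "0 < L" and x: "x \<in> unit_cube" and y: "y \<in> unit_cube"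
  shows "\<bar>f y - f x\<bar> \<le> L * DIM('a)"
proof -
  have "\<bar>y \<bullet> b - x \<bullet> b\<bar> powr (min s 1) \<le> 1" if "b \<in> Basis" for b
  proof -
    have "\<bar>y \<bullet> b - x \<bullet> b\<bar> \<le> 1" using x y that unfolding mem_unit_cube by (smt (verit))
    then have "\<bar>y \<bullet> b - x \<bullet> b\<bar> powr (min s 1) \<le> 1 powr (min s 1)" using s by (intro powr_mono2) auto
    then show ?thesis by simp
  qed
  then have "(\<Sum>b\<in>Basis. L * \<bar>y \<bullet> b - x \<bullet> b\<bar> powr (min s 1)) \<le> (\<Sum>b\<in>(Basis :: 'a set). L * 1)"
    using L by (intro sum_mono mult_left_mono) auto
  then show ?thesis using holder_modulus[OF f s L x y] by (simp add: mult.commute)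
qed

lemma holder_continuous_on:
  fixes f :: "'a::euclidean_space \<Rightarrow> real"
  assumes f: "f \<in> holder_class s L" and s: "0 < s" and L: "0 < L"
  shows "continuous_on unit_cube f"
  unfolding continuous_on_def
proof
  fix x :: 'a assume x: "x \<in> unit_cube"
  let ?g = "\<lambda>y. \<Sum>b\<in>Basis. L * \<bar>y \<bullet> b - x \<bullet> b\<bar> powr (min s 1)"
  have "(?g \<longlongrightarrow> (\<Sum>b\<in>(Basis::'a set). L * \<bar>x \<bullet> b - x \<bullet> b\<bar> powr (min s 1))) (at x within unit_cube)"
  proof (intro tendsto_sum tendsto_mult tendsto_const tendsto_powr')
    show "((\<lambda>y. \<bar>y \<bullet> b - x \<bullet> b\<bar>) \<longlongrightarrow> \<bar>x \<bullet> b - x \<bullet> b\<bar>) (at x within unit_cube)" for b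
      by (intro tendsto_rabs tendsto_diff tendsto_inner tendsto_const tendsto_ident_at)
  qed (use s in auto)
  then have "(?g \<longlongrightarrow> 0) (at x within unit_cube)" by simp
  then have "((\<lambda>y. f y - f x) \<longlongrightarrow> 0) (at x within unit_cube)"
  proof (rule Lim_null_comparison[rotated])
    show "\<forall>\<^sub>F y in at x within unit_cube. norm (f y - f x) \<le> ?g y"
      unfolding eventually_at_filter using holder_modulus[OF f s L x] by (auto intro!: always_eventually)
  qed
  then show "(f \<longlongrightarrow> f x) (at x within unit_cube)" by (simp add: LIM_zero_iff)
qed

text \<open>The bias bound, uniform in \<open>N\<close> and in both functions. The difference is cut
  off to zero outside the cube, which makes it a globally bounded measurable function, and its
  Taylor error on lines is at most twice that of each function.\<close>

lemma holder_difference_L2_le: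
  fixes s L M :: real
  assumes s: "0 < s" and L: "0 < L" and M: "0 \<le> M"
  shows "\<exists>C>0. \<forall>N\<ge>1. \<forall>f\<in>holder_class s L. \<forall>g\<in>holder_class s L.
    (\<forall>z\<in>unit_cube. \<bar>f z - g z\<bar> \<le> M) \<longrightarrow>
    (\<integral>z. indicator unit_cube z * (f z - g z)\<^sup>2 \<partial>lborel)
      \<le> C * (real N ^ DIM('a) * (\<Sum>c\<in>PiE Basis (\<lambda>_. {..<N}). (\<integral>z. indicator (cube_cell N c) z * (f z - g z) \<partial>lborel)\<^sup>2)
            + real N powr (- 2 * s) :: real) \<and>
     (\<lambda>z. indicator unit_cube z * (f z - g z)) \<in> borel_measurable (borel :: 'a::euclidean_space measure)"
proof -
  define k where "k = nat \<lfloor>s\<rfloor>"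
  let ?d = "DIM('a)"
  obtain W where W: "1 \<le> W" and rec: "cell_reconstruction k W"
    using cell_reconstruction_exists by blast
  define C1 where "C1 = 2 * W ^ (2 * ?d) * real ((2 * k + 1) ^ ?d)"
  define C2 where "C2 = 2 * (?d * W ^ ?d * (W * (2 * L) * (real k + 1) powr s))\<^sup>2"
  define C3 where "C3 = M\<^sup>2 * (real k + 1) powr (2 * s)"
  have C: "0 < C1" "0 \<le> C2" "0 \<le> C3" using W by (auto simp: C1_def C2_def C3_def)
  have main: "(\<integral>z. indicator unit_cube z * (f z - g z)\<^sup>2 \<partial>lborel)
      \<le> (C1 + C2 + C3) * (real N ^ ?d * (\<Sum>c\<in>PiE Basis (\<lambda>_. {..<N}). (\<integral>z. indicator (cube_cell N c) z * (f z - g z) \<partial>lborel)\<^sup>2)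
            + real N powr (- 2 * s))"
    and meas: "(\<lambda>z. indicator unit_cube z * (f z - g z)) \<in> borel_measurable (borel :: 'a measure)"
    if N: "1 \<le> N" and f: "f \<in> holder_class s L" and g: "g \<in> holder_class s L"
      and bd: "\<And>z. z \<in> unit_cube \<Longrightarrow> \<bar>f z - g z\<bar> \<le> M" for N and f g :: "'a \<Rightarrow> real"
  proof -
    define F where "F z = indicator unit_cube z * (f z - g z)" for z
    have cont: "continuous_on unit_cube (\<lambda>z. f z - g z)"
      by (intro continuous_on_diff holder_continuous_on[OF f s L] holder_continuous_on[OF g s L])
    have Fm: "F \<in> borel_measurable borel"
      using borel_measurable_continuous_on_indicator[OF _ cont] by (simp add: F_def[abs_def])
    then show "(\<lambda>z. indicator unit_cube z * (f z - g z)) \<in> borel_measurable (borel :: 'a measure)"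
      by (simp add: F_def[abs_def])
    interpret line_approx F k "2 * L" s M
    proof
      show "F \<in> borel_measurable borel" by (rule Fm)
      show "\<bar>F x\<bar> \<le> M" for x using bd[of x] M by (auto simp: F_def indicator_def)
      show "0 \<le> 2 * L" "0 < s" using L s by auto
      fix x b :: 'a assume x: "x \<in> unit_cube" and b: "b \<in> Basis"
      obtain c where c: "c 0 = f x" "\<And>t. t \<in> {0..1} \<Longrightarrow>
          \<bar>f (coord_upd x b t) - (\<Sum>a\<le>k. c a * (t - x \<bullet> b) ^ a)\<bar> \<le> L * \<bar>t - x \<bullet> b\<bar> powr s"
        using holder_line_taylor[OF f s L x b] unfolding k_def by blast
      obtain c' where c': "c' 0 = g x" "\<And>t. t \<in> {0..1} \<Longrightarrow>
          \<bar>g (coord_upd x b t) - (\<Sum>a\<le>k. c' a * (t - x \<bullet> b) ^ a)\<bar> \<le> L * \<bar>t - x \<bullet> b\<bar> powr s"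
        using holder_line_taylor[OF g s L x b] unfolding k_def by blast
      show "\<exists>c. c 0 = F x \<and> (\<forall>t\<in>{0..1}. \<bar>F (coord_upd x b t) - (\<Sum>a\<le>k. c a * (t - x \<bullet> b) ^ a)\<bar>
          \<le> 2 * L * \<bar>t - x \<bullet> b\<bar> powr s)"
      proof (intro exI[of _ "\<lambda>a. c a - c' a"] conjI ballI)
        show "c 0 - c' 0 = F x" using x by (simp add: F_def c(1) c'(1))
        fix t :: real assume t: "t \<in> {0..1}"
        have "F (coord_upd x b t) = f (coord_upd x b t) - g (coord_upd x b t)"
          using coord_upd_in_unit_cube[OF x b t] by (simp add: F_def)
        then show "\<bar>F (coord_upd x b t) - (\<Sum>a\<le>k. (c a - c' a) * (t - x \<bullet> b) ^ a)\<bar> \<le> 2 * L * \<bar>t - x \<bullet> b\<bar> powr s"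
          using c(2)[OF t] c'(2)[OF t] by (simp add: left_diff_distrib sum_subtractf)
      qed
    qed
    have sq: "indicator unit_cube z * (F z)\<^sup>2 = indicator unit_cube z * (f z - g z)\<^sup>2" for z
      by (simp add: F_def indicator_def)
    have cm: "cell_mass N c = (\<integral>z. indicator (cube_cell N c) z * (f z - g z) \<partial>lborel)" for c
      unfolding cell_mass_def
      by (intro Bochner_Integration.integral_cong refl) (auto simp: F_def cube_cell_def indicator_def)
    define S where "S = real N ^ ?d * (\<Sum>c\<in>PiE Basis (\<lambda>_. {..<N}). (cell_mass N c)\<^sup>2)"
    have S: "0 \<le> S" by (simp add: S_def sum_nonneg)
    define T where "T = real N powr (- 2 * s)"
    have T: "0 \<le> T" by (simp add: T_def)
    have N0: "real N > 0" using N by simp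
    have T_eq: "(((real k + 1) / N) powr s)\<^sup>2 = (real k + 1) powr (2 * s) * T"
    proof -
      have "(((real k + 1) / N) powr s)\<^sup>2 = ((real k + 1) / N) powr (2 * s)"
        by (simp add: power2_eq_square powr_add[symmetric])
      also have "\<dots> = (real k + 1) powr (2 * s) * T"
        using N0 by (simp add: powr_divide T_def powr_minus_divide)
      finally show ?thesis .
    qed
    have "(\<integral>z. indicator unit_cube z * (F z)\<^sup>2 \<partial>lborel) \<le> C1 * S + (C2 + C3) * T"
    proof (cases "k < N")
      case True
      have "(\<integral>z. indicator unit_cube z * (F z)\<^sup>2 \<partial>lborel)
          \<le> C1 * S + 2 * (?d * W ^ ?d * (W * (2 * L) * ((real k + 1) / N) powr s))\<^sup>2"
        unfolding C1_def S_def by (rule L2_le_cell_masses_fine[OF W rec True])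
      also have "2 * (?d * W ^ ?d * (W * (2 * L) * ((real k + 1) / N) powr s))\<^sup>2 = C2 * T"
      proof -
        have "((real k + 1) powr s)\<^sup>2 = (real k + 1) powr (2 * s)"
          by (simp add: power2_eq_square powr_add[symmetric])
        then show ?thesis unfolding C2_def power_mult_distrib T_eq by simp
      qed
      finally show ?thesis using mult_nonneg_nonneg[OF C(3) T] by (simp add: distrib_right)
    next
      case False
      \<comment> \<open>No window of \<open>k + 1\<close> cells fits, but then \<open>N\<close> is
        at most \<open>k\<close>, so \<open>real N powr (- 2 * s)\<close> is bounded below and the
        trivial bound on the difference is absorbed by the constant.\<close>
      have "1 \<le> ((real k + 1) / N) powr (2 * s)"
        using False N s by (intro ge_one_powr_ge_zero) (auto simp: field_simps)
      also have "\<dots> = (real k + 1) powr (2 * s) * T"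
        using N0 by (simp add: powr_divide T_def powr_minus_divide)
      finally have "M\<^sup>2 * 1 \<le> M\<^sup>2 * ((real k + 1) powr (2 * s) * T)" by (intro mult_left_mono) auto
      then have "M\<^sup>2 \<le> C3 * T" by (simp add: C3_def mult.assoc)
      then show ?thesis
        using L2_le_bound mult_nonneg_nonneg[OF C(2) T] mult_nonneg_nonneg[OF less_imp_le[OF C(1)] S]
        by (simp add: distrib_right)
    qed
    also have "\<dots> \<le> (C1 + C2 + C3) * (S + T)"
    proof -
      have "C1 * S + (C2 + C3) * T \<le> C1 * S + (C2 + C3) * T + (C1 * T + (C2 + C3) * S)"
        using C S T by simp
      also have "\<dots> = (C1 + C2 + C3) * (S + T)" by (simp add: algebra_simps)
      finally show ?thesis .
    qed
    finally show "(\<integral>z. indicator unit_cube z * (f z - g z)\<^sup>2 \<partial>lborel)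
      \<le> (C1 + C2 + C3) * (real N ^ ?d * (\<Sum>c\<in>PiE Basis (\<lambda>_. {..<N}). (\<integral>z. indicator (cube_cell N c) z * (f z - g z) \<partial>lborel)\<^sup>2)
            + real N powr (- 2 * s))"
      unfolding sq S_def T_def cm .
  qed
  show ?thesis
    using C main meas by (intro exI[of _ "C1 + C2 + C3"]) auto
qed

text \<open>Events of the sample are covered by boxes of prescribed labels, so \<open>S\<close>
  itself may be non-measurable. Since the labelled regions carry all mass, samples outside every box
  form a null set that can be added to the cover.\<close>

lemma iid_sample_bridge:
  fixes P :: "'x measure" and K :: "'x \<Rightarrow> 'c"
  assumes P: "prob_space P" and C: "finite C" and I: "finite I"
    and Q: "\<And>c. c \<in> C \<Longrightarrow> {x \<in> G. K x = c} \<in> sets P" and one: "(\<Sum>c\<in>C. measure P {x \<in> G. K x = c}) = 1"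
    and S: "\<And>X. X \<in> S \<Longrightarrow> (\<And>i. i \<in> I \<Longrightarrow> X i \<in> G) \<Longrightarrow> \<Phi> (\<lambda>i\<in>I. K (X i))"
  shows "\<exists>T\<in>sets (PiM I (\<lambda>_. P)). S \<inter> space (PiM I (\<lambda>_. P)) \<subseteq> T \<and>
     emeasure (PiM I (\<lambda>_. P)) T \<le> ennreal (fexp (\<lambda>c. measure P {x \<in> G. K x = c}) C I (\<lambda>w. of_bool (\<Phi> w)))"
proof -
  interpret P: prob_space P by fact
  interpret PI: prob_space "PiM I (\<lambda>_. P)" by (rule prob_space_PiM) (rule P)
  let ?M = "PiM I (\<lambda>_. P)" and ?W = "PiE I (\<lambda>_. C)"
  define q where "q c = measure P {x \<in> G. K x = c}" for c
  define Box where "Box w = PiE I (\<lambda>i. {x \<in> G. K x = w i})" for w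
  have finW: "finite ?W" using C I by (intro finite_PiE) auto
  have Box: "Box w \<in> sets ?M" "measure ?M (Box w) = (\<Prod>i\<in>I. q (w i))" if "w \<in> ?W" for w
  proof -
    have *: "{x \<in> G. K x = w i} \<in> sets P" if "i \<in> I" for i using Q PiE_mem[OF \<open>w \<in> ?W\<close> that] by blast
    show "Box w \<in> sets ?M" unfolding Box_def using I * by (intro sets_PiM_I_finite) auto
    show "measure ?M (Box w) = (\<Prod>i\<in>I. q (w i))"
    proof -
      interpret PP: product_prob_space "\<lambda>_. P" by standard
      interpret FP: finite_product_prob_space "\<lambda>_. P" I using I by unfold_locales
      show ?thesis unfolding Box_def q_def using * by (intro FP.finite_measure_PiM_emb)
    qed
  qed
  have disj: "disjoint_family_on Box ?W"
  proof (unfold disjoint_family_on_def, intro ballI impI)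
    fix w w' assume w: "w \<in> ?W" "w' \<in> ?W" "w \<noteq> w'"
    show "Box w \<inter> Box w' = {}"
    proof (rule ccontr)
      assume "Box w \<inter> Box w' \<noteq> {}"
      then obtain X where "X \<in> Box w" "X \<in> Box w'" by blast
      then have "w i = w' i" if "i \<in> I" for i using that by (auto simp: Box_def PiE_iff)
      then have "w = w'" using w(1,2) by (auto intro: PiE_ext)
      then show False using w(3) by simp
    qed
  qed
  define V where "V = {w \<in> ?W. \<Phi> w}"
  have V: "V \<subseteq> ?W" by (auto simp: V_def)
  have mU: "measure ?M (\<Union>w\<in>V. Box w) = fexp q C I (\<lambda>w. of_bool (\<Phi> w))"
  proof -
    have "measure ?M (\<Union>w\<in>V. Box w) = (\<Sum>w\<in>V. measure ?M (Box w))"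
      using Box(1) V finite_subset[OF V finW] disjoint_family_on_mono[OF V disj]
      by (intro PI.finite_measure_finite_Union) auto
    also have "\<dots> = (\<Sum>w\<in>?W. (\<Prod>i\<in>I. q (w i)) * of_bool (\<Phi> w))"
      using finW V by (intro sum.mono_neutral_cong_left) (auto simp: V_def Box(2))
    finally show ?thesis by (simp add: fexp_def)
  qed
  have all: "measure ?M (\<Union>w\<in>?W. Box w) = 1"
  proof -
    have "measure ?M (\<Union>w\<in>?W. Box w) = (\<Sum>w\<in>?W. measure ?M (Box w))"
      using Box(1) finW disj by (intro PI.finite_measure_finite_Union) auto
    also have "\<dots> = (\<Sum>w\<in>?W. \<Prod>i\<in>I. q (w i))" by (intro sum.cong refl Box)
    also have "\<dots> = (\<Prod>i\<in>I. \<Sum>c\<in>C. q c)" using prod_sum_PiE[of I "\<lambda>_. C" "\<lambda>_. q"] I C by simp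
    also have "\<dots> = 1" using one by (simp add: q_def)
    finally show ?thesis .
  qed
  have sU: "(\<Union>w\<in>?W. Box w) \<in> sets ?M" "(\<Union>w\<in>V. Box w) \<in> sets ?M"
    using Box(1) finW V by (auto intro!: sets.finite_UN intro: finite_subset)
  \<comment> \<open>Samples without labels are put into the cover because nothing is known about the
    test there.\<close>
  define T where "T = (space ?M - (\<Union>w\<in>?W. Box w)) \<union> (\<Union>w\<in>V. Box w)"
  have "T \<in> sets ?M" unfolding T_def using sU by auto
  moreover have "S \<inter> space ?M \<subseteq> T"
  proof
    fix X assume X: "X \<in> S \<inter> space ?M"
    show "X \<in> T"
    proof (cases "X \<in> (\<Union>w\<in>?W. Box w)")
      case False
      then show ?thesis using X by (auto simp: T_def)
    next
      case True
      then obtain w where w: "w \<in> ?W" "X \<in> Box w" by blast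
      have XG: "X i \<in> G" "K (X i) = w i" if "i \<in> I" for i using w(2) that by (auto simp: Box_def PiE_iff)
      have "(\<lambda>i\<in>I. K (X i)) = w" using XG(2) PiE_arb[OF w(1)] by (auto simp: fun_eq_iff restrict_def)
      then have "\<Phi> w" using S[of X] X XG(1) by auto
      then show ?thesis using w by (auto simp: T_def V_def)
    qed
  qed
  moreover have "emeasure ?M T \<le> ennreal (fexp q C I (\<lambda>w. of_bool (\<Phi> w)))"
  proof -
    have "measure ?M T \<le> measure ?M (space ?M - (\<Union>w\<in>?W. Box w)) + measure ?M (\<Union>w\<in>V. Box w)"
      unfolding T_def using sU by (intro measure_Un_le) auto
    also have "measure ?M (space ?M - (\<Union>w\<in>?W. Box w)) = 0"
      using PI.prob_compl[OF sU(1)] all by simp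
    finally show ?thesis unfolding PI.emeasure_eq_measure mU by (intro ennreal_leI) simp
  qed
  ultimately show ?thesis unfolding q_def by blast
qed

section \<open>Discretization of a Hoelder distribution\<close>

lemma cube_cell_volume:
  assumes "\<And>b. b \<in> Basis \<Longrightarrow> c b < N"
  shows "integrable lborel (indicator (cube_cell N c) :: 'a::euclidean_space \<Rightarrow> real)"
    "(\<integral>z. indicator (cube_cell N c) z \<partial>(lborel :: 'a measure)) = 1 / real N ^ DIM('a)"
proof -
  \<comment> \<open>The volume formula was obtained inside the locale; the zero function gives an
    instance.\<close>
  interpret line_approx "\<lambda>_::'a. 0" 0 0 1 0 by unfold_locales auto
  show "integrable lborel (indicator (cube_cell N c) :: 'a \<Rightarrow> real)"
    "(\<integral>z. indicator (cube_cell N c) z \<partial>(lborel :: 'a measure)) = 1 / real N ^ DIM('a)"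
    using cell_volume[OF assms] by auto
qed

lemma unit_cube_volume:
  "integrable lborel (indicator unit_cube :: 'a::euclidean_space \<Rightarrow> real)"
  "(\<integral>z. indicator unit_cube z \<partial>(lborel :: 'a measure)) = (1 :: real)"
proof -
  have "measure lborel (unit_cube :: 'a set) = 1"
    unfolding unit_cube_def by (subst measure_lborel_cbox_eq) (auto simp: inner_sum_left_Basis)
  then show "(\<integral>z. indicator unit_cube z \<partial>(lborel :: 'a measure)) = (1 :: real)" by simp
qed (simp add: unit_cube_def emeasure_lborel_cbox_eq)

text \<open>\<open>enn2real\<close> sends infinity to zero, but the derivative of a probability
  measure is finite almost everywhere, so the real-valued function is still a density.\<close>

lemma RN_deriv_lborel:
  fixes N :: "'c::euclidean_space measure"
  assumes N: "prob_space N" "sets N = sets borel" "absolutely_continuous lborel N"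
  defines "h \<equiv> \<lambda>x. enn2real (RN_deriv lborel N x)"
  shows "h \<in> borel_measurable borel" and "\<And>x. 0 \<le> h x"
    and "\<And>S. S \<in> sets borel \<Longrightarrow> emeasure N S = (\<integral>\<^sup>+x. ennreal (indicator S x * h x) \<partial>lborel)"
    and "\<And>S. S \<in> sets borel \<Longrightarrow> integrable lborel (\<lambda>x. indicator S x * h x)"
    and "\<And>S. S \<in> sets borel \<Longrightarrow> measure N S = (\<integral>x. indicator S x * h x \<partial>lborel)"
proof -
  interpret N: prob_space N by fact
  have sN: "sets N = sets (lborel :: 'c measure)" using N(2) by simp
  show m[measurable]: "h \<in> borel_measurable borel"
    using borel_measurable_RN_deriv[of lborel N] unfolding h_def by (simp cong: measurable_cong_sets)
  show h0: "\<And>x. 0 \<le> h x" by (simp add: h_def)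
  have dens: "density lborel (RN_deriv lborel N) = N"
    by (rule sigma_finite_measure.density_RN_deriv[OF lborel.sigma_finite_measure_axioms N(3) sN])
  have fin: "AE x in lborel. RN_deriv lborel N x \<noteq> \<infinity>"
    by (rule sigma_finite_measure.RN_deriv_finite[OF lborel.sigma_finite_measure_axioms _ N(3) sN]) unfold_locales
  show em: "emeasure N S = (\<integral>\<^sup>+x. ennreal (indicator S x * h x) \<partial>lborel)" if "S \<in> sets borel" for S
  proof -
    have "emeasure N S = emeasure (density lborel (RN_deriv lborel N)) S" by (simp add: dens)
    also have "\<dots> = (\<integral>\<^sup>+x. RN_deriv lborel N x * indicator S x \<partial>lborel)"
      using that by (intro emeasure_density) auto
    also have "\<dots> = (\<integral>\<^sup>+x. ennreal (indicator S x * h x) \<partial>lborel)"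
    proof (rule nn_integral_cong_AE, use fin in eventually_elim)
      case (elim x)
      then show ?case by (auto simp: indicator_def h_def less_top)
    qed
    finally show ?thesis .
  qed
  show int: "integrable lborel (\<lambda>x. indicator S x * h x)" if "S \<in> sets borel" for S
  proof (rule integrableI_nonneg)
    show "(\<lambda>x. indicator S x * h x) \<in> borel_measurable lborel" using that by measurable
    show "(\<integral>\<^sup>+ x. ennreal (indicator S x * h x) \<partial>lborel) < \<infinity>"
      unfolding em[OF that, symmetric] by (simp add: N.emeasure_eq_measure)
  qed (simp add: h0)
  show "measure N S = (\<integral>x. indicator S x * h x \<partial>lborel)" if "S \<in> sets borel" for S
    unfolding measure_def em[OF that] using that h0
    by (intro integral_eq_nn_integral[symmetric]) auto
qed

section \<open>Marginal densities and their product\<close>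

lemma nn_integral_lborel_product:
  fixes u :: "'a::euclidean_space \<Rightarrow> ennreal" and v :: "'b::euclidean_space \<Rightarrow> ennreal"
  assumes [measurable]: "u \<in> borel_measurable borel" "v \<in> borel_measurable borel"
  shows "(\<integral>\<^sup>+x. u (fst x) * v (snd x) \<partial>lborel) = (\<integral>\<^sup>+y. u y \<partial>lborel) * (\<integral>\<^sup>+z. v z \<partial>lborel)"
proof -
  have "(\<integral>\<^sup>+x. u (fst x) * v (snd x) \<partial>(lborel :: ('a \<times> 'b) measure))
      = (\<integral>\<^sup>+x. u (fst x) * v (snd x) \<partial>(lborel \<Otimes>\<^sub>M lborel))" by (simp add: lborel_prod)
  also have "\<dots> = (\<integral>\<^sup>+y. \<integral>\<^sup>+z. u y * v z \<partial>lborel \<partial>lborel)"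
    by (subst lborel.nn_integral_fst[symmetric]) auto
  also have "\<dots> = (\<integral>\<^sup>+y. u y \<partial>lborel) * (\<integral>\<^sup>+z. v z \<partial>lborel)"
    by (simp add: nn_integral_cmult nn_integral_multc)
  finally show ?thesis .
qed

lemma absolutely_continuous_marginals:
  fixes P :: "('a::euclidean_space \<times> 'b::euclidean_space) measure"
  assumes "prob_space P" "sets P = sets borel" "absolutely_continuous lborel P"
  shows "absolutely_continuous lborel (distr P borel fst)" "absolutely_continuous lborel (distr P borel snd)"
proof -
  have sp: "space P = UNIV" using assms(2) by (simp add: sets_eq_imp_space_eq[OF assms(2)])
  have fm: "fst \<in> measurable P borel" "snd \<in> measurable P borel"
    by (auto simp: measurable_cong_sets[OF assms(2) refl] intro!: borel_measurable_continuous_onI continuous_intros)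
  have null: "x \<in> null_sets P" if "x \<in> null_sets lborel" for x using assms(3) that by (auto simp: absolutely_continuous_def)
  show "absolutely_continuous lborel (distr P borel fst)"
    unfolding absolutely_continuous_def
  proof
    fix S :: "'a set" assume S: "S \<in> null_sets lborel"
    have "S \<times> (UNIV :: 'b set) \<in> null_sets (lborel \<Otimes>\<^sub>M lborel)"
      using S by (auto simp: null_sets_def lborel.emeasure_pair_measure_Times)
    then have "S \<times> (UNIV :: 'b set) \<in> null_sets P" by (intro null) (simp add: lborel_prod)
    moreover have "fst -` S \<inter> space P = S \<times> UNIV" by (auto simp: sp)
    ultimately show "S \<in> null_sets (distr P borel fst)"
      using S fm by (auto simp: null_sets_def emeasure_distr)
  qed
  show "absolutely_continuous lborel (distr P borel snd)"
    unfolding absolutely_continuous_def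
  proof
    fix S :: "'b set" assume S: "S \<in> null_sets lborel"
    have "(UNIV :: 'a set) \<times> S \<in> null_sets (lborel \<Otimes>\<^sub>M lborel)"
      using S by (auto simp: null_sets_def lborel.emeasure_pair_measure_Times)
    then have "(UNIV :: 'a set) \<times> S \<in> null_sets P" by (intro null) (simp add: lborel_prod)
    moreover have "snd -` S \<inter> space P = UNIV \<times> S" by (auto simp: sp)
    ultimately show "S \<in> null_sets (distr P borel snd)"
      using S fm by (auto simp: null_sets_def emeasure_distr)
  qed
qed

lemma mem_unit_cube_prod: "x \<in> unit_cube \<longleftrightarrow> fst x \<in> unit_cube \<and> snd x \<in> unit_cube"
  by (cases x) (simp add: mem_unit_cube Basis_prod_def ball_Un)

lemma product_density_integral:
  fixes P :: "('a::euclidean_space \<times> 'b::euclidean_space) measure"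
  assumes P: "prob_space P" "sets P = sets borel" "absolutely_continuous lborel P"
    and S: "S \<in> sets borel" and T: "T \<in> sets borel"
  shows "integrable lborel (\<lambda>x. indicator (S \<times> T) x * product_density P x)"
    "(\<integral>x. indicator (S \<times> T) x * product_density P x \<partial>lborel) = measure P (S \<times> UNIV) * measure P (UNIV \<times> T)"
    "product_density P \<in> borel_measurable borel" "0 \<le> product_density P x"
proof -
  interpret P: prob_space P by fact
  have fm: "fst \<in> measurable P borel" "snd \<in> measurable P borel"
    by (auto simp: measurable_cong_sets[OF P(2) refl] intro!: borel_measurable_continuous_onI continuous_intros)
  have sp: "space P = UNIV" using P(2) by (simp add: sets_eq_imp_space_eq[OF P(2)])
  interpret Y: prob_space "distr P borel fst" by (rule P.prob_space_distr[OF fm(1)])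
  interpret Z: prob_space "distr P borel snd" by (rule P.prob_space_distr[OF fm(2)])
  define hY where "hY x = enn2real (RN_deriv lborel (distr P borel fst) x)" for x
  define hZ where "hZ x = enn2real (RN_deriv lborel (distr P borel snd) x)" for x
  note Y = RN_deriv_lborel[OF Y.prob_space_axioms sets_distr absolutely_continuous_marginals(1)[OF P], folded hY_def]
  note Z = RN_deriv_lborel[OF Z.prob_space_axioms sets_distr absolutely_continuous_marginals(2)[OF P], folded hZ_def]
  note [measurable] = Y(1) Z(1) S T
  have pd: "product_density P x = hY (fst x) * hZ (snd x)" for x by (simp add: product_density_def hY_def hZ_def)
  show "product_density P \<in> borel_measurable borel"
  proof -
    have "(\<lambda>x. hY (fst x) * hZ (snd x)) \<in> borel_measurable (borel \<Otimes>\<^sub>M borel)" by measurable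
    then show ?thesis by (simp add: borel_prod pd[abs_def])
  qed
  show "0 \<le> product_density P x" using Y(2) Z(2) by (simp add: pd mult_nonneg_nonneg)
  have mST: "(\<lambda>x. indicator (S \<times> T) x * product_density P x) \<in> borel_measurable (lborel :: ('a \<times> 'b) measure)"
  proof -
    have "(\<lambda>x. (indicator S (fst x) * indicator T (snd x)) * (hY (fst x) * hZ (snd x))) \<in> borel_measurable (borel \<Otimes>\<^sub>M borel)"
      by measurable
    moreover have "indicator (S \<times> T) x = (indicator S (fst x) * indicator T (snd x) :: real)" for x
      by (cases x) (auto simp: indicator_def)
    ultimately show ?thesis by (simp add: borel_prod pd[abs_def])
  qed
  have eq: "ennreal (indicator (S \<times> T) x * product_density P x)
      = ennreal (indicator S (fst x) * hY (fst x)) * ennreal (indicator T (snd x) * hZ (snd x))" for x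
    using Y(2) Z(2) by (cases x) (auto simp: pd indicator_def ennreal_mult)
  have e: "(\<integral>\<^sup>+x. ennreal (indicator (S \<times> T) x * product_density P x) \<partial>lborel)
      = emeasure (distr P borel fst) S * emeasure (distr P borel snd) T"
    unfolding eq Y(3)[OF S] Z(3)[OF T] by (rule nn_integral_lborel_product) measurable
  have nn: "0 \<le> indicator (S \<times> T) x * product_density P x" for x
    using Y(2) Z(2) by (simp add: pd mult_nonneg_nonneg)
  show "integrable lborel (\<lambda>x. indicator (S \<times> T) x * product_density P x)"
    by (rule integrableI_nonneg[OF mST]) (simp_all add: nn e Y.emeasure_eq_measure Z.emeasure_eq_measure ennreal_mult[symmetric])
  have "(\<integral>x. indicator (S \<times> T) x * product_density P x \<partial>lborel)
      = measure (distr P borel fst) S * measure (distr P borel snd) T"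
    by (subst integral_eq_nn_integral[OF mST]) (simp_all add: nn e Y.emeasure_eq_measure Z.emeasure_eq_measure ennreal_mult[symmetric])
  also have "measure (distr P borel fst) S = measure P (S \<times> UNIV)"
  proof -
    have "fst -` S = S \<times> (UNIV :: 'b set)" by auto
    then show ?thesis using fm by (simp add: measure_distr sp)
  qed
  also have "measure (distr P borel snd) T = measure P (UNIV \<times> T)"
  proof -
    have "snd -` T = (UNIV :: 'a set) \<times> T" by auto
    then show ?thesis using fm by (simp add: measure_distr sp)
  qed
  finally show "(\<integral>x. indicator (S \<times> T) x * product_density P x \<partial>lborel) = measure P (S \<times> UNIV) * measure P (UNIV \<times> T)" .
qed

text \<open>Labels are restricted to \<open>Basis\<close> so that they lie in a finite set of
  extensional functions. On the cube the indices are nonnegative, so converting them to naturals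
  loses nothing.\<close>

definition cell_of :: "nat \<Rightarrow> 'a::euclidean_space \<Rightarrow> 'a \<Rightarrow> nat" where
  "cell_of N u = (\<lambda>b\<in>Basis. nat (cell_index N (u \<bullet> b)))"

abbreviation cell_pair :: "nat \<Rightarrow> 'a::euclidean_space \<times> 'b::euclidean_space \<Rightarrow> ('a \<Rightarrow> nat) \<times> ('b \<Rightarrow> nat)" where
  "cell_pair N x \<equiv> (cell_of N (fst x), cell_of N (snd x))"

abbreviation cells :: "nat \<Rightarrow> ('a::euclidean_space \<Rightarrow> nat) set" where
  "cells N \<equiv> PiE Basis (\<lambda>_. {..<N})"

lemma cell_index_range: "1 \<le> N \<Longrightarrow> 0 \<le> t \<Longrightarrow> t \<le> 1 \<Longrightarrow> 0 \<le> cell_index N t \<and> cell_index N t < int N"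
  by (auto simp: cell_index_def)

lemma cell_of_eq_iff:
  assumes "1 \<le> N" "u \<in> unit_cube" "c \<in> cells N"
  shows "cell_of N u = c \<longleftrightarrow> u \<in> cube_cell N c"
proof
  assume "cell_of N u = c"
  then have "c b = nat (cell_index N (u \<bullet> b))" if "b \<in> Basis" for b using that by (auto simp: cell_of_def)
  then show "u \<in> cube_cell N c"
    using assms(2) cell_index_range[OF assms(1)] by (auto simp: cube_cell_def mem_unit_cube)
next
  assume "u \<in> cube_cell N c"
  then show "cell_of N u = c"
    using PiE_arb[OF assms(3)] by (auto simp: cube_cell_def cell_of_def fun_eq_iff restrict_def)
qed

lemma same_cell_eq:
  fixes u v :: "real^'d"
  assumes "1 \<le> N" "u \<in> unit_cube" "v \<in> unit_cube"
  shows "same_cell N u v = of_bool (cell_of N u = cell_of N v)"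
proof -
  have B: "(Basis :: (real^'d) set) = range (\<lambda>i. axis i 1)" by (auto simp: Basis_vec_def)
  have "cell_of N u = cell_of N v \<longleftrightarrow> (\<forall>b\<in>Basis. nat (cell_index N (u \<bullet> b)) = nat (cell_index N (v \<bullet> b)))"
    by (auto simp: cell_of_def fun_eq_iff restrict_def)
  also have "\<dots> \<longleftrightarrow> (\<forall>b\<in>Basis. cell_index N (u \<bullet> b) = cell_index N (v \<bullet> b))"
    using assms(2,3) cell_index_range[OF assms(1)] by (intro ball_cong refl eq_nat_nat_iff) (auto simp: mem_unit_cube)
  also have "\<dots> \<longleftrightarrow> (\<forall>i. cell_index N (u $ i) = cell_index N (v $ i))"
    by (simp add: B inner_axis)
  finally show ?thesis by (simp add: same_cell_def)
qed

section \<open>The test as a function of cell labels\<close>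

lemma h_in_eq:
  assumes "1 \<le> N" "x1 \<in> unit_cube" "x2 \<in> unit_cube" "x3 \<in> unit_cube" "x4 \<in> unit_cube"
  shows "h_in N x1 x2 x3 x4 = cell_kernel (cell_pair N x1) (cell_pair N x2) (cell_pair N x3) (cell_pair N x4)"
  using assms by (simp add: h_in_def cell_kernel_def same_cell_eq mem_unit_cube_prod)

lemma U_stat_eq:
  assumes "1 \<le> N" "\<And>i. i \<in> {1..n} \<Longrightarrow> X i \<in> unit_cube"
  shows "U_stat N n X = cell_U n (\<lambda>i. cell_pair N (X i))"
  unfolding U_stat_def cell_U_def
proof (intro arg_cong2[where f="(/)"] sum.cong refl)
  fix t assume "t \<in> distinct_quadruples n"
  then show "(case t of (i, j, k, l) \<Rightarrow> h_in N (X i) (X j) (X k) (X l))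
    = (case t of (i, j, k, l) \<Rightarrow> cell_kernel (cell_pair N (X i)) (cell_pair N (X j)) (cell_pair N (X k)) (cell_pair N (X l)))"
    using assms(2) by (cases t) (auto simp: distinct_quadruples_def intro!: h_in_eq[OF assms(1)])
qed

lemma U_stat_permuted_eq:
  assumes "1 \<le> N" "\<And>i. i \<in> {1..n} \<Longrightarrow> X i \<in> unit_cube" "\<pi> permutes {1..n}"
  shows "U_stat N n (permuted_sample \<pi> X) = cell_U n (permuted_sample \<pi> (\<lambda>i. cell_pair N (X i)))"
proof -
  have "permuted_sample \<pi> X i \<in> unit_cube" if "i \<in> {1..n}" for i
    using assms(2)[OF that] assms(2)[of "\<pi> i"] that permutes_in_image[OF assms(3)]
    by (simp add: permuted_sample_def mem_unit_cube_prod del: atLeastAtMost_iff)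
  then have "U_stat N n (permuted_sample \<pi> X) = cell_U n (\<lambda>i. cell_pair N (permuted_sample \<pi> X i))"
    by (rule U_stat_eq[OF assms(1)])
  moreover have "(\<lambda>i. cell_pair N (permuted_sample \<pi> X i)) = permuted_sample \<pi> (\<lambda>i. cell_pair N (X i))"
    by (simp add: permuted_sample_def fun_eq_iff)
  ultimately show ?thesis by simp
qed

lemma single_test_eq:
  assumes N: "1 \<le> N" and X: "\<And>i. i \<in> {1..n} \<Longrightarrow> X i \<in> unit_cube"
  defines "w \<equiv> \<lambda>i\<in>{1..n}. cell_pair N (X i)"
  shows "single_test N a n X = of_bool (cell_U n w > cell_crit a n w)"
proof -
  have w: "w i = cell_pair N (X i)" if "i \<in> {1..n}" for i using that by (simp add: w_def)
  have U: "U_stat N n X = cell_U n w"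
  proof -
    have "U_stat N n X = cell_U n (\<lambda>i. cell_pair N (X i))" by (rule U_stat_eq[OF N X])
    also have "\<dots> = cell_U n w" by (rule cell_U_cong) (simp only: w)
    finally show ?thesis .
  qed
  have "crit_value N a n X = cell_crit a n (\<lambda>i. cell_pair N (X i))"
  proof -
    have "(\<Sum>\<pi> | \<pi> permutes {1..n}. of_bool (U_stat N n (permuted_sample \<pi> X) \<le> t))
       = (\<Sum>\<pi> | \<pi> permutes {1..n}. of_bool (cell_U n (permuted_sample \<pi> (\<lambda>i. cell_pair N (X i))) \<le> t) :: real)" for t
      by (intro sum.cong refl) (use U_stat_permuted_eq[OF N X] in auto)
    then show ?thesis unfolding crit_value_def perm_crit_def by simp
  qed
  also have "\<dots> = cell_crit a n w"
    by (rule perm_crit_cong) (simp add: w)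
  finally show ?thesis by (simp add: single_test_def U)
qed

lemma unit_cube_Times: "unit_cube = unit_cube \<times> unit_cube"
  by (auto simp: mem_unit_cube_prod)

lemma cube_cell_prod:
  "cube_cell N c = cube_cell N (\<lambda>b. c (b, 0)) \<times> cube_cell N (\<lambda>b. c (0, b))"
  by (auto simp: cube_cell_def mem_unit_cube_prod Basis_prod_def ball_Un)

text \<open>A basis vector of the product space is (b, 0) or (0, b); as basis vectors are nonzero,
  \<open>snd z = 0\<close> tells the two kinds apart, and a label splits into a pair of
  labels.\<close>

lemma sum_cells_prod:
  fixes h :: "('a::euclidean_space \<times> 'b::euclidean_space) set \<Rightarrow> real"
  shows "(\<Sum>c\<in>cells N. h (cube_cell N c)) = (\<Sum>(a, b)\<in>cells N \<times> cells N. h (cube_cell N a \<times> cube_cell N b))"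
proof (rule sum.reindex_bij_witness[where
      j = "\<lambda>c. (\<lambda>b\<in>Basis. c (b, 0), \<lambda>b\<in>Basis. c (0, b))" and
      i = "\<lambda>(a, b). \<lambda>z\<in>Basis. if snd z = 0 then a (fst z) else b (snd z)"])
  fix c :: "'a \<times> 'b \<Rightarrow> nat" assume c: "c \<in> cells N"
  show "(case (\<lambda>b\<in>Basis. c (b, 0), \<lambda>b\<in>Basis. c (0, b)) of (a, b) \<Rightarrow> \<lambda>z\<in>Basis. if snd z = 0 then a (fst z) else b (snd z)) = c"
  proof
    fix z show "(case (\<lambda>b\<in>Basis. c (b, 0), \<lambda>b\<in>Basis. c (0, b)) of (a, b) \<Rightarrow> \<lambda>z\<in>Basis. if snd z = 0 then a (fst z) else b (snd z)) z = c z"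
      using PiE_arb[OF c, of z] by (cases "z \<in> Basis") (auto simp: Basis_prod_def)
  qed
  show "(\<lambda>b\<in>Basis. c (b, 0), \<lambda>b\<in>Basis. c (0, b)) \<in> cells N \<times> cells N"
    using c by (auto simp: PiE_iff Basis_prod_def)
  have "cube_cell N (\<lambda>b\<in>Basis. c (b, 0)) = cube_cell N (\<lambda>b. c (b, 0))"
    "cube_cell N (\<lambda>b\<in>Basis. c (0, b)) = cube_cell N (\<lambda>b. c (0, b))"
    by (auto simp: cube_cell_def)
  then show "(case (\<lambda>b\<in>Basis. c (b, 0), \<lambda>b\<in>Basis. c (0, b)) of (a, b) \<Rightarrow> h (cube_cell N a \<times> cube_cell N b)) = h (cube_cell N c)"
    by (simp add: cube_cell_prod[of N c])
next
  fix ab :: "('a \<Rightarrow> nat) \<times> ('b \<Rightarrow> nat)" assume ab: "ab \<in> cells N \<times> cells N"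
  obtain a b where [simp]: "ab = (a, b)" by (cases ab)
  have a: "a \<in> cells N" and b: "b \<in> cells N" using ab by auto
  let ?c = "\<lambda>z\<in>Basis. if snd z = 0 then a (fst z) else b (snd z)"
  have "(\<lambda>x\<in>Basis. ?c (x, 0)) = a"
    using PiE_arb[OF a] by (auto simp: fun_eq_iff restrict_def Basis_prod_def)
  moreover have "(\<lambda>x\<in>Basis. ?c (0, x)) = b"
    using PiE_arb[OF b] by (auto simp: fun_eq_iff restrict_def Basis_prod_def)
  ultimately show "(\<lambda>x\<in>Basis. (case ab of (a, b) \<Rightarrow> \<lambda>z\<in>Basis. if snd z = 0 then a (fst z) else b (snd z)) (x, 0),
     \<lambda>x\<in>Basis. (case ab of (a, b) \<Rightarrow> \<lambda>z\<in>Basis. if snd z = 0 then a (fst z) else b (snd z)) (0, x)) = ab" by simp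
  show "(case ab of (a, b) \<Rightarrow> \<lambda>z\<in>Basis. if snd z = 0 then a (fst z) else b (snd z)) \<in> cells N"
    using a b by (auto simp: PiE_iff Basis_prod_def)
qed

locale holder_dist =
  fixes P :: "('a::euclidean_space \<times> 'b::euclidean_space) measure" and s L :: real and N :: nat
  assumes P: "P \<in> holder_dists s L" and s: "0 < s" and L: "0 < L" and N: "1 \<le> N"
begin

definition p :: "('a \<Rightarrow> nat) \<times> ('b \<Rightarrow> nat) \<Rightarrow> real" where
  "p c = measure P {x \<in> unit_cube. cell_pair N x = c}"

text \<open>The mean value 1 of a density on the unit cube plus the maximal oscillation of a Hoelder
  function.\<close>

definition M :: real where "M = 1 + L * DIM('a \<times> 'b)"

lemma P_prob: "prob_space P" "sets P = sets borel" "absolutely_continuous lborel P" "emeasure P unit_cube = 1"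
  using P by (auto simp: holder_dists_def)

sublocale PS: prob_space P by (rule P_prob)

lemma P_cube: "measure P unit_cube = 1" using P_prob(4) by (simp add: measure_def)

lemma space_P: "space P = UNIV" using P_prob(2) by (simp add: sets_eq_imp_space_eq[OF P_prob(2)])

lemma cell_set:
  fixes c :: "('a \<Rightarrow> nat) \<times> ('b \<Rightarrow> nat)"
  shows "c \<in> cells N \<times> cells N \<Longrightarrow> {x \<in> unit_cube. cell_pair N x = c} = cube_cell N (fst c) \<times> cube_cell N (snd c)"
proof (rule set_eqI)
  fix x :: "'a \<times> 'b" assume c: "c \<in> cells N \<times> cells N"
  have sub: "cube_cell N d \<subseteq> unit_cube" for d :: "'a \<Rightarrow> nat" by (auto simp: cube_cell_def)
  have sub2: "cube_cell N d \<subseteq> unit_cube" for d :: "'b \<Rightarrow> nat" by (auto simp: cube_cell_def)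
  show "x \<in> {x \<in> unit_cube. cell_pair N x = c} \<longleftrightarrow> x \<in> cube_cell N (fst c) \<times> cube_cell N (snd c)"
    using c cell_of_eq_iff[OF N, of "fst x" "fst c"] cell_of_eq_iff[OF N, of "snd x" "snd c"]
      sub[of "fst c"] sub2[of "snd c"]
    by (cases c; cases x) (auto simp: mem_unit_cube_prod)
qed

lemma cell_sets: "cube_cell N a \<times> cube_cell N b \<in> sets borel"
  by (simp add: borel_prod[symmetric])

lemma cell_sum: "(\<Sum>c\<in>cells N. indicator (cube_cell N c) z) = (indicator unit_cube z :: real)" for z :: "'x::euclidean_space"
  using unit_cube_split(1)[of N z] N by simp

lemma joint_density_facts:
  "joint_density P \<in> borel_measurable borel" "0 \<le> joint_density P x"
  "S \<in> sets borel \<Longrightarrow> integrable lborel (\<lambda>x. indicator S x * joint_density P x)"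
  "S \<in> sets borel \<Longrightarrow> measure P S = (\<integral>x. indicator S x * joint_density P x \<partial>lborel)"
  using RN_deriv_lborel[OF P_prob(1-3)] by (simp_all add: joint_density_def[abs_def])

lemma cube_UNIV: "measure P (S \<times> UNIV) = measure P (S \<times> unit_cube)" "measure P (UNIV \<times> T) = measure P (unit_cube \<times> T)"
  if "S \<in> sets borel" "T \<in> sets borel" for S T
proof -
  have s: "S \<times> (UNIV :: 'b set) \<in> sets P" "S \<times> unit_cube \<in> sets P" "(UNIV :: 'a set) \<times> T \<in> sets P" "unit_cube \<times> T \<in> sets P"
    using that by (auto simp: P_prob(2) borel_prod[symmetric])
  have ae: "AE x in P. x \<in> unit_cube"
    using P_cube by (intro PS.AE_prob_1) simp
  show "measure P (S \<times> UNIV) = measure P (S \<times> unit_cube)"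
  proof (rule PS.finite_measure_eq_AE)
    show "AE x in P. x \<in> S \<times> UNIV \<longleftrightarrow> x \<in> S \<times> unit_cube"
      using ae by eventually_elim (auto simp: mem_unit_cube_prod)
  qed (use s in auto)
  show "measure P (UNIV \<times> T) = measure P (unit_cube \<times> T)"
  proof (rule PS.finite_measure_eq_AE)
    show "AE x in P. x \<in> UNIV \<times> T \<longleftrightarrow> x \<in> unit_cube \<times> T"
      using ae by eventually_elim (auto simp: mem_unit_cube_prod)
  qed (use s in auto)
qed

lemma product_density_facts:
  "product_density P \<in> borel_measurable borel" "0 \<le> product_density P x"
  "S \<in> sets borel \<Longrightarrow> T \<in> sets borel \<Longrightarrow> integrable lborel (\<lambda>x. indicator (S \<times> T) x * product_density P x)"
  "S \<in> sets borel \<Longrightarrow> T \<in> sets borel \<Longrightarrow> (\<integral>x. indicator (S \<times> T) x * product_density P x \<partial>lborel)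
    = measure P (S \<times> unit_cube) * measure P (unit_cube \<times> T)"
  using product_density_integral(1,2)[OF P_prob(1-3)] product_density_integral(3,4)[OF P_prob(1-3), of "{}" "{}"] cube_UNIV
  by simp_all

lemma versions:
  obtains f g where "f \<in> holder_class s L" "g \<in> holder_class s L"
    "AE x in lborel. x \<in> unit_cube \<longrightarrow> joint_density P x = f x"
    "AE x in lborel. x \<in> unit_cube \<longrightarrow> product_density P x = g x"
  using P by (auto simp: holder_dists_def)

lemma p_eq: "c \<in> cells N \<times> cells N \<Longrightarrow> p c = measure P (cube_cell N (fst c) \<times> cube_cell N (snd c))"
  by (simp add: p_def cell_set)

lemma sum_p_measure:
  assumes "finite K" "\<And>c. c \<in> K \<Longrightarrow> T c \<in> sets borel" "S \<in> sets borel"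
    "\<And>z. (\<Sum>c\<in>K. indicator (T c) z) = (indicator S z :: real)"
  shows "(\<Sum>c\<in>K. measure P (T c)) = measure P S"
proof -
  have "(\<Sum>c\<in>K. measure P (T c)) = (\<Sum>c\<in>K. \<integral>x. indicator (T c) x * joint_density P x \<partial>lborel)"
    by (intro sum.cong refl joint_density_facts(4) assms)
  also have "\<dots> = (\<integral>x. (\<Sum>c\<in>K. indicator (T c) x * joint_density P x) \<partial>lborel)"
    by (rule Bochner_Integration.integral_sum[symmetric]) (intro joint_density_facts(3) assms)
  also have "\<dots> = measure P S"
    unfolding sum_distrib_right[symmetric] assms(4) by (rule joint_density_facts(4)[symmetric]) (rule assms)
  finally show ?thesis .
qed

lemma sum_p_snd: "a \<in> cells N \<Longrightarrow> (\<Sum>b\<in>cells N. p (a, b)) = measure P (cube_cell N a \<times> unit_cube)"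
proof -
  assume a: "a \<in> cells N"
  have "(\<Sum>b\<in>cells N. p (a, b)) = (\<Sum>b\<in>cells N. measure P (cube_cell N a \<times> cube_cell N b))"
    using a by (intro sum.cong refl) (simp add: p_eq)
  also have "\<dots> = measure P (cube_cell N a \<times> unit_cube)"
  proof (rule sum_p_measure)
    fix z :: "'a \<times> 'b"
    have "(\<Sum>b\<in>cells N. indicator (cube_cell N a \<times> cube_cell N b) z)
        = indicator (cube_cell N a) (fst z) * (\<Sum>b\<in>cells N. indicator (cube_cell N b) (snd z) :: real)"
      unfolding sum_distrib_left by (cases z) (auto intro!: sum.cong simp: indicator_def)
    then show "(\<Sum>b\<in>cells N. indicator (cube_cell N a \<times> cube_cell N b) z) = (indicator (cube_cell N a \<times> unit_cube) z :: real)"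
      unfolding cell_sum by (cases z) (auto simp: indicator_def)
  qed (auto intro!: finite_PiE cell_sets simp: borel_prod[symmetric])
  finally show ?thesis .
qed

lemma sum_p_fst: "b \<in> cells N \<Longrightarrow> (\<Sum>a\<in>cells N. p (a, b)) = measure P (unit_cube \<times> cube_cell N b)"
proof -
  assume b: "b \<in> cells N"
  have "(\<Sum>a\<in>cells N. p (a, b)) = (\<Sum>a\<in>cells N. measure P (cube_cell N a \<times> cube_cell N b))"
    using b by (intro sum.cong refl) (simp add: p_eq)
  also have "\<dots> = measure P (unit_cube \<times> cube_cell N b)"
  proof (rule sum_p_measure)
    fix z :: "'a \<times> 'b"
    have "(\<Sum>a\<in>cells N. indicator (cube_cell N a \<times> cube_cell N b) z)
        = (\<Sum>a\<in>cells N. indicator (cube_cell N a) (fst z)) * (indicator (cube_cell N b) (snd z) :: real)"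
      unfolding sum_distrib_right by (cases z) (auto intro!: sum.cong simp: indicator_def)
    then show "(\<Sum>a\<in>cells N. indicator (cube_cell N a \<times> cube_cell N b) z) = (indicator (unit_cube \<times> cube_cell N b) z :: real)"
      unfolding cell_sum by (cases z) (auto simp: indicator_def)
  qed (auto intro!: finite_PiE cell_sets simp: borel_prod[symmetric])
  finally show ?thesis .
qed

lemma sum_p: "sum p (cells N \<times> cells N) = 1"
proof -
  have "sum p (cells N \<times> cells N) = (\<Sum>(a, b)\<in>cells N \<times> cells N. measure P (cube_cell N a \<times> cube_cell N b))"
    by (intro sum.cong refl) (auto simp: p_eq)
  also have "\<dots> = (\<Sum>c\<in>cells N. measure P (cube_cell N c))" by (rule sum_cells_prod[symmetric])
  also have "\<dots> = measure P unit_cube"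
    by (rule sum_p_measure) (auto intro!: finite_PiE simp: cell_sum)
  finally show ?thesis using P_cube by simp
qed

end

context holder_dist
begin

lemma version_integrable:
  fixes h :: "'a \<times> 'b \<Rightarrow> real"
  assumes h: "h \<in> holder_class s L" and S: "S \<in> sets borel" "S \<subseteq> unit_cube"
  shows "integrable lborel (\<lambda>x. indicator S x * h x)"
proof -
  have "integrable lborel (\<lambda>x. indicator unit_cube x *\<^sub>R h x)"
    using holder_continuous_on[OF h s L] by (intro borel_integrable_compact) (auto simp: unit_cube_def)
  then have "integrable lborel (\<lambda>x. indicator S x *\<^sub>R (indicator unit_cube x *\<^sub>R h x))"
    by (rule integrable_mult_indicator[rotated]) (use S(1) in simp)
  moreover have "indicator S x *\<^sub>R (indicator unit_cube x *\<^sub>R h x) = indicator S x * h x" for x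
    using S(2) by (auto simp: indicator_def)
  ultimately show ?thesis by (simp only:)
qed

lemma version_integral:
  fixes h d :: "'a \<times> 'b \<Rightarrow> real"
  assumes h: "h \<in> holder_class s L" and S: "S \<in> sets borel" "S \<subseteq> unit_cube"
    and d[measurable]: "d \<in> borel_measurable borel" and ae: "AE x in lborel. x \<in> unit_cube \<longrightarrow> d x = h x"
  shows "(\<integral>x. indicator S x * d x \<partial>lborel) = (\<integral>x. indicator S x * h x \<partial>lborel)"
proof (rule integral_cong_AE)
  note S(1)[measurable]
  show "(\<lambda>x. indicator S x * d x) \<in> borel_measurable lborel" by measurable
  show "(\<lambda>x. indicator S x * h x) \<in> borel_measurable lborel"
    using version_integrable[OF h S] by (rule borel_measurable_integrable)
  show "AE x in lborel. indicator S x * d x = indicator S x * h x"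
    using ae by eventually_elim (use S(2) in \<open>auto simp: indicator_def\<close>)
qed

text \<open>The average over the unit cube is 1, so no value can be farther from 1 than the
  oscillation.\<close>

lemma version_bound:
  fixes h :: "'a \<times> 'b \<Rightarrow> real"
  assumes h: "h \<in> holder_class s L" and one: "(\<integral>x. indicator unit_cube x * h x \<partial>lborel) = 1" and y: "y \<in> unit_cube"
  shows "\<bar>h y - 1\<bar> \<le> L * DIM('a \<times> 'b)"
proof -
  let ?D = "L * DIM('a \<times> 'b)"
  have osc: "\<bar>h x - h y\<bar> \<le> ?D" if "x \<in> unit_cube" for x using holder_oscillation[OF h s L y that] .
  have int: "integrable lborel (\<lambda>x. indicator unit_cube x * h x)" by (rule version_integrable[OF h]) auto
  have ci: "integrable lborel (\<lambda>x :: 'a \<times> 'b. c * indicator unit_cube x)" for c :: real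
    using unit_cube_volume(1) by (intro integrable_mult_right)
  have "(h y - ?D) * (\<integral>x. indicator unit_cube x \<partial>(lborel :: ('a \<times> 'b) measure)) \<le> 1"
    unfolding one[symmetric] integral_mult_right_zero[symmetric]
    by (intro integral_mono ci int) (use osc in \<open>force simp: indicator_def abs_le_iff\<close>)
  moreover have "1 \<le> (h y + ?D) * (\<integral>x. indicator unit_cube x \<partial>(lborel :: ('a \<times> 'b) measure))"
    unfolding one[symmetric] integral_mult_right_zero[symmetric]
    by (intro integral_mono ci int) (use osc in \<open>force simp: indicator_def abs_le_iff\<close>)
  ultimately show ?thesis unfolding unit_cube_volume(2) by (simp add: abs_le_iff)
qed

lemma cell_prod_eq:
  fixes a :: "'a \<Rightarrow> nat" and b :: "'b \<Rightarrow> nat"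
  shows "cube_cell N a \<times> cube_cell N b = cube_cell N (\<lambda>z. if snd z = 0 then a (fst z) else b (snd z))"
  unfolding cube_cell_prod[of N "\<lambda>z. if snd z = 0 then a (fst z) else b (snd z)"]
  by (auto simp: cube_cell_def)

lemma cell_prod_subset: "cube_cell N a \<times> cube_cell N b \<subseteq> unit_cube"
  by (auto simp: cube_cell_def mem_unit_cube_prod)

lemma version_cell_le:
  fixes h :: "'a \<times> 'b \<Rightarrow> real"
  assumes h: "h \<in> holder_class s L" and one: "(\<integral>x. indicator unit_cube x * h x \<partial>lborel) = 1"
    and ab: "a \<in> cells N" "b \<in> cells N"
  shows "(\<integral>x. indicator (cube_cell N a \<times> cube_cell N b) x * h x \<partial>lborel) \<le> M / real N ^ DIM('a \<times> 'b)"
proof -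
  define c where "c = (\<lambda>z. if snd z = 0 then a (fst z) else b (snd z))"
  have c: "c z < N" if "z \<in> Basis" for z using that ab by (auto simp: c_def Basis_prod_def PiE_iff)
  have "(\<integral>x. indicator (cube_cell N c) x * h x \<partial>lborel) \<le> (\<integral>x. M * indicator (cube_cell N c) x \<partial>lborel)"
  proof (rule integral_mono)
    show "integrable lborel (\<lambda>x. indicator (cube_cell N c) x * h x)"
      by (rule version_integrable[OF h]) (auto simp: cube_cell_def)
    show "integrable lborel (\<lambda>x. M * indicator (cube_cell N c) x)"
      by (intro integrable_mult_right cube_cell_volume(1) c)
    fix x
    show "indicator (cube_cell N c) x * h x \<le> M * indicator (cube_cell N c) x"
      using version_bound[OF h one, of x] by (auto simp: indicator_def cube_cell_def M_def abs_le_iff)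
  qed
  also have "\<dots> = M / real N ^ DIM('a \<times> 'b)"
    using cube_cell_volume(2)[where 'a="'a \<times> 'b", OF c] by simp
  finally show ?thesis unfolding cell_prod_eq c_def .
qed

lemma joint_one: "(\<integral>x. indicator unit_cube x * joint_density P x \<partial>lborel) = 1"
  using joint_density_facts(4)[of unit_cube] P_cube by simp

lemma product_one: "(\<integral>x. indicator unit_cube x * product_density P x \<partial>lborel) = 1"
  using product_density_facts(4)[of unit_cube unit_cube] P_cube by (simp flip: unit_cube_Times)

lemma p_integral: "c \<in> cells N \<times> cells N \<Longrightarrow> p c = (\<integral>x. indicator (cube_cell N (fst c) \<times> cube_cell N (snd c)) x * joint_density P x \<partial>lborel)"
  unfolding p_eq by (rule joint_density_facts(4)) (rule cell_sets)

lemma marginals_integral: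
  "a \<in> cells N \<Longrightarrow> b \<in> cells N \<Longrightarrow> (\<Sum>b'\<in>cells N. p (a, b')) * (\<Sum>a'\<in>cells N. p (a', b))
    = (\<integral>x. indicator (cube_cell N a \<times> cube_cell N b) x * product_density P x \<partial>lborel)"
  by (simp add: sum_p_snd sum_p_fst product_density_facts(4))

text \<open>Density bound times cell volume. Both halves of the class membership enter: the joint
  density bounds the cell probabilities, and the product density bounds the products of
  marginals.\<close>

sublocale cell_dist p "cells N" "cells N" "M / real N ^ DIM('a \<times> 'b)"
proof
  obtain f g where fg: "f \<in> holder_class s L" "g \<in> holder_class s L"
    "AE x in lborel. x \<in> unit_cube \<longrightarrow> joint_density P x = f x"
    "AE x in lborel. x \<in> unit_cube \<longrightarrow> product_density P x = g x" by (rule versions)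
  note vf = version_integral[OF fg(1) _ _ joint_density_facts(1) fg(3)]
  note vg = version_integral[OF fg(2) _ _ product_density_facts(1) fg(4)]
  have f1: "(\<integral>x. indicator unit_cube x * f x \<partial>lborel) = 1" using vf[of unit_cube] joint_one by simp
  have g1: "(\<integral>x. indicator unit_cube x * g x \<partial>lborel) = 1" using vg[of unit_cube] product_one by simp
  show "finite (cells N)" "finite (cells N)" by (auto intro: finite_PiE)
  show "0 \<le> p c" for c by (simp add: p_def)
  show "sum p (cells N \<times> cells N) = 1" by (rule sum_p)
  show "0 \<le> M / real N ^ DIM('a \<times> 'b)" using L by (simp add: M_def)
  show "p c \<le> M / real N ^ DIM('a \<times> 'b)" if c: "c \<in> cells N \<times> cells N" for c
  proof -
    have "fst c \<in> cells N" "snd c \<in> cells N" using c by auto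
    from version_cell_le[OF fg(1) f1 this] show ?thesis
      unfolding p_integral[OF c] vf[OF cell_sets cell_prod_subset] .
  qed
  show "(\<Sum>b'\<in>cells N. p (a, b')) * (\<Sum>a'\<in>cells N. p (a', b)) \<le> M / real N ^ DIM('a \<times> 'b)"
    if ab: "a \<in> cells N" "b \<in> cells N" for a b
    using version_cell_le[OF fg(2) g1 ab]
    unfolding marginals_integral[OF ab] vg[OF cell_sets cell_prod_subset] .
qed

lemma card_cells: "real (card (cells N \<times> cells N :: (('a \<Rightarrow> nat) \<times> ('b \<Rightarrow> nat)) set)) = real N ^ DIM('a \<times> 'b)"
  by (simp add: card_cartesian_product card_PiE power_add)

lemma null_indep:
  assumes "AE x in lborel. joint_density P x = product_density P x" and c: "c \<in> cells N \<times> cells N"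
  shows "p c = p1 (fst c) * p2 (snd c)"
proof -
  have ab: "fst c \<in> cells N" "snd c \<in> cells N" using c by auto
  have m: "(\<lambda>x. indicator (cube_cell N (fst c) \<times> cube_cell N (snd c)) x * joint_density P x) \<in> borel_measurable lborel"
    "(\<lambda>x. indicator (cube_cell N (fst c) \<times> cube_cell N (snd c)) x * product_density P x) \<in> borel_measurable lborel"
    using joint_density_facts(1) product_density_facts(1) cell_sets[of "fst c" "snd c"] by auto
  have "p c = (\<integral>x. indicator (cube_cell N (fst c) \<times> cube_cell N (snd c)) x * product_density P x \<partial>lborel)"
    unfolding p_integral[OF c] by (rule integral_cong_AE[OF m]) (use assms(1) in \<open>eventually_elim, simp\<close>)
  then show ?thesis using marginals_integral[OF ab] by (simp add: p1_def p2_def)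
qed

text \<open>All mass is already inside the cube. This reduces \<open>L2_norm\<close>, an integral
  over the whole space, to the cube where the Hoelder versions are known.\<close>

lemma zero_outside_cube:
  fixes d :: "'a \<times> 'b \<Rightarrow> real"
  assumes d: "d \<in> borel_measurable borel" "\<And>x. 0 \<le> d x" "integrable lborel d" "(\<integral>x. d x \<partial>lborel) = 1"
    and one: "(\<integral>x. indicator unit_cube x * d x \<partial>lborel) = 1"
  shows "AE x in lborel. x \<notin> unit_cube \<longrightarrow> d x = 0"
proof -
  have i: "integrable lborel (\<lambda>x. indicator unit_cube x * d x)"
    using integrable_mult_indicator[OF _ d(3), of unit_cube] by simp
  have "(\<integral>x. d x - indicator unit_cube x * d x \<partial>lborel) = 0"
    using Bochner_Integration.integral_diff[OF d(3) i] d(4) one by simp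
  moreover have "integrable lborel (\<lambda>x. d x - indicator unit_cube x * d x)"
    by (intro Bochner_Integration.integrable_diff d(3) i)
  moreover have "AE x in lborel. 0 \<le> d x - indicator unit_cube x * d x"
    using d(2) by (intro AE_I2) (simp add: indicator_def)
  ultimately have "AE x in lborel. d x - indicator unit_cube x * d x = 0"
    using integral_nonneg_eq_0_iff_AE by blast
  then show ?thesis by eventually_elim (auto simp: indicator_def)
qed

text \<open>The integral of the difference of the two versions over a cell is exactly
  \<open>dep\<close>, so the squared cell masses in the bias bound add up to
  \<open>\<theta>\<close>. Both versions are within \<open>L * DIM\<close> of 1, which gives the
  bound on their difference.\<close>

lemma L2_distance_le:
  assumes C: "\<And>f g :: 'a \<times> 'b \<Rightarrow> real. f \<in> holder_class s L \<Longrightarrow> g \<in> holder_class s L \<Longrightarrow>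
      (\<And>z. z \<in> unit_cube \<Longrightarrow> \<bar>f z - g z\<bar> \<le> 2 * L * DIM('a \<times> 'b)) \<Longrightarrow>
      (\<integral>z. indicator unit_cube z * (f z - g z)\<^sup>2 \<partial>lborel)
      \<le> C * (real N ^ DIM('a \<times> 'b) * (\<Sum>c\<in>cells N. (\<integral>z. indicator (cube_cell N c) z * (f z - g z) \<partial>lborel)\<^sup>2)
            + real N powr (- 2 * s)) \<and>
     (\<lambda>z. indicator unit_cube z * (f z - g z)) \<in> borel_measurable borel"
  shows "(L2_norm (\<lambda>x. joint_density P x - product_density P x))\<^sup>2 \<le> C * (real N ^ DIM('a \<times> 'b) * \<theta> + real N powr (- 2 * s))"
proof -
  obtain f g where fg: "f \<in> holder_class s L" "g \<in> holder_class s L"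
    "AE x in lborel. x \<in> unit_cube \<longrightarrow> joint_density P x = f x"
    "AE x in lborel. x \<in> unit_cube \<longrightarrow> product_density P x = g x" by (rule versions)
  note vf = version_integral[OF fg(1) _ _ joint_density_facts(1) fg(3)]
  note vg = version_integral[OF fg(2) _ _ product_density_facts(1) fg(4)]
  have f1: "(\<integral>x. indicator unit_cube x * f x \<partial>lborel) = 1" using vf[of unit_cube] joint_one by simp
  have g1: "(\<integral>x. indicator unit_cube x * g x \<partial>lborel) = 1" using vg[of unit_cube] product_one by simp
  have "\<bar>f z - g z\<bar> \<le> 2 * L * DIM('a \<times> 'b)" if "z \<in> unit_cube" for z
    using version_bound[OF fg(1) f1 that] version_bound[OF fg(2) g1 that] by (simp add: abs_le_iff)
  note Cfg = C[OF fg(1,2) this]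
  have zj: "AE x in lborel. x \<notin> unit_cube \<longrightarrow> joint_density P x = 0"
  proof (rule zero_outside_cube[OF joint_density_facts(1,2)])
    show "integrable lborel (joint_density P)" "(\<integral>x. joint_density P x \<partial>lborel) = 1"
      using joint_density_facts(3,4)[of UNIV] PS.prob_space by (simp_all add: space_P)
  qed (rule joint_one)
  have zp: "AE x in lborel. x \<notin> unit_cube \<longrightarrow> product_density P x = 0"
  proof (rule zero_outside_cube[OF product_density_facts(1,2)])
    have "measure P (UNIV \<times> unit_cube) = measure P unit_cube" "measure P (unit_cube \<times> UNIV) = measure P unit_cube"
      using cube_UNIV[of unit_cube unit_cube] by (simp_all flip: unit_cube_Times)
    then show "integrable lborel (product_density P)" "(\<integral>x. product_density P x \<partial>lborel) = 1"
      using product_density_integral(1,2)[OF P_prob(1-3), of UNIV UNIV] PS.prob_space by (simp_all add: space_P)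
  qed (rule product_one)
  have "(L2_norm (\<lambda>x. joint_density P x - product_density P x))\<^sup>2
      = (\<integral>x. (joint_density P x - product_density P x)\<^sup>2 \<partial>lborel)"
    by (simp add: L2_norm_def)
  also have "\<dots> = (\<integral>x. (indicator unit_cube x * (f x - g x))\<^sup>2 \<partial>lborel)"
  proof (rule integral_cong_AE)
    show "(\<lambda>x. (joint_density P x - product_density P x)\<^sup>2) \<in> borel_measurable lborel"
      using joint_density_facts(1) product_density_facts(1) by auto
    show "(\<lambda>x. (indicator unit_cube x * (f x - g x))\<^sup>2) \<in> borel_measurable lborel"
      using Cfg by auto
    show "AE x in lborel. (joint_density P x - product_density P x)\<^sup>2 = (indicator unit_cube x * (f x - g x))\<^sup>2"
      using fg(3,4) zj zp by eventually_elim (auto simp: indicator_def)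
  qed
  also have "\<dots> = (\<integral>x. indicator unit_cube x * (f x - g x)\<^sup>2 \<partial>lborel)"
    by (intro Bochner_Integration.integral_cong refl) (simp add: indicator_def)
  also have "\<dots> \<le> C * (real N ^ DIM('a \<times> 'b) * (\<Sum>c\<in>cells N. (\<integral>z. indicator (cube_cell N c) z * (f z - g z) \<partial>lborel)\<^sup>2)
            + real N powr (- 2 * s))" using Cfg by blast
  also have "(\<Sum>c\<in>cells N. (\<integral>z. indicator (cube_cell N c) z * (f z - g z) \<partial>lborel)\<^sup>2) = \<theta>"
  proof -
    have "(\<Sum>c\<in>cells N. (\<integral>z. indicator (cube_cell N c) z * (f z - g z) \<partial>lborel)\<^sup>2)
       = (\<Sum>(a :: 'a \<Rightarrow> nat, b :: 'b \<Rightarrow> nat)\<in>cells N \<times> cells N. (\<integral>z. indicator (cube_cell N a \<times> cube_cell N b) z * (f z - g z) \<partial>lborel)\<^sup>2)"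
      by (rule sum_cells_prod[of "\<lambda>S. (\<integral>z. indicator S z * (f z - g z) \<partial>lborel)\<^sup>2"])
    also have "\<dots> = (\<Sum>c\<in>cells N \<times> cells N. (dep c)\<^sup>2)"
    proof (rule sum.cong[OF refl])
      fix c :: "('a \<Rightarrow> nat) \<times> ('b \<Rightarrow> nat)" assume c: "c \<in> cells N \<times> cells N"
      obtain a b where cab: "c = (a, b)" and a: "a \<in> cells N" and b: "b \<in> cells N" using c by (cases c) auto
      let ?S = "cube_cell N a \<times> cube_cell N b"
      have "(\<integral>z. indicator ?S z * (f z - g z) \<partial>lborel) = (\<integral>z. indicator ?S z * f z - indicator ?S z * g z \<partial>lborel)"
        by (simp add: right_diff_distrib)
      also have "\<dots> = (\<integral>z. indicator ?S z * f z \<partial>lborel) - (\<integral>z. indicator ?S z * g z \<partial>lborel)"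
        by (intro Bochner_Integration.integral_diff version_integrable fg cell_sets cell_prod_subset)
      also have "\<dots> = dep c"
        unfolding vf[OF cell_sets cell_prod_subset, symmetric] vg[OF cell_sets cell_prod_subset, symmetric]
        using p_integral[OF c] marginals_integral[OF a b] by (simp add: dep_def cab p1_def p2_def)
      finally show "(case c of (a, b) \<Rightarrow> (\<integral>z. indicator (cube_cell N a \<times> cube_cell N b) z * (f z - g z) \<partial>lborel)\<^sup>2) = (dep c)\<^sup>2"
        by (simp add: cab)
    qed
    finally show ?thesis by (simp add: \<theta>_def)
  qed
  finally show ?thesis .
qed

end

section \<open>The adaptive test\<close>

text \<open>Here \<open>R\<close> stands for \<kappa>^(d/2) and \<open>M / R\<^sup>2\<close> for
  \<open>\<rho>\<close>. The sampling error and the permutation error each receive half of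
  \<open>\<beta>\<close>; \<open>b\<close> is the required signal \<open>R * \<theta>\<close> in
  units of \<open>ll / n\<close>.\<close>

lemma type_two_arith:
  fixes R \<theta> M C1 ll l0 \<alpha> \<beta> \<gamma> b :: real and n m q d :: nat
  assumes m: "0 < m" "real n \<le> 8 * m" "m \<le> n" and q: "real q \<le> C1 * ll" and l0: "0 < l0" "l0 \<le> ll"
    and R: "1 \<le> R" and kap: "ll * R\<^sup>2 \<le> 2 ^ d * n" and th: "b * ll / n \<le> R * \<theta>"
    and ex: "exp (- 2 * real q) \<le> \<alpha> * \<beta> / (2 * \<gamma>)"
    and b: "3200 * M / (l0 * \<beta>) \<le> b" "36864 * C1 * (2 * C1 * 2 ^ d + M) \<le> b"
    and pos: "1 \<le> M" "0 < \<alpha>" "0 < \<beta>" "\<beta> \<le> 1" "0 < \<gamma>" "0 < C1" "0 < b"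
  shows "(128 * (M / R\<^sup>2) * \<theta> / m + 256 * R\<^sup>2 * (M / R\<^sup>2)\<^sup>2 / (real m)\<^sup>2) / (4 * \<theta>\<^sup>2)
      + (384 * real q * R * (2 * real q + real m * (M / R\<^sup>2)) / (real m)\<^sup>2 / (2 * \<theta>)) ^ (2 * q) / (\<alpha> / \<gamma>) \<le> \<beta>"
proof -
  have n: "real n > 0" using m by linarith
  have m0: "real m > 0" using m by simp
  have ll: "ll > 0" using l0 by simp
  have "0 < b * ll / n" using pos ll n by simp
  then have Rth: "0 < R * \<theta>" using th by linarith
  then have th0: "0 < \<theta>" using R by (simp add: zero_less_mult_iff)
  have mRth: "b * ll \<le> 8 * (m * (R * \<theta>))"
  proof -
    have "b * ll \<le> n * (R * \<theta>)" using th n by (simp add: field_simps)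
    also have "\<dots> \<le> (8 * m) * (R * \<theta>)" using m(2) Rth by (intro mult_right_mono) auto
    finally show ?thesis by simp
  qed
  \<comment> \<open>The variance term equals 32 t / R + 64 t^2, so t \<le> \<beta> / 400 leaves it
    below \<beta> / 2. The constant 3200 is 8 * 400, with the 8 from n \<le> 8 m.\<close>
  define t where "t = M / (m * R * \<theta>)"
  have t0: "0 \<le> t" using pos m0 R th0 by (simp add: t_def)
  have t: "t \<le> \<beta> / 400"
  proof -
    have "3200 * M \<le> b * (l0 * \<beta>)" using b(1) l0 pos by (simp add: pos_divide_le_eq)
    also have "\<dots> = b * l0 * \<beta>" by simp
    also have "\<dots> \<le> b * ll * \<beta>" using l0 pos by (intro mult_right_mono mult_left_mono) auto
    also have "\<dots> \<le> 8 * (m * (R * \<theta>)) * \<beta>" using mRth pos by (intro mult_right_mono) auto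
    finally have "400 * M \<le> \<beta> * (m * R * \<theta>)" by (simp add: mult_ac)
    moreover have "m * R * \<theta> > 0" using m0 R th0 by simp
    ultimately show ?thesis unfolding t_def by (simp add: pos_divide_le_eq mult_ac)
  qed
  have "(128 * (M / R\<^sup>2) * \<theta> / m + 256 * R\<^sup>2 * (M / R\<^sup>2)\<^sup>2 / (real m)\<^sup>2) / (4 * \<theta>\<^sup>2) = 32 * (t / R) + 64 * t\<^sup>2"
    using R th0 m0 by (simp add: t_def field_simps power2_eq_square)
  also have "\<dots> \<le> 32 * t + 64 * t"
  proof -
    have "t / R \<le> t" using R t0 by (simp add: divide_le_eq mult_left_le_one_le mult_le_cancel_left1)
    moreover have "t\<^sup>2 \<le> t"
      unfolding power2_eq_square using t0 t pos by (intro mult_left_le_one_le) auto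
    ultimately show ?thesis by linarith
  qed
  also have "\<dots> \<le> \<beta> / 2" using t pos by linarith
  finally have first: "(128 * (M / R\<^sup>2) * \<theta> / m + 256 * R\<^sup>2 * (M / R\<^sup>2)\<^sup>2 / (real m)\<^sup>2) / (4 * \<theta>\<^sup>2) \<le> \<beta> / 2" .
  define C3 where "C3 = 2 * C1 * 2 ^ d + M"
  have C3: "C3 > 0" using pos by (simp add: C3_def add_pos_pos)
  define X where "X = 384 * real q * R * (2 * real q + real m * (M / R\<^sup>2)) / (real m)\<^sup>2 / (2 * \<theta>)"
  have X0: "0 \<le> X" using pos R th0 by (auto simp: X_def intro!: divide_nonneg_nonneg mult_nonneg_nonneg add_nonneg_nonneg)
  have "X = 192 * (real q * (2 * real q * R\<^sup>2 + m * M)) / ((real m)\<^sup>2 * (R * \<theta>))"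
    unfolding X_def using R th0 m0 by (simp add: field_simps power2_eq_square)
  also have "\<dots> \<le> 192 * ((C1 * ll) * (C3 * n)) / ((real m)\<^sup>2 * (R * \<theta>))"
  proof (intro divide_right_mono mult_left_mono mult_mono)
    have "2 * real q * R\<^sup>2 \<le> 2 * (C1 * ll) * R\<^sup>2" using q by (intro mult_right_mono) auto
    also have "\<dots> = 2 * C1 * (ll * R\<^sup>2)" by simp
    also have "\<dots> \<le> 2 * C1 * (2 ^ d * n)" using kap pos by (intro mult_left_mono) auto
    moreover have "m * M \<le> n * M" using m pos by (intro mult_right_mono) auto
    ultimately show "2 * real q * R\<^sup>2 + m * M \<le> C3 * n" by (simp add: C3_def algebra_simps)
  qed (use q R Rth pos ll m0 in auto)
  \<comment> \<open>Any bound below exp (- 1) would do, since the power 2 q then decays like exp (-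
    2 q). The constant 36864 is 192 * 3 * 64, where n \<le> 8 m is used twice.\<close>
  also have "\<dots> \<le> 1 / 3"
  proof -
    have "576 * ((C1 * ll) * (C3 * n)) * 64 = (36864 * C1 * C3) * (ll * n)" by simp
    also have "\<dots> \<le> b * (ll * n)" using b(2) ll n by (intro mult_right_mono) (auto simp: C3_def)
    also have "\<dots> = (b * ll) * n" by simp
    also have "\<dots> \<le> (8 * (m * (R * \<theta>))) * (8 * m)"
      by (rule mult_mono[OF mRth m(2)]) (use Rth m0 in auto)
    also have "\<dots> = ((real m)\<^sup>2 * (R * \<theta>)) * 64" by (simp add: power2_eq_square)
    finally have "576 * ((C1 * ll) * (C3 * n)) \<le> (real m)\<^sup>2 * (R * \<theta>)" by (simp add: mult_ac)
    moreover have "(real m)\<^sup>2 * (R * \<theta>) > 0" using m0 Rth by simp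
    ultimately show ?thesis by (simp add: divide_le_eq)
  qed
  also have "\<dots> \<le> exp (- 1)" using exp_le by (simp add: exp_minus field_simps)
  finally have "X ^ (2 * q) \<le> exp (- 1) ^ (2 * q)" using X0 by (intro power_mono) auto
  also have "\<dots> = exp (- 2 * real q)" by (simp add: exp_of_nat_mult[symmetric])
  also have "\<dots> \<le> \<alpha> * \<beta> / (2 * \<gamma>)" by (rule ex)
  finally have "X ^ (2 * q) / (\<alpha> / \<gamma>) \<le> \<alpha> * \<beta> / (2 * \<gamma>) / (\<alpha> / \<gamma>)" using pos by (intro divide_right_mono) auto
  also have "\<dots> = \<beta> / 2" using pos by (simp add: field_simps)
  finally show ?thesis using first unfolding X_def by linarith
qed

text \<open>From n = 4 on, n exceeds e, so ln n > 1 and the iterated logarithm is positive.\<close>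

lemma loglog_bounds:
  assumes "4 \<le> n"
  defines "ll \<equiv> ln (ln (real n))"
  shows "0 < ln (ln 4 :: real)" "ln (ln 4) \<le> ll" "ll \<le> ln (real n)" "1 \<le> ln (real n)" "1 < real n / ll"
proof -
  have "exp 1 < (4::real)" using exp_le by linarith
  then have ln4: "1 < ln (4::real)" by (metis exp_gt_zero ln_exp ln_less_cancel_iff order_less_trans)
  then show l0: "0 < ln (ln 4 :: real)" by simp
  have nn: "ln 4 \<le> ln (real n)" using assms by simp
  then show l: "ln (ln 4) \<le> ll" unfolding ll_def using ln4 by simp
  show "1 \<le> ln (real n)" using nn ln4 by linarith
  then show ll: "ll \<le> ln (real n)" unfolding ll_def using ln_le_minus_one[of "ln (real n)"] by simp
  have "ln (real n) \<le> real n - 1" using assms by (intro ln_le_minus_one) auto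
  then have "ll < real n" "0 < ll" using ll l l0 by linarith+
  then show "1 < real n / ll" by (simp add: less_divide_eq_1_pos)
qed

text \<open>The number of resolutions is O(log n). For small n the iterated logarithm is below 1 and
  its own logarithm negative, so it is compared with its value at 4.\<close>

lemma gamma_max_bounds:
  assumes n: "4 \<le> n" and d: "1 \<le> d"
  shows "1 \<le> gamma_max d n"
    "real (gamma_max d n) \<le> (2 * (1 + \<bar>ln (ln (ln 4))\<bar>) / ln 2 + 1) * ln (real n)"
proof -
  define ll where "ll = ln (ln (real n))"
  note b = loglog_bounds[OF n, folded ll_def]
  have lg: "0 < log 2 (real n / ll)" using b by simp
  have x: "0 < 2 / real d * log 2 (real n / ll)" using lg d by simp
  then show "1 \<le> gamma_max d n" unfolding gamma_max_def ll_def[symmetric] by linarith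
  have "real (gamma_max d n) \<le> 2 / real d * log 2 (real n / ll) + 1"
    unfolding gamma_max_def ll_def[symmetric] using x by linarith
  also have "2 / real d * log 2 (real n / ll) \<le> 2 * log 2 (real n / ll)"
    using lg d by (intro mult_right_mono) (auto simp: divide_le_eq)
  also have "2 * log 2 (real n / ll) = 2 * (ln (real n) - ln ll) / ln 2"
  proof -
    have "0 < ll" using b by linarith
    then show ?thesis using n by (simp add: log_def ln_div)
  qed
  also have "\<dots> \<le> 2 * (ln (real n) * (1 + \<bar>ln (ln (ln 4))\<bar>)) / ln 2"
  proof (intro divide_right_mono mult_left_mono)
    have "ln (ln (ln 4)) \<le> ln ll" using b(1,2) by (subst ln_le_cancel_iff) linarith+
    then have "ln (real n) - ln ll \<le> ln (real n) + \<bar>ln (ln (ln 4))\<bar> * 1" by linarith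
    also have "\<dots> \<le> ln (real n) + \<bar>ln (ln (ln 4))\<bar> * ln (real n)"
      using b by (intro add_left_mono mult_left_mono) auto
    finally show "ln (real n) - ln ll \<le> ln (real n) * (1 + \<bar>ln (ln (ln 4))\<bar>)" by (simp add: algebra_simps)
  qed auto
  finally show "real (gamma_max d n) \<le> (2 * (1 + \<bar>ln (ln (ln 4))\<bar>) / ln 2 + 1) * ln (real n)"
    using b by (simp add: algebra_simps)
qed

lemma adaptive_test_cases:
  assumes "1 \<le> gamma_max (CARD('d1) + CARD('d2)) n"
  fixes X :: "nat \<Rightarrow> (real^'d1::finite) \<times> (real^'d2::finite)"
  defines "\<gamma> \<equiv> gamma_max (CARD('d1) + CARD('d2)) n"
  shows "adaptive_test \<alpha> n X = 1 \<Longrightarrow> \<exists>j\<in>{1..\<gamma>}. single_test (2 ^ j) (\<alpha> / real \<gamma>) n X = 1"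
    "adaptive_test \<alpha> n X = 0 \<Longrightarrow> j \<in> {1..\<gamma>} \<Longrightarrow> single_test (2 ^ j) (\<alpha> / real \<gamma>) n X = 0"
proof -
  let ?S = "(\<lambda>\<kappa>. single_test \<kappa> (\<alpha> / real \<gamma>) n X) ` {2 ^ j | j. j \<in> {1..\<gamma>}}"
  have S: "?S = (\<lambda>j. single_test (2 ^ j) (\<alpha> / real \<gamma>) n X) ` {1..\<gamma>}" by auto
  have fin: "finite ?S" "?S \<noteq> {}" unfolding S using assms by auto
  have ad: "adaptive_test \<alpha> n X = Max ?S" by (simp add: adaptive_test_def \<gamma>_def Let_def)
  show "\<exists>j\<in>{1..\<gamma>}. single_test (2 ^ j) (\<alpha> / real \<gamma>) n X = 1" if "adaptive_test \<alpha> n X = 1"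
    using Max_in[OF fin] that unfolding ad unfolding S by auto
  show "single_test (2 ^ j) (\<alpha> / real \<gamma>) n X = 0" if "adaptive_test \<alpha> n X = 0" "j \<in> {1..\<gamma>}"
  proof -
    have "single_test (2 ^ j) (\<alpha> / real \<gamma>) n X \<le> Max ?S" using that(2) fin by (intro Max_ge) (auto simp: S)
    then have "single_test (2 ^ j) (\<alpha> / real \<gamma>) n X \<le> 0" using that(1) ad by simp
    then show ?thesis by (simp add: single_test_def of_bool_def split: if_splits)
  qed
qed

lemma holder_dist_bridge:
  fixes P :: "((real^'d1::finite) \<times> (real^'d2::finite)) measure"
  assumes "holder_dist P s L N"
    and S: "\<And>X. X \<in> S \<Longrightarrow> (\<And>i. i \<in> {1..n} \<Longrightarrow> X i \<in> unit_cube) \<Longrightarrow> \<Phi> (\<lambda>i\<in>{1..n}. cell_pair N (X i))"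
  shows "\<exists>T\<in>sets (iid_sample n P). S \<inter> space (iid_sample n P) \<subseteq> T \<and>
     emeasure (iid_sample n P) T \<le> ennreal (fexp (holder_dist.p P N) (cells N \<times> cells N) {1..n} (\<lambda>w. of_bool (\<Phi> w)))"
proof -
  interpret holder_dist P s L N by fact
  show ?thesis
    unfolding iid_sample_def p_def[abs_def]
  proof (rule iid_sample_bridge[where G = unit_cube and K = "cell_pair N" and C = "cells N \<times> cells N"
        and I = "{1..n}" and S = S and \<Phi> = \<Phi>, OF P_prob(1) finite_C finite_atLeastAtMost])
    show "{x \<in> unit_cube. cell_pair N x = c} \<in> sets P" if "c \<in> cells N \<times> cells N" for c
      unfolding cell_set[OF that] P_prob(2) by (rule cell_sets)
    show "(\<Sum>c\<in>cells N \<times> cells N. measure P {x \<in> unit_cube. cell_pair N x = c}) = 1"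
      using sum_p by (simp add: p_def[abs_def])
  qed (rule S)
qed

text \<open>A union bound over the resolutions, each at level \<open>\<alpha> / \<gamma>\<close>,
  carried out on the measurable covers.\<close>

lemma type_one_error:
  fixes P :: "((real^'d1::finite) \<times> (real^'d2::finite)) measure"
  assumes nullP: "P \<in> null_dists s L" and s: "0 < s" and L: "0 < L" and \<alpha>: "0 < \<alpha>" "\<alpha> < 1" and n: "4 \<le> n"
  shows "test_prob n P (adaptive_test \<alpha> n) 1 \<le> ennreal \<alpha>"
proof -
  define \<gamma> where "\<gamma> = gamma_max (CARD('d1) + CARD('d2)) n"
  have g1: "1 \<le> \<gamma>" unfolding \<gamma>_def by (rule gamma_max_bounds[OF n]) (simp add: Suc_leI)
  define a where "a = \<alpha> / real \<gamma>"
  have a: "0 < a" "a < 1" using g1 \<alpha> by (auto simp: a_def divide_less_eq)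
  let ?M = "iid_sample n P"
  have "\<exists>T\<in>sets ?M. {X. single_test (2 ^ j) a n X = 1} \<inter> space ?M \<subseteq> T \<and> emeasure ?M T \<le> ennreal a" for j
  proof -
    have hd: "holder_dist P s L (2 ^ j)"
      by unfold_locales (use nullP s L in \<open>auto simp: null_dists_def\<close>)
    interpret holder_dist P s L "2 ^ j" by (rule hd)
    have "E {1..n} (\<lambda>w. of_bool (cell_U n w > cell_crit a n w)) \<le> a"
    proof (intro type_one_error_le null_indep a)
      show "AE x in lborel. joint_density P x = product_density P x" using nullP by (simp add: null_dists_def)
    qed
    then have le: "ennreal (E {1..n} (\<lambda>w. of_bool (cell_U n w > cell_crit a n w))) \<le> ennreal a"
      by (rule ennreal_leI)
    have "\<exists>T\<in>sets ?M. {X. single_test (2 ^ j) a n X = 1} \<inter> space ?M \<subseteq> T \<and>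
        emeasure ?M T \<le> ennreal (E {1..n} (\<lambda>w. of_bool (cell_U n w > cell_crit a n w)))"
    proof (rule holder_dist_bridge[OF hd])
      fix X :: "nat \<Rightarrow> (real^'d1) \<times> (real^'d2)"
      assume X: "X \<in> {X. single_test (2 ^ j) a n X = 1}" "\<And>i. i \<in> {1..n} \<Longrightarrow> X i \<in> unit_cube"
      have "single_test (2 ^ j) a n X = of_bool (cell_U n (\<lambda>i\<in>{1..n}. cell_pair (2 ^ j) (X i))
          > cell_crit a n (\<lambda>i\<in>{1..n}. cell_pair (2 ^ j) (X i)))"
        using N X(2) by (rule single_test_eq)
      with X(1) show "cell_U n (\<lambda>i\<in>{1..n}. cell_pair (2 ^ j) (X i))
          > cell_crit a n (\<lambda>i\<in>{1..n}. cell_pair (2 ^ j) (X i))"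
        by (simp only: mem_Collect_eq of_bool_eq_1_iff)
    qed
    then show ?thesis using order_trans[OF _ le] by blast
  qed
  then obtain T where T: "\<And>j. T j \<in> sets ?M" "\<And>j. {X. single_test (2 ^ j) a n X = 1} \<inter> space ?M \<subseteq> T j"
    "\<And>j. emeasure ?M (T j) \<le> ennreal a" by metis
  have "test_prob n P (adaptive_test \<alpha> n) 1 \<le> emeasure ?M (\<Union>j\<in>{1..\<gamma>}. T j)"
    unfolding test_prob_def
  proof (rule emeasure_mono)
    show "{X \<in> space ?M. adaptive_test \<alpha> n X = 1} \<subseteq> (\<Union>j\<in>{1..\<gamma>}. T j)"
    proof
      fix X assume X: "X \<in> {X \<in> space ?M. adaptive_test \<alpha> n X = 1}"
      then obtain j where "j \<in> {1..\<gamma>}" "single_test (2 ^ j) a n X = 1"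
        using adaptive_test_cases(1)[OF g1[unfolded \<gamma>_def], of \<alpha> X] unfolding \<gamma>_def[symmetric] a_def[symmetric] by auto
      then show "X \<in> (\<Union>j\<in>{1..\<gamma>}. T j)" using X subsetD[OF T(2)[of j], of X] by auto
    qed
    show "(\<Union>j\<in>{1..\<gamma>}. T j) \<in> sets ?M" using T(1) by auto
  qed
  also have "\<dots> \<le> (\<Sum>j\<in>{1..\<gamma>}. emeasure ?M (T j))" using T(1) by (intro emeasure_subadditive_finite) auto
  also have "\<dots> \<le> (\<Sum>j\<in>{1..\<gamma>}. ennreal a)" by (intro sum_mono T(3))
  also have "\<dots> = ennreal (\<Sum>j\<in>{1..\<gamma>}. a)" using a by (intro sum_ennreal) auto
  also have "(\<Sum>j\<in>{1..\<gamma>}. a) = \<alpha>" using g1 by (simp add: a_def)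
  finally show ?thesis .
qed

text \<open>The resolution \<open>2 ^ j\<close> with \<open>j = \<lceil>log 2 \<kappa>\<rceil>\<close>, where \<open>\<kappa> = (n / log log n) powr (2 / (4 s + d))\<close> balances bias and noise.\<close>
lemma resolution_choice:
  fixes s :: real
  assumes n: "4 \<le> n" and d: "1 \<le> d" and s: "0 < s" "real d < 4 * s"
  defines "ll \<equiv> ln (ln (real n))"
  defines "k0 \<equiv> (real n / ll) powr (2 / (4 * s + d))"
  shows "\<exists>j\<in>{1..gamma_max d n}. k0 \<le> 2 ^ j \<and> 2 ^ j \<le> 2 * k0"
    "k0 ^ d \<le> real n / ll" "0 < k0"
    "k0 powr (- 2 * s) = sqrt (k0 ^ d) * (ll / n)"
proof -
  note b = loglog_bounds[OF n, folded ll_def]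
  define r where "r = real n / ll"
  have r: "1 < r" using b by (simp add: r_def)
  have ll: "0 < ll" using b by linarith
  have D: "0 < 4 * s + real d" using s by simp
  define x where "x = 2 / (4 * s + d) * log 2 r"
  have lg: "0 < log 2 r" using r by simp
  have x: "0 < x" using lg D by (simp add: x_def)
  have k0x: "k0 = 2 powr x"
    unfolding x_def k0_def r_def[symmetric] mult.commute[of "2 / _"] powr_powr[symmetric] using r by simp
  show k0: "0 < k0" by (simp add: k0x)
  define j where "j = nat \<lceil>x\<rceil>"
  have rj: "real j = of_int \<lceil>x\<rceil>" using x by (simp add: j_def)
  \<comment> \<open>The upper end of the grid is the balancing exponent for \<open>s = 0\<close>, so
    every smoothness finds its resolution on the grid.\<close>
  have "x \<le> 2 / real d * log 2 r"
    unfolding x_def using lg d s by (intro mult_right_mono divide_left_mono) auto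
  then have "\<lceil>x\<rceil> \<le> \<lceil>2 / real d * log 2 r\<rceil>" by (rule ceiling_mono)
  then have "j \<le> gamma_max d n" unfolding j_def gamma_max_def ll_def[symmetric] r_def by (rule nat_mono)
  moreover have "1 \<le> j" unfolding j_def using x by linarith
  moreover have "k0 \<le> 2 ^ j"
    unfolding k0x powr_realpow[symmetric, OF zero_less_numeral] using rj by (intro powr_mono) linarith+
  moreover have "(2::real) ^ j \<le> 2 powr (x + 1)"
    unfolding powr_realpow[symmetric, OF zero_less_numeral] using rj by (intro powr_mono) linarith+
  then have "2 ^ j \<le> 2 * k0" by (simp add: powr_add k0x)
  ultimately show "\<exists>j\<in>{1..gamma_max d n}. k0 \<le> 2 ^ j \<and> 2 ^ j \<le> 2 * k0" by (intro bexI[of _ j]) auto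
  have kd: "k0 ^ d = r powr (2 * d / (4 * s + d))"
    unfolding k0_def r_def[symmetric] using r by (simp add: powr_power mult.commute)
  \<comment> \<open>This is where 4 s > d is used: it keeps \<kappa>^d below n / log log n.\<close>
  have "2 * d / (4 * s + d) \<le> 1" using s D by (simp add: divide_le_eq)
  then have "r powr (2 * d / (4 * s + d)) \<le> r powr 1" using r by (intro powr_mono) auto
  then show "k0 ^ d \<le> real n / ll" using kd r by (simp add: r_def)
  have "sqrt (k0 ^ d) = r powr (d / (4 * s + d))"
  proof -
    have half: "2 * x / y * (1 / 2) = x / y" for x y :: real by simp
    have "2 * d / (4 * s + d) * (1 / 2) = d / (4 * s + d)"
      by (simp only: of_nat_mult of_nat_numeral half)
    then show ?thesis
      unfolding kd powr_half_sqrt[symmetric, OF powr_ge_zero] powr_powr by (rule arg_cong)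
  qed
  then have "sqrt (k0 ^ d) * (ll / n) = r powr (d / (4 * s + d)) * r powr (- 1)"
    using r ll by (simp add: r_def powr_minus)
  also have "\<dots> = r powr (d / (4 * s + d) + - 1)" by (rule powr_add[symmetric])
  \<comment> \<open>The balance equation: the squared bias \<kappa>^(-2 s) equals the noise level
    \<kappa>^(d/2) log log n / n.\<close>
  also have "d / (4 * s + d) + - 1 = 2 / (4 * s + d) * (- 2 * s)" using D by (simp add: field_simps)
  also have "r powr \<dots> = k0 powr (- 2 * s)" unfolding k0_def r_def[symmetric] powr_powr ..
  finally show "k0 powr (- 2 * s) = sqrt (k0 ^ d) * (ll / n)" by simp
qed

text \<open>Acceptance by the adaptive test forces acceptance at the balancing resolution, so that
  resolution alone has to detect the alternative.\<close>

lemma type_two_error: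
  fixes s L \<alpha> \<beta> :: real
  assumes s: "0 < s" "real (CARD('d1::finite) + CARD('d2::finite)) < 4 * s" and L: "0 < L"
    and \<alpha>: "0 < \<alpha>" "\<alpha> < 1" and \<beta>: "0 < \<beta>" "\<beta> \<le> 1"
  shows "\<exists>C>0. \<forall>n\<ge>4. \<forall>\<epsilon>. \<epsilon> \<ge> C * (ln (ln (real n)) / real n)
            powr (2 * s / (4 * s + real (CARD('d1) + CARD('d2)))) \<longrightarrow>
      (\<forall>P\<in>(alt_dists s L \<epsilon> :: ((real^'d1) \<times> (real^'d2)) measure set).
         test_prob n P (adaptive_test \<alpha> n) 0 \<le> ennreal \<beta>)"
proof -
  define d where "d = CARD('d1) + CARD('d2)"
  have d: "1 \<le> d" by (simp add: d_def Suc_leI)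
  have dim: "DIM((real^'d1) \<times> (real^'d2)) = d" by (simp add: d_def)
  have "0 \<le> 2 * L * DIM((real^'d1) \<times> (real^'d2))" using L by simp
  from holder_difference_L2_le[OF s(1) L this, where 'a = "(real^'d1) \<times> (real^'d2)"]
  obtain CA where CA: "CA > 0" and CA_le: "\<And>N f g. 1 \<le> N \<Longrightarrow> f \<in> holder_class s L \<Longrightarrow> g \<in> holder_class s L \<Longrightarrow>
      (\<And>z :: (real^'d1) \<times> (real^'d2). z \<in> unit_cube \<Longrightarrow> \<bar>f z - g z\<bar> \<le> 2 * L * DIM((real^'d1) \<times> (real^'d2))) \<Longrightarrow>
      (\<integral>z. indicator unit_cube z * (f z - g z)\<^sup>2 \<partial>lborel)
      \<le> CA * (real N ^ DIM((real^'d1) \<times> (real^'d2)) * (\<Sum>c\<in>cells N. (\<integral>z. indicator (cube_cell N c) z * (f z - g z) \<partial>lborel)\<^sup>2)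
            + real N powr (- 2 * s)) \<and>
     (\<lambda>z. indicator unit_cube z * (f z - g z)) \<in> borel_measurable borel"
    by blast
  define l0 where "l0 = ln (ln (4 :: real))"
  have l0: "0 < l0" using loglog_bounds(1)[of 4] by (simp add: l0_def)
  define c0 where "c0 = 2 * (1 + \<bar>ln (ln (ln 4))\<bar>) / ln 2 + (1::real)"
  have c0: "0 < c0" by (simp add: c0_def add_nonneg_pos)
  \<comment> \<open>Chosen so that exp (- C0 * ll) \<le> \<alpha> \<beta> / (2 c0 ln n), which is at
    most \<alpha> \<beta> / (2 \<gamma>).\<close>
  define C0 where "C0 = \<bar>ln (2 * c0 / (\<alpha> * \<beta>))\<bar> / l0 + 1"
  have C0: "1 \<le> C0" using l0 by (simp add: C0_def)
  \<comment> \<open>The extra \<open>1 / l0\<close> pays for rounding \<open>q\<close> up to an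
    integer.\<close>
  define C1 where "C1 = C0 + 1 / l0"
  have C1: "0 < C1" using C0 l0 by (simp add: C1_def add_pos_pos)
  define M where "M = 1 + L * d"
  have M: "1 \<le> M" using L by (simp add: M_def)
  define b where "b = 3200 * M / (l0 * \<beta>) + 36864 * C1 * (2 * C1 * 2 ^ d + M) + 1"
  have t1: "0 \<le> 3200 * M / (l0 * \<beta>)" using M l0 \<beta> by simp
  have t2: "0 \<le> 36864 * C1 * (2 * C1 * 2 ^ d + M)" using M C1 by simp
  have b: "0 < b" "3200 * M / (l0 * \<beta>) \<le> b" "36864 * C1 * (2 * C1 * 2 ^ d + M) \<le> b"
    using t1 t2 unfolding b_def by linarith+
  \<comment> \<open>The 1 under the root lets the signal absorb the bias, and \<open>b\<close> is
    what \<open>type_two_arith\<close> asks for. The factor \<open>sqrt (2 ^ d)\<close> makes up for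
    rounding the resolution to a power of two.\<close>
  define C where "C = sqrt (2 * CA * (1 + b * sqrt (2 ^ d)))"
  have C2: "C\<^sup>2 = 2 * CA * (1 + b * sqrt (2 ^ d))" using CA b by (simp add: C_def)
  have C: "0 < C" using CA b by (simp add: C_def add_pos_pos)
  show ?thesis
  proof (intro exI[of _ C] conjI C allI impI ballI)
    fix n :: nat and \<epsilon> :: real and P :: "((real^'d1) \<times> (real^'d2)) measure"
    assume n: "4 \<le> n"
      and eps: "C * (ln (ln (real n)) / real n) powr (2 * s / (4 * s + real (CARD('d1) + CARD('d2)))) \<le> \<epsilon>"
      and P: "P \<in> alt_dists s L \<epsilon>"
    define ll where "ll = ln (ln (real n))"
    note lb = loglog_bounds[OF n, folded ll_def]
    have ll: "0 < ll" "l0 \<le> ll" using lb(1,2) unfolding l0_def by linarith+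
    have n0: "real n > 0" using n by simp
    define k0 where "k0 = (real n / ll) powr (2 / (4 * s + d))"
    note rc = resolution_choice[OF n d s(1) s(2)[folded d_def], folded ll_def, folded k0_def]
    obtain j where j: "j \<in> {1..gamma_max d n}" "k0 \<le> 2 ^ j" "2 ^ j \<le> 2 * k0" using rc(1) by blast
    define N where "N = (2::nat) ^ j"
    have N: "1 \<le> N" "k0 \<le> real N" "real N \<le> 2 * k0" using j(2,3) by (simp_all add: N_def)
    define \<gamma> where "\<gamma> = gamma_max d n"
    note gb = gamma_max_bounds[OF n d, folded \<gamma>_def c0_def]
    define a where "a = \<alpha> / real \<gamma>"
    have a: "0 < a" "a < 1" using gb(1) \<alpha> by (auto simp: a_def divide_less_eq)
    define q where "q = nat \<lceil>C0 * ll\<rceil>"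
    have C0ll: "0 < C0 * ll" using C0 ll by simp
    have q: "1 \<le> q" "C0 * ll \<le> real q" "real q \<le> C0 * ll + 1" unfolding q_def using C0ll by linarith+
    have qC1: "real q \<le> C1 * ll"
    proof -
      have "1 \<le> 1 / l0 * ll" using ll l0 by (simp add: field_simps)
      then show ?thesis using q(3) by (simp add: C1_def distrib_right)
    qed
    have ex: "exp (- 2 * real q) \<le> \<alpha> * \<beta> / (2 * real \<gamma>)"
    proof -
      have "ln (2 * c0 / (\<alpha> * \<beta>)) \<le> \<bar>ln (2 * c0 / (\<alpha> * \<beta>))\<bar> / l0 * l0" using l0 by simp
      also have "\<dots> \<le> \<bar>ln (2 * c0 / (\<alpha> * \<beta>))\<bar> / l0 * ll" using ll l0 by (intro mult_left_mono) auto
      finally have "ln (2 * c0 / (\<alpha> * \<beta>)) + ll \<le> C0 * ll" by (simp add: C0_def distrib_right)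
      then have "exp (- (C0 * ll)) \<le> exp (- (ln (2 * c0 / (\<alpha> * \<beta>)) + ll))" by simp
      also have "\<dots> = inverse (2 * c0 / (\<alpha> * \<beta>) * ln (real n))"
      proof -
        have "exp ll = ln (real n)" using lb by (simp add: ll_def)
        moreover have "exp (ln (2 * c0 / (\<alpha> * \<beta>))) = 2 * c0 / (\<alpha> * \<beta>)" using c0 \<alpha> \<beta> by simp
        ultimately show ?thesis by (simp only: exp_minus exp_add)
      qed
      also have "\<dots> = \<alpha> * \<beta> / (2 * (c0 * ln (real n)))" by (simp add: field_simps)
      also have "\<dots> \<le> \<alpha> * \<beta> / (2 * real \<gamma>)" using gb \<alpha> \<beta> c0 n by (intro divide_left_mono) auto
      finally have "exp (- (C0 * ll)) \<le> \<alpha> * \<beta> / (2 * real \<gamma>)" .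
      moreover have "exp (- 2 * real q) \<le> exp (- (C0 * ll))" using q(2) by simp
      ultimately show ?thesis by linarith
    qed
    have hd: "holder_dist P s L N"
      by unfold_locales (use P s L N(1) in \<open>auto simp: alt_dists_def\<close>)
    interpret H: holder_dist P s L N by (rule hd)
    define R where "R = sqrt (real N ^ d)"
    have R2: "R\<^sup>2 = real N ^ d" by (simp add: R_def)
    have R: "1 \<le> R" using N(1) by (simp add: R_def)
    have kap: "ll * R\<^sup>2 \<le> 2 ^ d * n"
    proof -
      have "real N ^ d \<le> (2 * k0) ^ d" using N by (intro power_mono) auto
      also have "\<dots> \<le> 2 ^ d * (n / ll)" unfolding power_mult_distrib using rc(2) by (intro mult_left_mono) auto
      finally have "ll * real N ^ d \<le> ll * (2 ^ d * (n / ll))" using ll by (intro mult_left_mono) auto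
      then show ?thesis using ll by (simp add: R2)
    qed
    have eps2: "C\<^sup>2 * k0 powr (- 2 * s) \<le> (L2_norm (\<lambda>x. joint_density P x - product_density P x))\<^sup>2"
    proof -
      have "(ll / n) powr (2 * s / (4 * s + d)) = k0 powr (- s)"
        using ll n0 by (simp add: k0_def powr_powr powr_divide powr_minus_divide)
      then have "C * k0 powr (- s) \<le> L2_norm (\<lambda>x. joint_density P x - product_density P x)"
        using eps P unfolding ll_def[symmetric] d_def[symmetric] by (simp add: alt_dists_def)
      then have "(C * k0 powr (- s))\<^sup>2 \<le> (L2_norm (\<lambda>x. joint_density P x - product_density P x))\<^sup>2"
        using C by (intro power_mono) auto
      moreover have "(C * k0 powr (- s))\<^sup>2 = C\<^sup>2 * k0 powr (- 2 * s)"
        by (simp add: power_mult_distrib power2_eq_square[of "k0 powr _"] powr_add[symmetric])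
      ultimately show ?thesis by simp
    qed
    have th: "b * ll / n \<le> R * H.\<theta>"
    proof -
      have "(L2_norm (\<lambda>x. joint_density P x - product_density P x))\<^sup>2 \<le> CA * (real N ^ d * H.\<theta> + real N powr (- 2 * s))"
        using H.L2_distance_le[OF CA_le[OF N(1)]] unfolding dim .
      also have "\<dots> \<le> CA * (real N ^ d * H.\<theta> + k0 powr (- 2 * s))"
        using CA N rc(3) s by (intro mult_left_mono add_left_mono powr_mono2') auto
      finally have "C\<^sup>2 * k0 powr (- 2 * s) \<le> CA * (real N ^ d * H.\<theta> + k0 powr (- 2 * s))" using eps2 by linarith
      then have "CA * (2 * (1 + b * sqrt (2 ^ d)) * k0 powr (- 2 * s)) \<le> CA * (real N ^ d * H.\<theta> + k0 powr (- 2 * s))"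
        unfolding C2 by (simp add: mult_ac)
      then have "2 * (1 + b * sqrt (2 ^ d)) * k0 powr (- 2 * s) \<le> real N ^ d * H.\<theta> + k0 powr (- 2 * s)"
        using CA by (simp only: mult_le_cancel_left_pos)
      moreover have "0 \<le> k0 powr (- 2 * s)" "0 \<le> b * sqrt (2 ^ d) * k0 powr (- 2 * s)" using b by auto
      moreover have "2 * (1 + b * sqrt (2 ^ d)) * k0 powr (- 2 * s)
          = 2 * k0 powr (- 2 * s) + 2 * (b * sqrt (2 ^ d) * k0 powr (- 2 * s))" by (simp add: algebra_simps)
      \<comment> \<open>The bias on the right is cancelled by half of the term 2 * k0^(-2 s) on the
        left.\<close>
      ultimately have "b * sqrt (2 ^ d) * k0 powr (- 2 * s) \<le> real N ^ d * H.\<theta>" by linarith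
      then have "b * (sqrt (2 ^ d) * sqrt (k0 ^ d)) * (ll / n) \<le> R * (R * H.\<theta>)"
        unfolding rc(4) R2[symmetric] by (simp add: power2_eq_square mult_ac)
      moreover have "R \<le> sqrt (2 ^ d) * sqrt (k0 ^ d)"
      proof -
        have "real N ^ d \<le> (2 * k0) ^ d" using N by (intro power_mono) auto
        then show ?thesis unfolding R_def real_sqrt_mult[symmetric] power_mult_distrib[symmetric]
          by (rule real_sqrt_le_mono)
      qed
      then have "b * R * (ll / n) \<le> b * (sqrt (2 ^ d) * sqrt (k0 ^ d)) * (ll / n)"
        using b ll n0 by (intro mult_right_mono mult_left_mono) auto
      ultimately have "R * (b * ll / n) \<le> R * (R * H.\<theta>)" by (simp add: mult_ac)
      then show ?thesis using R by (simp only: mult_le_cancel_left_pos)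
    qed
    have thpos: "0 < H.\<theta>"
    proof -
      have "0 < b * ll / n" using b ll n0 by simp
      then have "0 < R * H.\<theta>" using th by linarith
      then show ?thesis using R by (simp add: zero_less_mult_iff)
    qed
    \<comment> \<open>Four blocks fit into the sample, and n \<ge> 4 guarantees that they are
      nonempty and cover at least half of it.\<close>
    define m where "m = n div 4"
    have m: "0 < m" "4 * m \<le> n" "m \<le> n" "n \<le> 8 * m" using n unfolding m_def by presburger+
    have HM: "H.M = M" unfolding H.M_def M_def dim ..
    have rho: "H.M / real N ^ DIM((real^'d1) \<times> (real^'d2)) = M / R\<^sup>2" unfolding HM dim R2 ..
    have cc: "real (card (cells N \<times> cells N :: ((real^'d1 \<Rightarrow> nat) \<times> (real^'d2 \<Rightarrow> nat)) set)) = R\<^sup>2"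
      unfolding H.card_cells dim R2 ..
    have scc: "sqrt (R\<^sup>2) = R" using R by simp
    have "H.E {1..n} (\<lambda>w. of_bool (cell_U n w \<le> cell_crit a n w))
      \<le> (128 * (M / R\<^sup>2) * H.\<theta> / m + 256 * R\<^sup>2 * (M / R\<^sup>2)\<^sup>2 / (real m)\<^sup>2) / (4 * H.\<theta>\<^sup>2)
      + (384 * real q * R * (2 * real q + real m * (M / R\<^sup>2)) / (real m)\<^sup>2 / (2 * H.\<theta>)) ^ (2 * q) / a"
      using H.type_two_error_le[OF m(1,2) q(1) a thpos] unfolding rho cc scc .
    also have "\<dots> \<le> \<beta>"
      unfolding a_def
      by (rule type_two_arith[OF m(1) _ m(3) qC1 l0 ll(2) R kap th ex b(2,3) M \<alpha>(1) \<beta> _ C1 b(1)])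
         (use m(4) gb(1) in auto)
    finally have le: "ennreal (H.E {1..n} (\<lambda>w. of_bool (cell_U n w \<le> cell_crit a n w))) \<le> ennreal \<beta>"
      by (rule ennreal_leI)
    let ?M = "iid_sample n P"
    have "\<exists>T\<in>sets ?M. {X. single_test N a n X = 0} \<inter> space ?M \<subseteq> T \<and>
        emeasure ?M T \<le> ennreal (H.E {1..n} (\<lambda>w. of_bool (cell_U n w \<le> cell_crit a n w)))"
    proof (rule holder_dist_bridge[OF hd])
      fix X :: "nat \<Rightarrow> (real^'d1) \<times> (real^'d2)"
      assume X: "X \<in> {X. single_test N a n X = 0}" "\<And>i. i \<in> {1..n} \<Longrightarrow> X i \<in> unit_cube"
      have "single_test N a n X = of_bool (cell_U n (\<lambda>i\<in>{1..n}. cell_pair N (X i))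
          > cell_crit a n (\<lambda>i\<in>{1..n}. cell_pair N (X i)))"
        using N(1) X(2) by (rule single_test_eq)
      with X(1) show "cell_U n (\<lambda>i\<in>{1..n}. cell_pair N (X i))
          \<le> cell_crit a n (\<lambda>i\<in>{1..n}. cell_pair N (X i))"
        by (simp only: mem_Collect_eq of_bool_eq_0_iff not_less)
    qed
    then obtain T where T: "T \<in> sets ?M" "{X. single_test N a n X = 0} \<inter> space ?M \<subseteq> T" "emeasure ?M T \<le> ennreal \<beta>"
      using order_trans[OF _ le] by blast
    have "test_prob n P (adaptive_test \<alpha> n) 0 \<le> emeasure ?M T"
      unfolding test_prob_def
    proof (rule emeasure_mono[OF _ T(1)])
      show "{X \<in> space ?M. adaptive_test \<alpha> n X = 0} \<subseteq> T"
      proof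
        fix X assume X: "X \<in> {X \<in> space ?M. adaptive_test \<alpha> n X = 0}"
        then have "single_test N a n X = 0"
          using adaptive_test_cases(2)[OF gb(1)[unfolded \<gamma>_def d_def], of \<alpha> X j] j(1)
          unfolding N_def a_def \<gamma>_def d_def by simp
        then show "X \<in> T" using X subsetD[OF T(2), of X] by auto
      qed
    qed
    then show "test_prob n P (adaptive_test \<alpha> n) 0 \<le> ennreal \<beta>" using T(3) by (rule order_trans)
  qed
qed

theorem proposition7p2:
  fixes s L \<alpha> \<beta> :: real
  assumes "s > 0"
    and "4 * s > real (CARD('d1::finite) + CARD('d2::finite))"
    and "L > 0"
    and "0 < \<alpha>" and "\<alpha> < exp (-1)"
    and "0 < \<beta>" and "\<beta> < 1 - \<alpha>"
  shows "\<exists>C>0. \<forall>n\<ge>4. \<forall>\<epsilon>::real.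
    \<epsilon> \<ge> C * (ln (ln (real n)) / real n)
            powr (2 * s / (4 * s + real (CARD('d1) + CARD('d2)))) \<longrightarrow>
      (SUP P\<in>(null_dists s L :: ((real^'d1) \<times> (real^'d2)) measure set).
         test_prob n P (adaptive_test \<alpha> n) 1) \<le> ennreal \<alpha> \<and>
      (SUP P\<in>(alt_dists s L \<epsilon> :: ((real^'d1) \<times> (real^'d2)) measure set).
         test_prob n P (adaptive_test \<alpha> n) 0) \<le> ennreal \<beta>"
proof -
  have a1: "\<alpha> < 1" and b1: "\<beta> \<le> 1" using assms by linarith+
  obtain C where "C > 0" and C: "\<And>n \<epsilon> P. 4 \<le> n \<Longrightarrow> C * (ln (ln (real n)) / real n)
            powr (2 * s / (4 * s + real (CARD('d1) + CARD('d2)))) \<le> \<epsilon> \<Longrightarrow>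
      P \<in> (alt_dists s L \<epsilon> :: ((real^'d1) \<times> (real^'d2)) measure set) \<Longrightarrow>
         test_prob n P (adaptive_test \<alpha> n) 0 \<le> ennreal \<beta>"
    using type_two_error[OF assms(1-4) a1 assms(6) b1] by blast
  show ?thesis
  proof (intro exI[of _ C] conjI allI impI SUP_least)
    show "C > 0" by fact
  qed (use type_one_error[OF _ assms(1,3,4) a1] C in auto)
qed

end
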